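(* Assume that $\mathrm{A}$, $\mathbf{B}$, the coefficients $(\beta_k)$ and the Poisson random measures $(\eta_k)$ satisfy the conditions (A), (B), (N), (L) and (SD) listed in the context. Let $\{\mathcal{P}_t;t\ge0\}$ be the Markov semigroup associated with the solution $\mathbf{u}$ of $$d\mathbf{u}(t)+[\kappa \mathrm{A}\mathbf{u}(t)+\mathbf{B}(\mathbf{u}(t),\mathbf{u}(t))]\,dt=\sum_{k=1}^\infty\int_{\mathbb{R}_0}\beta_k z e_k\,d\bar\eta_k(z,t),\qquad \mathbf{u}(0)=\xi\in\mathbf{H}.$$ Then the point $0\in\mathbf{H}$ is accessible for $\{\mathcal{P}_t;t\ge0\}$.
   Context: Spaces. $\mathbf{H}=\{\mathbf{u}=(\mathbf{u}_1,\mathbf{u}_2,\ldots)\in(\mathbb{R}^2)^\infty:\sum_n|\mathbf{u}_n|^2<\infty\}$ is a real Hilbert space with scalar product $\langle\mathbf{u},\mathbf{v}\rangle=\sum_n\mathbf{u}_n\cdot\mathbf{v}_n$ (also written $(\mathbf{u},\mathbf{v})$) and norm $|\cdot|$; $\kappa>0$ is a constant. (A) $\mathrm{A}$ is a self-adjoint positive linear operator on $\mathbf{H}$ whose domain $D(\mathrm{A})$ is dense and compactly embedded in $\mathbf{H}$; its eigenvalues are $\lambda_j=k_0\lambda^{2j}$, $j\ge1$, for some $k_0>0$, $\lambda>1$; and its eigenvectors $e_1,e_2,\ldots$ ($\mathrm{A}e_j=\lambda_je_j$) form an orthonormal basis of $\mathbf{H}$. Put $\mathbf{V}=D(\mathrm{A}^{1/2})$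 with norm $\Vert\cdot\Vert=|\cdot|+|\mathrm{A}^{1/2}\cdot|$ and dual $\mathbf{V}^\ast$, with $\mathbf{V}\subset\mathbf{H}\subset\mathbf{V}^\ast$ a Gelfand triple; $\langle\cdot,\cdot\rangle$ also denotes the duality between $\mathbf{V}^\ast$ and $\mathbf{V}$. (B) $\mathbf{B}:\mathbf{H}\times\mathbf{H}\to\mathbf{V}^\ast$ is bilinear and there are constants $C_0,C_1>0$ such that: $\Vert\mathbf{B}(\mathbf{u},\mathbf{v})\Vert_{\mathbf{V}^\ast}\le C_0|\mathbf{u}||\mathbf{v}|$ for $\mathbf{u},\mathbf{v}\in\mathbf{H}$; $|\mathbf{B}(\mathbf{u},\mathbf{v})|\le C_1\Vert\mathbf{u}\Vert|\mathbf{v}|$ for $\mathbf{u}\in\mathbf{V},\mathbf{v}\in\mathbf{H}$; $|\mathbf{B}(\mathbf{u},\mathbf{v})|\le C_1|\mathbf{u}|\Vert\mathbf{v}\Vert$ for $\mathbf{u}\in\mathbf{H},\mathbf{v}\in\mathbf{V}$; $\langle\mathbf{B}(\mathbf{u},\mathbf{v}),\mathbf{v}\rangle=0$ for $\mathbf{u}\in\mathbf{H},\mathbf{v}\in\mathbf{V}$. (N) $\beta_j=\lambda_j^{-\theta}$ for all $j$, for some $\theta\in(\frac14,\frac12)$. Noise. $(\Omega,\mathcal{F},\mathbb{P})$ is a complete probability space with filtration $\mathbb{F}=(\mathcal{F}_t)_{t\ge0}$ satisfying the usual conditions. $\eta_1,\eta_2,\ldots$ are Poisson random measures on $\mathbb{R}_0\times[0,\infty)$,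 $\mathbb{R}_0=\mathbb{R}\setminus\{0\}$, adapted to $\mathbb{F}$, with $\sigma$-finite Lévy measures on $\mathbb{R}_0$; $\tilde\eta_k$ is the compensated measure of $\eta_k$, and $d\bar\eta_k(z,t)=\mathbf{1}_{|z|\le1}\,\tilde\eta_k(dz,dt)+\mathbf{1}_{|z|>1}\,\eta_k(dz,dt)$. Put $L(t)=\sum_{k}\int_0^t\int_{\mathbb{R}_0}\beta_kze_k\,d\bar\eta_k(z,s)$. (L) (i) The $\eta_k$ are independent and identically distributed, with common Lévy measure $\nu$ (compensator $\nu(dz)dt$). (ii) $\nu(dz)=g(z)dz$ with a $C^1$ function $g:\mathbb{R}_0\to(0,\infty)$ such that for every $p\ge1$ there is $C_p>0$ with $|g'(z)/g(z)|^p\le C_p(1+|z|^{-p})$ for all $z\in\mathbb{R}_0$. (iii) $z^2g(z)\to0$ as $|z|\to\infty$ and $\int_{\mathbb{R}_0}|z|^q\nu(dz)<\infty$ for every $q\ge1$. (iv) There is $\alpha>0$ such that for every $y\in\mathbb{R}\setminus\{0\}$, $\liminf_{\varepsilon\searrow0}\varepsilon^\alpha\int_{\mathbb{R}_0}(|zy/\varepsilon|^2\wedge1)\,\nu(dz)>0$. (SD) (small deviation property condition) Either $\int_{-1}^1|z|\nu(dz)=\infty$; or $\int_{-1}^1|z|\nu(dz)<\infty$ and, with $\mathcal{E}=-\int_{|z|\le1}z\,\nu(dz)$, one of the following holds: $\mathcal{E}=0$; or $\mathcal{E}>0$ and $\nu([-\varepsilon,0))\ne0$ for all $\varepsilon>0$;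 or $\mathcal{E}<0$ and $\nu((0,\varepsilon])\ne0$ for all $\varepsilon>0$. Solution. For $T>0$, an $\mathbb{F}$-adapted $\mathbf{H}$-valued process $\mathbf{u}$ is a solution on $[0,T]$ if $\mathbf{u}\in L^2(0,T;\mathbf{V})$ $\mathbb{P}$-a.s. and, for every $t\in[0,T]$ and $\phi\in\mathbf{V}$, $\mathbb{P}$-a.s. $(\mathbf{u}(t),\phi)=(\xi,\phi)-\int_0^t\langle\kappa\mathrm{A}\mathbf{u}(s)+\mathbf{B}(\mathbf{u}(s),\mathbf{u}(s)),\phi\rangle ds+\langle L(t),\phi\rangle$. Under conditions (A), (B), (N) and (L), for every $\xi\in\mathbf{H}$ there is a unique solution $\mathbf{u}(\cdot,\xi)$, which is a Markov process; its Markov semigroup is $\mathcal{P}_t\Phi(\xi)=\mathbb{E}[\Phi(\mathbf{u}(t,\xi))]$ for $\Phi$ bounded measurable on $\mathbf{H}$. Accessibility. The resolvent is $\mathcal{R}_\lambda(\xi,\mathcal{U})=\int_0^\infty e^{-\lambda t}[\mathcal{P}_t\mathbf{1}_{\mathcal{U}}](\xi)\,dt$ for $\mathcal{U}\subset\mathbf{H}$ measurable, $\lambda>0$, $\xi\in\mathbf{H}$ (here $\lambda$ is a resolvent parameter, unrelated to the number in (A)). A point $\mathbf{x}\in\mathbf{H}$ is accessible if $\mathcal{R}_\lambda(\xi,\mathcal{U})>0$ for every $\xi\in\mathbf{H}$ and every open neighbourhood $\mathcal{U}$ of $\mathbf{x}$. *)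

theory Defs
  imports "HOL-Probability.Probability"
begin

section \<open>The space of square summable sequences in the plane\<close>

text \<open>
  Sequences, eigenvectors, noise coefficients and Poisson random measures are all indexed from \<open>0\<close>
  instead of \<open>1\<close>; hence the exponent \<open>2 * (j + 1)\<close> in the eigenvalues below.
\<close>

typedef shell_space = "{u :: nat \<Rightarrow> real^2. summable (\<lambda>n. (norm (u n))\<^sup>2)}"
  morphisms shell Abs_shell_space
  by (rule exI[of _ "\<lambda>_. 0"]) simp

setup_lifting type_definition_shell_space

lemma summable_shell: "summable (\<lambda>n. (norm (shell u n))\<^sup>2)"
  using shell[of u] by simp

lemma summable_norm2_add:
  fixes u v :: "nat \<Rightarrow> 'a::real_inner"
  assumes "summable (\<lambda>n. (norm (u n))\<^sup>2)" "summable (\<lambda>n. (norm (v n))\<^sup>2)"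
  shows "summable (\<lambda>n. (norm (u n + v n))\<^sup>2)"
proof (rule summable_comparison_test')
  show "summable (\<lambda>n. 2 * (norm (u n))\<^sup>2 + 2 * (norm (v n))\<^sup>2)"
    by (intro summable_add summable_mult assms)
  fix n
  have "(norm (u n + v n))\<^sup>2 + (norm (u n - v n))\<^sup>2 = 2 * (norm (u n))\<^sup>2 + 2 * (norm (v n))\<^sup>2"
    by (simp add: power2_norm_eq_inner algebra_simps inner_commute)
  then have "(norm (u n + v n))\<^sup>2 \<le> 2 * (norm (u n))\<^sup>2 + 2 * (norm (v n))\<^sup>2"
    using zero_le_power2[of "norm (u n - v n)"] by linarith
  then show "norm ((norm (u n + v n))\<^sup>2) \<le> 2 * (norm (u n))\<^sup>2 + 2 * (norm (v n))\<^sup>2"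
    by simp
qed

lemma summable_norm2_inner:
  fixes u v :: "nat \<Rightarrow> 'a::real_inner"
  assumes "summable (\<lambda>n. (norm (u n))\<^sup>2)" "summable (\<lambda>n. (norm (v n))\<^sup>2)"
  shows "summable (\<lambda>n. u n \<bullet> v n)"
proof -
  have eq: "u n \<bullet> v n = ((norm (u n + v n))\<^sup>2 - (norm (u n))\<^sup>2 - (norm (v n))\<^sup>2) / 2" for n
    by (simp add: power2_norm_eq_inner algebra_simps inner_commute)
  show ?thesis
    unfolding eq by (intro summable_divide summable_diff summable_norm2_add assms)
qed

instantiation shell_space :: real_vector
begin

lift_definition zero_shell_space :: shell_space is "\<lambda>_. 0" by simp
lift_definition plus_shell_space :: "shell_space \<Rightarrow> shell_space \<Rightarrow> shell_space"
  is "\<lambda>u v n. u n + v n" by (rule summable_norm2_add)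
lift_definition uminus_shell_space :: "shell_space \<Rightarrow> shell_space"
  is "\<lambda>u n. - u n" by simp
lift_definition minus_shell_space :: "shell_space \<Rightarrow> shell_space \<Rightarrow> shell_space"
  is "\<lambda>u v n. u n - v n"
  using summable_norm2_add[of _ "\<lambda>n. - v n" for v] by fastforce
lift_definition scaleR_shell_space :: "real \<Rightarrow> shell_space \<Rightarrow> shell_space"
  is "\<lambda>c u n. c *\<^sub>R u n" by (simp add: power_mult_distrib summable_mult)

instance
  by standard (transfer; auto simp: algebra_simps)+

end

instantiation shell_space :: real_inner
begin

definition inner_shell_space :: "shell_space \<Rightarrow> shell_space \<Rightarrow> real"
  where "inner_shell_space u v = (\<Sum>n. shell u n \<bullet> shell v n)"
definition norm_shell_space :: "shell_space \<Rightarrow> real"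
  where "norm_shell_space u = sqrt (inner u u)"
definition sgn_shell_space :: "shell_space \<Rightarrow> shell_space"
  where "sgn_shell_space u = inverse (norm u) *\<^sub>R u"
definition dist_shell_space :: "shell_space \<Rightarrow> shell_space \<Rightarrow> real"
  where "dist_shell_space u v = norm (u - v)"
definition uniformity_shell_space :: "(shell_space \<times> shell_space) filter"
  where "uniformity_shell_space = (INF e\<in>{0<..}. principal {(u, v). dist u v < e})"
definition open_shell_space :: "shell_space set \<Rightarrow> bool"
  where "open_shell_space U \<longleftrightarrow> (\<forall>u\<in>U. eventually (\<lambda>(u', v). u' = u \<longrightarrow> v \<in> U) uniformity)"

instance
proof
  fix u v w :: shell_space and c :: real
  have sm: "summable (\<lambda>n. shell a n \<bullet> shell b n)" for a b
    by (intro summable_norm2_inner summable_shell)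
  show "u \<bullet> v = v \<bullet> u"
    by (simp add: inner_shell_space_def inner_commute)
  show "(u + v) \<bullet> w = u \<bullet> w + v \<bullet> w"
    by (simp add: inner_shell_space_def plus_shell_space.rep_eq inner_add_left suminf_add sm)
  show "(c *\<^sub>R u) \<bullet> v = c * (u \<bullet> v)"
    by (simp add: inner_shell_space_def scaleR_shell_space.rep_eq suminf_mult sm)
  show "0 \<le> u \<bullet> u"
    by (simp add: inner_shell_space_def suminf_nonneg sm)
  show "u \<bullet> u = 0 \<longleftrightarrow> u = 0"
  proof
    assume "u \<bullet> u = 0"
    then have "\<forall>n. shell u n \<bullet> shell u n = 0"
      using suminf_eq_zero_iff[OF sm[of u u]] by (simp add: inner_shell_space_def)
    then show "u = 0" by (simp add: shell_inject[symmetric] zero_shell_space.rep_eq fun_eq_iff)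
  qed (simp add: inner_shell_space_def zero_shell_space.rep_eq)
qed (rule norm_shell_space_def sgn_shell_space_def dist_shell_space_def
       uniformity_shell_space_def open_shell_space_def)+

end

lemma norm2_shell_space: "(norm u)\<^sup>2 = (\<Sum>n. (norm (shell u n))\<^sup>2)"
  by (simp add: power2_norm_eq_inner inner_shell_space_def)

lemma sum_norm2_shell_le: "(\<Sum>n<N. (norm (shell u n))\<^sup>2) \<le> (norm u)\<^sup>2"
  unfolding norm2_shell_space by (rule sum_le_suminf) (auto simp: summable_shell)

lemma norm_shell_le: "norm (shell u n) \<le> norm u"
proof -
  have "(norm (shell u n))\<^sup>2 \<le> (\<Sum>k<Suc n. (norm (shell u k))\<^sup>2)"
    by (simp add: sum_nonneg)
  also have "\<dots> \<le> (norm u)\<^sup>2" by (rule sum_norm2_shell_le)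
  finally show ?thesis by (rule power2_le_imp_le) simp
qed

lemma shell_diff: "shell (u - v) n = shell u n - shell v n"
  by (simp add: minus_shell_space.rep_eq)

instance shell_space :: complete_space
proof
  fix X :: "nat \<Rightarrow> shell_space"
  assume X: "Cauchy X"
  have "Cauchy (\<lambda>i. shell (X i) n)" for n
  proof (rule metric_CauchyI)
    fix e :: real assume "0 < e"
    then obtain M where M: "\<And>i j. i \<ge> M \<Longrightarrow> j \<ge> M \<Longrightarrow> dist (X i) (X j) < e"
      using X unfolding Cauchy_def by blast
    have "dist (shell (X i) n) (shell (X j) n) < e" if "i \<ge> M" "j \<ge> M" for i j
      using norm_shell_le[of "X i - X j" n] M[OF that] by (simp add: dist_norm shell_diff)
    then show "\<exists>M. \<forall>i\<ge>M. \<forall>j\<ge>M. dist (shell (X i) n) (shell (X j) n) < e" by blast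
  qed
  then have l: "(\<lambda>i. shell (X i) n) \<longlonglongrightarrow> lim (\<lambda>i. shell (X i) n)" for n
    by (simp add: Cauchy_convergent convergent_LIMSEQ_iff[symmetric])
  define l where "l n = lim (\<lambda>i. shell (X i) n)" for n
  note l = l[folded l_def]
  have bound: "\<exists>M. \<forall>i\<ge>M. \<forall>N. (\<Sum>n<N. (norm (shell (X i) n - l n))\<^sup>2) \<le> e\<^sup>2" if "0 < e" for e
  proof -
    obtain M where M: "\<And>i j. i \<ge> M \<Longrightarrow> j \<ge> M \<Longrightarrow> dist (X i) (X j) < e"
      using X \<open>0 < e\<close> unfolding Cauchy_def by blast
    have "(\<Sum>n<N. (norm (shell (X i) n - l n))\<^sup>2) \<le> e\<^sup>2" if "i \<ge> M" for i N
    proof (rule LIMSEQ_le_const2)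
      show "(\<lambda>j. \<Sum>n<N. (norm (shell (X i) n - shell (X j) n))\<^sup>2)
              \<longlonglongrightarrow> (\<Sum>n<N. (norm (shell (X i) n - l n))\<^sup>2)"
        by (intro tendsto_intros l)
      have "(\<Sum>n<N. (norm (shell (X i) n - shell (X j) n))\<^sup>2) \<le> e\<^sup>2" if "j \<ge> M" for j
        using sum_norm2_shell_le[where u = "X i - X j" and N = N] M[OF \<open>i \<ge> M\<close> that]
          power_mono[of "norm (X i - X j)" e 2]
        by (simp add: shell_diff dist_norm)
      then show "\<exists>J. \<forall>j\<ge>J. (\<Sum>n<N. (norm (shell (X i) n - shell (X j) n))\<^sup>2) \<le> e\<^sup>2" by blast
    qed
    then show ?thesis by blast
  qed
  have diff: "summable (\<lambda>n. (norm (shell (X i) n - l n))\<^sup>2)"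
    if "\<forall>N. (\<Sum>n<N. (norm (shell (X i) n - l n))\<^sup>2) \<le> e\<^sup>2" for i e
    using that by (intro bounded_imp_summable[where B = "e\<^sup>2"])
      (auto simp: lessThan_Suc_atMost[symmetric] simp del: sum.lessThan_Suc)
  obtain M where "\<forall>N. (\<Sum>n<N. (norm (shell (X M) n - l n))\<^sup>2) \<le> 1\<^sup>2"
    using bound[of 1] by auto
  from diff[OF this] have "summable (\<lambda>n. (norm (l n - shell (X M) n))\<^sup>2)"
    by (simp add: norm_minus_commute)
  from summable_norm2_add[OF this summable_shell[of "X M"]]
  have suml: "summable (\<lambda>n. (norm (l n))\<^sup>2)" by simp
  define L where "L = Abs_shell_space l"
  have L: "shell L = l" unfolding L_def using suml by (simp add: Abs_shell_space_inverse)
  have "X \<longlonglongrightarrow> L"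
  proof (rule LIMSEQ_I)
    fix r :: real assume "0 < r"
    then obtain M where M: "\<forall>i\<ge>M. \<forall>N. (\<Sum>n<N. (norm (shell (X i) n - l n))\<^sup>2) \<le> (r/2)\<^sup>2"
      using bound[of "r/2"] by auto
    have "norm (X i - L) < r" if "i \<ge> M" for i
    proof -
      have "(norm (X i - L))\<^sup>2 \<le> (r/2)\<^sup>2"
        unfolding norm2_shell_space shell_diff L
        using M that diff[of i "r/2"] by (intro suminf_le_const) auto
      then have "norm (X i - L) \<le> r/2"
        by (rule power2_le_imp_le) (use \<open>0 < r\<close> in simp)
      then show ?thesis using \<open>0 < r\<close> by simp
    qed
    then show "\<exists>M. \<forall>i\<ge>M. norm (X i - L) < r" by blast
  qed
  then show "convergent X" by (auto simp: convergent_def)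
qed


section \<open>The linear operator and the Gelfand triple\<close>

text \<open>An unbounded operator is a pair of a domain \<open>D\<close> and a function \<open>A\<close> whose values off \<open>D\<close> are
  irrelevant.\<close>

definition linear_operator :: "'h::real_inner set \<Rightarrow> ('h \<Rightarrow> 'h) \<Rightarrow> bool" where
  "linear_operator D A \<longleftrightarrow> subspace D \<and>
     (\<forall>x\<in>D. \<forall>y\<in>D. A (x + y) = A x + A y) \<and> (\<forall>c. \<forall>x\<in>D. A (c *\<^sub>R x) = c *\<^sub>R A x)"

definition adjoint_domain :: "'h::real_inner set \<Rightarrow> ('h \<Rightarrow> 'h) \<Rightarrow> 'h set" where
  "adjoint_domain D A = {y. \<exists>w. \<forall>x\<in>D. A x \<bullet> y = x \<bullet> w}"

definition self_adjoint_operator :: "'h::real_inner set \<Rightarrow> ('h \<Rightarrow> 'h) \<Rightarrow> bool" where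
  "self_adjoint_operator D A \<longleftrightarrow> linear_operator D A \<and> closure D = UNIV \<and>
     adjoint_domain D A = D \<and> (\<forall>x\<in>D. \<forall>y\<in>D. A x \<bullet> y = x \<bullet> A y)"

definition eigenvalues :: "'h::real_vector set \<Rightarrow> ('h \<Rightarrow> 'h) \<Rightarrow> real set" where
  "eigenvalues D A = {\<mu>. \<exists>x\<in>D. x \<noteq> 0 \<and> A x = \<mu> *\<^sub>R x}"

definition orthonormal_basis :: "(nat \<Rightarrow> 'h::real_inner) \<Rightarrow> bool" where
  "orthonormal_basis e \<longleftrightarrow>
     (\<forall>i j. e i \<bullet> e j = (if i = j then 1 else 0)) \<and> closure (span (range e)) = UNIV"

definition shell_eigenvalue :: "real \<Rightarrow> real \<Rightarrow> nat \<Rightarrow> real" where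
  "shell_eigenvalue k0 lam j = k0 * lam ^ (2 * (j + 1))"

definition condition_A ::
  "shell_space set \<Rightarrow> (shell_space \<Rightarrow> shell_space) \<Rightarrow> real \<Rightarrow> real \<Rightarrow> (nat \<Rightarrow> shell_space) \<Rightarrow> bool" where
  "condition_A D A k0 lam e \<longleftrightarrow>
     self_adjoint_operator D A \<and> (\<forall>x\<in>D. 0 \<le> A x \<bullet> x) \<and>
     compact (closure {x \<in> D. norm x + norm (A x) \<le> 1}) \<and>
     0 < k0 \<and> 1 < lam \<and> eigenvalues D A = range (shell_eigenvalue k0 lam) \<and>
     (\<forall>j. e j \<in> D \<and> A (e j) = shell_eigenvalue k0 lam j *\<^sub>R e j) \<and> orthonormal_basis e"

text \<open>The square root of the positive operator with eigenvalues \<open>\<mu> j\<close> and orthonormal eigenbasis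
  \<open>e\<close>, given by the spectral calculus.\<close>

definition sqrt_domain :: "(nat \<Rightarrow> real) \<Rightarrow> (nat \<Rightarrow> 'h::real_inner) \<Rightarrow> 'h set" where
  "sqrt_domain \<mu> e = {x. summable (\<lambda>j. \<mu> j * (x \<bullet> e j)\<^sup>2)}"

definition sqrt_op :: "(nat \<Rightarrow> real) \<Rightarrow> (nat \<Rightarrow> 'h::real_inner) \<Rightarrow> 'h \<Rightarrow> 'h" where
  "sqrt_op \<mu> e x =
     (if x \<in> sqrt_domain \<mu> e then (\<Sum>j. (sqrt (\<mu> j) * (x \<bullet> e j)) *\<^sub>R e j) else 0)"

definition V_norm :: "(nat \<Rightarrow> real) \<Rightarrow> (nat \<Rightarrow> 'h::real_inner) \<Rightarrow> 'h \<Rightarrow> real" where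
  "V_norm \<mu> e x = norm x + norm (sqrt_op \<mu> e x)"

text \<open>Elements of the dual of \<open>V\<close> are represented by functions on the whole space that vanish off \<open>V\<close>,
  so that equality in the dual is equality of functions; the duality is application.\<close>

definition V_dual :: "(nat \<Rightarrow> real) \<Rightarrow> (nat \<Rightarrow> 'h::real_inner) \<Rightarrow> ('h \<Rightarrow> real) set" where
  "V_dual \<mu> e = {f.
     (\<forall>x\<in>sqrt_domain \<mu> e. \<forall>y\<in>sqrt_domain \<mu> e. f (x + y) = f x + f y) \<and>
     (\<forall>c. \<forall>x\<in>sqrt_domain \<mu> e. f (c *\<^sub>R x) = c * f x) \<and>
     (\<exists>K. \<forall>x\<in>sqrt_domain \<mu> e. \<bar>f x\<bar> \<le> K * V_norm \<mu> e x) \<and>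
     (\<forall>x. x \<notin> sqrt_domain \<mu> e \<longrightarrow> f x = 0)}"

definition V_dual_norm :: "(nat \<Rightarrow> real) \<Rightarrow> (nat \<Rightarrow> 'h::real_inner) \<Rightarrow> ('h \<Rightarrow> real) \<Rightarrow> real" where
  "V_dual_norm \<mu> e f = (SUP x\<in>{x \<in> sqrt_domain \<mu> e. V_norm \<mu> e x \<le> 1}. \<bar>f x\<bar>)"

definition H_to_V_dual :: "(nat \<Rightarrow> real) \<Rightarrow> (nat \<Rightarrow> 'h::real_inner) \<Rightarrow> 'h \<Rightarrow> 'h \<Rightarrow> real" where
  "H_to_V_dual \<mu> e h = (\<lambda>x. if x \<in> sqrt_domain \<mu> e then h \<bullet> x else 0)"

text \<open>The extension of \<open>A\<close> to \<open>V\<close> with values in the dual of \<open>V\<close>, through the form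
  \<open>(A\<^sup>1\<^sup>/\<^sup>2 u, A\<^sup>1\<^sup>/\<^sup>2 x)\<close>.\<close>

definition V_operator :: "(nat \<Rightarrow> real) \<Rightarrow> (nat \<Rightarrow> 'h::real_inner) \<Rightarrow> 'h \<Rightarrow> 'h \<Rightarrow> real" where
  "V_operator \<mu> e u = (\<lambda>x. sqrt_op \<mu> e u \<bullet> sqrt_op \<mu> e x)"

definition condition_B ::
  "(nat \<Rightarrow> real) \<Rightarrow> (nat \<Rightarrow> shell_space) \<Rightarrow>
   (shell_space \<Rightarrow> shell_space \<Rightarrow> shell_space \<Rightarrow> real) \<Rightarrow> bool" where
  "condition_B \<mu> e B \<longleftrightarrow>
     (\<forall>u v. B u v \<in> V_dual \<mu> e) \<and>
     (\<forall>v x. linear (\<lambda>u. B u v x)) \<and> (\<forall>u x. linear (\<lambda>v. B u v x)) \<and>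
     (\<exists>C\<^sub>0>0. \<exists>C\<^sub>1>0.
        (\<forall>u v. V_dual_norm \<mu> e (B u v) \<le> C\<^sub>0 * norm u * norm v) \<and>
        (\<forall>u\<in>sqrt_domain \<mu> e. \<forall>v.
           \<exists>h. B u v = H_to_V_dual \<mu> e h \<and> norm h \<le> C\<^sub>1 * V_norm \<mu> e u * norm v) \<and>
        (\<forall>u. \<forall>v\<in>sqrt_domain \<mu> e.
           \<exists>h. B u v = H_to_V_dual \<mu> e h \<and> norm h \<le> C\<^sub>1 * norm u * V_norm \<mu> e v) \<and>
        (\<forall>u. \<forall>v\<in>sqrt_domain \<mu> e. B u v v = 0))"

definition condition_N :: "(nat \<Rightarrow> real) \<Rightarrow> (nat \<Rightarrow> real) \<Rightarrow> bool" where
  "condition_N \<mu> \<beta> \<longleftrightarrow> (\<exists>\<theta>. 1/4 < \<theta> \<and> \<theta> < 1/2 \<and> (\<forall>j. \<beta> j = \<mu> j powr (- \<theta>)))"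


section \<open>Poisson random measures\<close>

definition usual_filtration :: "'w measure \<Rightarrow> (real \<Rightarrow> 'w measure) \<Rightarrow> bool" where
  "usual_filtration M F \<longleftrightarrow>
     (\<forall>t\<ge>0. subalgebra M (F t)) \<and> (\<forall>s\<ge>0. \<forall>t\<ge>s. sets (F s) \<subseteq> sets (F t)) \<and>
     null_sets M \<subseteq> sets (F 0) \<and> (\<forall>t\<ge>0. sets (F t) = (\<Inter>s\<in>{t<..}. sets (F s)))"

definition levy_measure :: "real measure \<Rightarrow> bool" where
  "levy_measure \<nu> \<longleftrightarrow> sets \<nu> = sets (restrict_space borel (- {0})) \<and> sigma_finite_measure \<nu> \<and>
     (\<integral>\<^sup>+z. ennreal (min 1 (z\<^sup>2)) \<partial>\<nu>) < \<infinity>"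

definition jump_intensity :: "real measure \<Rightarrow> (real \<times> real) measure" where
  "jump_intensity \<nu> = \<nu> \<Otimes>\<^sub>M restrict_space lborel {0..}"

definition random_measure_events ::
  "'w measure \<Rightarrow> ('w \<Rightarrow> 'a measure) \<Rightarrow> 'a set set \<Rightarrow> 'w set set" where
  "random_measure_events M \<eta> \<A> =
     sigma_sets (space M) {(\<lambda>\<omega>. emeasure (\<eta> \<omega>) A) -` E \<inter> space M | A E. A \<in> \<A> \<and> E \<in> sets borel}"

definition poisson_random_measure ::
  "'w measure \<Rightarrow> 'a measure \<Rightarrow> ('w \<Rightarrow> 'a measure) \<Rightarrow> bool" where
  "poisson_random_measure M \<mu> \<eta> \<longleftrightarrow>
     (\<forall>\<omega>\<in>space M. sets (\<eta> \<omega>) = sets \<mu> \<and>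
        (\<forall>A\<in>sets \<mu>. emeasure (\<eta> \<omega>) A \<in> insert \<infinity> (range of_nat))) \<and>
     (\<forall>A\<in>sets \<mu>. (\<lambda>\<omega>. emeasure (\<eta> \<omega>) A) \<in> borel_measurable M) \<and>
     (\<forall>A\<in>sets \<mu>. emeasure \<mu> A < \<infinity> \<longrightarrow>
        (\<forall>n. measure M {\<omega> \<in> space M. emeasure (\<eta> \<omega>) A = of_nat n} =
              measure \<mu> A ^ n / fact n * exp (- measure \<mu> A))) \<and>
     (\<forall>A\<in>sets \<mu>. emeasure \<mu> A = \<infinity> \<longrightarrow> (AE \<omega> in M. emeasure (\<eta> \<omega>) A = \<infinity>)) \<and>
     (\<forall>A. range A \<subseteq> sets \<mu> \<longrightarrow> disjoint_family A \<longrightarrow>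
        prob_space.indep_vars M (\<lambda>_. borel) (\<lambda>i \<omega>. emeasure (\<eta> \<omega>) (A i)) (UNIV :: nat set))"

text \<open>Adaptedness of a Poisson random measure includes, as usual, that its restriction to times after
  \<open>s\<close> is independent of the past up to \<open>s\<close>.\<close>

definition adapted_random_measure ::
  "'w measure \<Rightarrow> (real \<Rightarrow> 'w measure) \<Rightarrow> real measure \<Rightarrow> ('w \<Rightarrow> (real \<times> real) measure) \<Rightarrow> bool" where
  "adapted_random_measure M F \<nu> \<eta> \<longleftrightarrow>
     (\<forall>t\<ge>0. \<forall>A\<in>sets (jump_intensity \<nu>). A \<subseteq> UNIV \<times> {0..t} \<longrightarrow>
        (\<lambda>\<omega>. emeasure (\<eta> \<omega>) A) \<in> borel_measurable (F t)) \<and>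
     (\<forall>s\<ge>0. prob_space.indep_set M (sets (F s))
        (random_measure_events M \<eta> {A \<in> sets (jump_intensity \<nu>). A \<subseteq> UNIV \<times> {s<..}}))"

text \<open>The random measures share the intensity \<open>\<nu>(dz) dt\<close>, which makes them identically distributed.\<close>

definition driving_measures ::
  "'w measure \<Rightarrow> (real \<Rightarrow> 'w measure) \<Rightarrow> real measure \<Rightarrow> (nat \<Rightarrow> 'w \<Rightarrow> (real \<times> real) measure) \<Rightarrow> bool" where
  "driving_measures M F \<nu> \<eta> \<longleftrightarrow> levy_measure \<nu> \<and>
     (\<forall>k. poisson_random_measure M (jump_intensity \<nu>) (\<eta> k) \<and> adapted_random_measure M F \<nu> (\<eta> k)) \<and>
     prob_space.indep_sets M
       (\<lambda>k. random_measure_events M (\<eta> k) (sets (jump_intensity \<nu>))) UNIV"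

text \<open>Only the conditions on the Levy measure itself; independence and identical distribution are
  in \<open>driving_measures\<close>.\<close>

definition condition_L :: "real measure \<Rightarrow> bool" where
  "condition_L \<nu> \<longleftrightarrow>
     (\<exists>g :: real \<Rightarrow> real.
        \<nu> = density (restrict_space lborel (- {0})) (\<lambda>z. ennreal (g z)) \<and>
        (\<forall>z. z \<noteq> 0 \<longrightarrow> 0 < g z \<and> g field_differentiable (at z)) \<and>
        continuous_on (- {0}) (deriv g) \<and>
        (\<forall>p::real. p \<ge> 1 \<longrightarrow>
           (\<exists>C>0. \<forall>z. z \<noteq> 0 \<longrightarrow> \<bar>deriv g z / g z\<bar> powr p \<le> C * (1 + \<bar>z\<bar> powr (- p)))) \<and>
        ((\<lambda>z. z\<^sup>2 * g z) \<longlongrightarrow> 0) at_infinity) \<and>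
     (\<forall>q::real. q \<ge> 1 \<longrightarrow> (\<integral>\<^sup>+z. ennreal (\<bar>z\<bar> powr q) \<partial>\<nu>) < \<infinity>) \<and>
     (\<exists>\<alpha>::real. \<alpha> > 0 \<and> (\<forall>y::real. y \<noteq> 0 \<longrightarrow>
        0 < Liminf (at_right 0)
              (\<lambda>\<epsilon>. ennreal (\<epsilon> powr \<alpha>) * (\<integral>\<^sup>+z. ennreal (min (\<bar>z * y / \<epsilon>\<bar>\<^sup>2) 1) \<partial>\<nu>))))"

definition condition_SD :: "real measure \<Rightarrow> bool" where
  "condition_SD \<nu> \<longleftrightarrow>
     (let I = (\<integral>\<^sup>+z\<in>{-1..1}. ennreal \<bar>z\<bar> \<partial>\<nu>); E = - (\<integral>z\<in>{-1..1}. z \<partial>\<nu>) in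
      I = \<infinity> \<or>
      (I < \<infinity> \<and>
        (E = 0 \<or>
         (E > 0 \<and> (\<forall>\<epsilon>>0. emeasure \<nu> {-\<epsilon>..<0} \<noteq> 0)) \<or>
         (E < 0 \<and> (\<forall>\<epsilon>>0. emeasure \<nu> {0<..\<epsilon>} \<noteq> 0)))))"


section \<open>The noise\<close>

text \<open>The compensated integral of \<open>z\<close> over \<open>0 < \<bar>z\<bar> \<le> 1\<close> up to time \<open>t\<close> is the mean square limit of
  the compensated integrals over \<open>\<epsilon> < \<bar>z\<bar> \<le> 1\<close>, on which the intensity is finite. It is determined
  only up to null sets, hence a relation.\<close>

definition truncated_small_jumps ::
  "real measure \<Rightarrow> (real \<times> real) measure \<Rightarrow> real \<Rightarrow> real \<Rightarrow> real" where
  "truncated_small_jumps \<nu> m t \<epsilon> =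
     (\<integral>p\<in>{z. \<epsilon> < \<bar>z\<bar> \<and> \<bar>z\<bar> \<le> 1} \<times> {0<..t}. fst p \<partial>m) -
     (\<integral>p\<in>{z. \<epsilon> < \<bar>z\<bar> \<and> \<bar>z\<bar> \<le> 1} \<times> {0<..t}. fst p \<partial>jump_intensity \<nu>)"

definition is_small_jump_integral ::
  "'w measure \<Rightarrow> real measure \<Rightarrow> ('w \<Rightarrow> (real \<times> real) measure) \<Rightarrow> real \<Rightarrow> ('w \<Rightarrow> real) \<Rightarrow> bool" where
  "is_small_jump_integral M \<nu> \<eta> t X \<longleftrightarrow> X \<in> borel_measurable M \<and>
     ((\<lambda>\<epsilon>. \<integral>\<^sup>+\<omega>. ennreal ((truncated_small_jumps \<nu> (\<eta> \<omega>) t \<epsilon> - X \<omega>)\<^sup>2) \<partial>M) \<longlongrightarrow> 0) (at_right 0)"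

definition large_jump_integral :: "(real \<times> real) measure \<Rightarrow> real \<Rightarrow> real" where
  "large_jump_integral m t = (\<integral>p\<in>{z. 1 < \<bar>z\<bar>} \<times> {0<..t}. fst p \<partial>m)"

text \<open>\<open>L\<close> is a version of the noise. The terms of the series are independent, so almost sure
  convergence is the same as convergence in probability.\<close>

definition is_noise ::
  "'w measure \<Rightarrow> real measure \<Rightarrow> (nat \<Rightarrow> 'w \<Rightarrow> (real \<times> real) measure) \<Rightarrow> (nat \<Rightarrow> real) \<Rightarrow>
   (nat \<Rightarrow> 'h::real_inner) \<Rightarrow> (real \<Rightarrow> 'w \<Rightarrow> 'h) \<Rightarrow> bool" where
  "is_noise M \<nu> \<eta> \<beta> e L \<longleftrightarrow>
     (\<forall>t\<ge>0. L t \<in> borel_measurable M \<and>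
        (\<exists>X. (\<forall>k. is_small_jump_integral M \<nu> (\<eta> k) t (X k)) \<and>
             (AE \<omega> in M. (\<lambda>k. (\<beta> k * (X k \<omega> + large_jump_integral (\<eta> k \<omega>) t)) *\<^sub>R e k) sums L t \<omega>)))"


section \<open>Solutions and accessibility\<close>

text \<open>Joint measurability in time and sample is part of the notion of a process here: without it
  the pathwise time integrals of \<open>u\<close> would not be determined by the random variables \<open>u t\<close>, even
  almost surely.\<close>

definition is_solution ::
  "'w measure \<Rightarrow> (real \<Rightarrow> 'w measure) \<Rightarrow> (nat \<Rightarrow> real) \<Rightarrow> (nat \<Rightarrow> shell_space) \<Rightarrow> real \<Rightarrow>
   (shell_space \<Rightarrow> shell_space \<Rightarrow> shell_space \<Rightarrow> real) \<Rightarrow> (real \<Rightarrow> 'w \<Rightarrow> shell_space) \<Rightarrow>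
   shell_space \<Rightarrow> real \<Rightarrow> (real \<Rightarrow> 'w \<Rightarrow> shell_space) \<Rightarrow> bool" where
  "is_solution M F \<mu> e \<kappa> B L \<xi> T u \<longleftrightarrow>
     (\<forall>t\<in>{0..T}. u t \<in> borel_measurable (F t)) \<and>
     (\<lambda>(t, \<omega>). u t \<omega>) \<in> borel_measurable (restrict_space borel {0..T} \<Otimes>\<^sub>M M) \<and>
     (AE \<omega> in M. (AE t in lborel. t \<in> {0..T} \<longrightarrow> u t \<omega> \<in> sqrt_domain \<mu> e) \<and>
                 set_integrable lborel {0..T} (\<lambda>t. (V_norm \<mu> e (u t \<omega>))\<^sup>2)) \<and>
     (\<forall>t\<in>{0..T}. \<forall>\<phi>\<in>sqrt_domain \<mu> e. AE \<omega> in M.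
        u t \<omega> \<bullet> \<phi> = \<xi> \<bullet> \<phi>
          - (\<integral>s\<in>{0..t}. (\<kappa> * V_operator \<mu> e (u s \<omega>) \<phi> + B (u s \<omega>) (u s \<omega>) \<phi>) \<partial>lborel)
          + L t \<omega> \<bullet> \<phi>)"

definition solution_semigroup ::
  "'w measure \<Rightarrow> ('h \<Rightarrow> real \<Rightarrow> 'w \<Rightarrow> 'h) \<Rightarrow> real \<Rightarrow> ('h \<Rightarrow> real) \<Rightarrow> 'h \<Rightarrow> real" where
  "solution_semigroup M u t \<Phi> \<xi> = (\<integral>\<omega>. \<Phi> (u \<xi> t \<omega>) \<partial>M)"

definition resolvent :: "(real \<Rightarrow> ('h \<Rightarrow> real) \<Rightarrow> 'h \<Rightarrow> real) \<Rightarrow> real \<Rightarrow> 'h \<Rightarrow> 'h set \<Rightarrow> real" where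
  "resolvent P r \<xi> U = (\<integral>t\<in>{0..}. exp (- r * t) * P t (indicator U) \<xi> \<partial>lborel)"

definition accessible ::
  "(real \<Rightarrow> ('h \<Rightarrow> real) \<Rightarrow> 'h \<Rightarrow> real) \<Rightarrow> 'h::topological_space \<Rightarrow> bool" where
  "accessible P x \<longleftrightarrow> (\<forall>r>0. \<forall>\<xi> U. open U \<longrightarrow> x \<in> U \<longrightarrow> 0 < resolvent P r \<xi> U)"

end

theory Submission
  imports Defs
begin

text \<open>
  The resolvent of a neighbourhood \<open>U\<close> of \<open>0\<close> is positive as soon as, for some \<open>T\<close> and with positive
  probability, the path spends a set of times of positive Lebesgue measure in \<open>U\<close> before \<open>T\<close>
  (\<open>resolvent_positive\<close>). This holds because the noise can stay small for as long as one likes, and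
  without noise the dissipation drives every solution to the origin.

  To compare with the noiseless equation, let \<open>m\<^sub>j\<close> be the \<open>j\<close>-th coordinate of the noise, read off from
  the equation, and \<open>z\<^sub>j\<close> the solution \<open>ou (\<kappa> \<mu>\<^sub>j) m\<^sub>j\<close> of the linear equation driven by it. The
  differences \<open>v\<^sub>j = u\<^sub>j - z\<^sub>j\<close> are absolutely continuous:
  \<open>v\<^sub>j = \<xi>\<^sub>j - \<integral> (\<kappa> \<mu>\<^sub>j v\<^sub>j + \<langle>B(u,u), e\<^sub>j\<rangle>)\<close>. A solution is only known to lie in \<open>L\<^sup>2(0,T;V)\<close>, so the energy
  is computed for the truncation \<open>p = \<Sum>j<n. v\<^sub>j e\<^sub>j\<close>. As \<open>\<langle>B(u,p),p\<rangle> = 0\<close>, the trilinear term is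
  \<open>\<langle>B(u,u-p),p\<rangle>\<close>, and the coordinates of \<open>u - p\<close> are \<open>z\<^sub>j\<close> for \<open>j < n\<close> and \<open>u\<^sub>j\<close> for \<open>j \<ge> n\<close>; the latter
  contribute little for large \<open>n\<close>. Hence, if \<open>\<integral>\<^sub>0\<^sup>T \<Sum>j. \<mu>\<^sub>j z\<^sub>j\<^sup>2\<close> is below a threshold depending on \<open>T\<close>, then
  \<open>\<integral>\<^sub>0\<^sup>T \<bar>u\<bar>\<^sup>2\<close> is bounded independently of \<open>T\<close>, and for large \<open>T\<close> the norm of \<open>u\<close> cannot stay above a given
  level (\<open>energy_estimate\<close>).

  It remains to see that \<open>\<integral>\<^sub>0\<^sup>T \<Sum>j. \<mu>\<^sub>j z\<^sub>j\<^sup>2\<close> is small with positive probability. In the first \<open>N\<close>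
  components one prescribes the jumps larger than \<open>\<epsilon>\<close>: one jump of size about \<open>c \<tau>\<close> in each time
  interval of length \<open>\<tau>\<close>, and no other, where \<open>c\<close> is the drift of the compensated process. These
  jumps undo the drift (\<open>quiet_path\<close>), and since the Levy density is positive everywhere, the event \<open>G\<close> that they
  occur has positive probability (\<open>quiet_counts\<close>). Conditioning on \<open>G\<close> changes neither the law of
  the jumps below \<open>\<epsilon>\<close> nor that of the components \<open>j \<ge> N\<close> (\<open>poisson_counts_conditioned\<close>), so second
  moments of Poisson integrals bound the rest: on \<open>G\<close> the first \<open>N\<close> coordinates of the noise are as small as wished, and
  the others have increments of variance at most \<open>K \<beta>\<^sub>j\<^sup>2 (t - s)\<close> (\<open>quiet_event\<close>). The linear
  semigroup gains the factor \<open>1 / \<mu>\<^sub>j\<close> (\<open>ou_moment\<close>), which leaves the tail of the convergent series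
  \<open>\<Sum>j. \<beta>\<^sub>j\<^sup>2\<close>. Choosing \<open>N\<close> first and \<open>G\<close> afterwards makes the conditional expectation of
  \<open>\<integral>\<^sub>0\<^sup>T \<Sum>j. \<mu>\<^sub>j z\<^sub>j\<^sup>2\<close> smaller than the threshold (\<open>hitting_near_zero\<close>).
\<close>

section \<open>Orthonormal series and the space V\<close>

lemma orthonormalD:
  assumes "orthonormal_basis e"
  shows "e i \<bullet> e j = (if i = j then 1 else 0)"
  using assms by (auto simp: orthonormal_basis_def)

lemma inner_orthonormal_sum:
  assumes "orthonormal_basis e" "finite I"
  shows "(\<Sum>j\<in>I. c j *\<^sub>R e j) \<bullet> e k = (if k \<in> I then c k else 0)"
  using assms(2) by (simp add: inner_sum_left orthonormalD[OF assms(1)] if_distrib cong: if_cong)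

lemma norm2_orthonormal_sum:
  assumes "orthonormal_basis e" "finite I"
  shows "(norm (\<Sum>j\<in>I. c j *\<^sub>R e j))\<^sup>2 = (\<Sum>j\<in>I. (c j)\<^sup>2)"
proof -
  have "(norm (\<Sum>j\<in>I. c j *\<^sub>R e j))\<^sup>2 = (\<Sum>j\<in>I. c j *\<^sub>R e j) \<bullet> (\<Sum>k\<in>I. c k *\<^sub>R e k)"
    by (simp add: power2_norm_eq_inner)
  also have "\<dots> = (\<Sum>k\<in>I. c k * ((\<Sum>j\<in>I. c j *\<^sub>R e j) \<bullet> e k))"
    by (simp add: inner_sum_right)
  also have "\<dots> = (\<Sum>k\<in>I. (c k)\<^sup>2)"
    by (rule sum.cong) (simp_all add: inner_orthonormal_sum[OF assms] power2_eq_square)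
  finally show ?thesis .
qed

lemma orthonormal_series_convergent:
  fixes e :: "nat \<Rightarrow> 'h::{real_inner,complete_space}"
  assumes e: "orthonormal_basis e" and c: "summable (\<lambda>j. (c j)\<^sup>2)"
  shows "\<exists>x. (\<lambda>j. c j *\<^sub>R e j) sums x"
proof -
  have "Cauchy (\<lambda>n. \<Sum>j<n. c j *\<^sub>R e j)"
  proof (rule metric_CauchyI)
    fix r :: real assume r: "0 < r"
    then obtain N where N: "\<And>m n. m \<ge> N \<Longrightarrow> norm (\<Sum>j=m..<n. (c j)\<^sup>2) < r\<^sup>2"
      using c[unfolded summable_Cauchy, rule_format, of "r\<^sup>2"] by auto
    have aux: "dist (\<Sum>j<m. c j *\<^sub>R e j) (\<Sum>j<n. c j *\<^sub>R e j) < r" if "m \<ge> N" "m \<le> n" for m n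
    proof -
      have "(\<Sum>j<n. c j *\<^sub>R e j) - (\<Sum>j<m. c j *\<^sub>R e j) = (\<Sum>j=m..<n. c j *\<^sub>R e j)"
        using that by (simp add: lessThan_atLeast0 sum_diff_nat_ivl)
      then have "(dist (\<Sum>j<m. c j *\<^sub>R e j) (\<Sum>j<n. c j *\<^sub>R e j))\<^sup>2 = (\<Sum>j=m..<n. (c j)\<^sup>2)"
        by (metis dist_commute dist_norm norm2_orthonormal_sum[OF e] finite_atLeastLessThan)
      also have "\<dots> < r\<^sup>2" using N[OF that(1), of n] by simp
      finally show ?thesis using r by (simp add: power2_less_imp_less)
    qed
    have "dist (\<Sum>j<m. c j *\<^sub>R e j) (\<Sum>j<n. c j *\<^sub>R e j) < r" if "m \<ge> N" "n \<ge> N" for m n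
      using aux[of m n] aux[of n m] that by (cases "m \<le> n") (auto simp: dist_commute)
    then show "\<exists>M. \<forall>m\<ge>M. \<forall>n\<ge>M. dist (\<Sum>j<m. c j *\<^sub>R e j) (\<Sum>j<n. c j *\<^sub>R e j) < r" by blast
  qed
  then show ?thesis
    unfolding sums_def using Cauchy_convergent convergent_def by blast
qed

lemma orthonormal_series_inner:
  assumes e: "orthonormal_basis e" and x: "(\<lambda>j. c j *\<^sub>R e j) sums x"
  shows "x \<bullet> e k = c k"
proof -
  have "(\<lambda>j. (c j *\<^sub>R e j) \<bullet> e k) sums (x \<bullet> e k)"
    using bounded_linear.sums[OF bounded_linear_inner_left x] .
  moreover have "(\<lambda>j. (c j *\<^sub>R e j) \<bullet> e k) sums c k"
    using sums_single[of k c] by (simp add: orthonormalD[OF e] if_distrib eq_commute cong: if_cong)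
  ultimately show ?thesis by (rule sums_unique2)
qed

lemma orthonormal_series_norm:
  assumes e: "orthonormal_basis e" and x: "(\<lambda>j. c j *\<^sub>R e j) sums x"
  shows "(\<lambda>j. (c j)\<^sup>2) sums (norm x)\<^sup>2"
proof -
  have "(\<lambda>n. (norm (\<Sum>j<n. c j *\<^sub>R e j))\<^sup>2) \<longlonglongrightarrow> (norm x)\<^sup>2"
    using x unfolding sums_def by (intro tendsto_intros)
  then show ?thesis
    unfolding sums_def by (simp add: norm2_orthonormal_sum[OF e])
qed

lemma bessel_finite:
  assumes e: "orthonormal_basis e"
  shows "(\<Sum>j<n. (x \<bullet> e j)\<^sup>2) \<le> (norm x)\<^sup>2"
proof -
  let ?p = "\<Sum>j<n. (x \<bullet> e j) *\<^sub>R e j"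
  have "x \<bullet> ?p = (\<Sum>j<n. (x \<bullet> e j)\<^sup>2)"
    by (simp add: inner_sum_right power2_eq_square)
  then have "(norm (x - ?p))\<^sup>2 = (norm x)\<^sup>2 - 2 * (\<Sum>j<n. (x \<bullet> e j)\<^sup>2) + (norm ?p)\<^sup>2"
    by (simp add: power2_norm_eq_inner inner_diff_left inner_diff_right inner_commute)
  then have "(norm (x - ?p))\<^sup>2 = (norm x)\<^sup>2 - (\<Sum>j<n. (x \<bullet> e j)\<^sup>2)"
    by (simp add: norm2_orthonormal_sum[OF e])
  then show ?thesis using zero_le_power2[of "norm (x - ?p)"] by linarith
qed

text \<open>The difference of \<open>x\<close> and the sum of its series is orthogonal to the dense span of the basis.\<close>

lemma parseval:
  fixes e :: "nat \<Rightarrow> 'h::{real_inner,complete_space}"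
  assumes e: "orthonormal_basis e"
  shows "(\<lambda>j. (x \<bullet> e j)\<^sup>2) sums (norm x)\<^sup>2"
proof -
  have "summable (\<lambda>j. (x \<bullet> e j)\<^sup>2)"
    using bessel_finite[OF e, of x]
    by (intro bounded_imp_summable[where B = "(norm x)\<^sup>2"]) (auto simp: lessThan_Suc_atMost[symmetric] simp del: sum.lessThan_Suc)
  from orthonormal_series_convergent[OF e this]
  obtain y where y: "(\<lambda>j. (x \<bullet> e j) *\<^sub>R e j) sums y" by blast
  let ?Z = "{w. (x - y) \<bullet> w = 0}"
  have "e j \<in> ?Z" for j
    using orthonormal_series_inner[OF e y, of j] by (simp add: inner_diff_left)
  moreover have "subspace ?Z" by (auto simp: subspace_def inner_add_right)
  ultimately have "span (range e) \<subseteq> ?Z" by (intro span_minimal) auto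
  moreover have "closed ?Z" by (intro closed_Collect_eq continuous_intros)
  ultimately have "?Z = UNIV"
    using e closure_minimal[of "span (range e)" ?Z] by (auto simp: orthonormal_basis_def)
  then have "(x - y) \<bullet> (x - y) = 0" by blast
  then have "x = y" by simp
  then show ?thesis using orthonormal_series_norm[OF e y] by simp
qed

lemma sqrt_op_sums:
  fixes e :: "nat \<Rightarrow> 'h::{real_inner,complete_space}"
  assumes e: "orthonormal_basis e" and \<mu>: "\<And>j. 0 \<le> \<mu> j" and x: "x \<in> sqrt_domain \<mu> e"
  shows "(\<lambda>j. (sqrt (\<mu> j) * (x \<bullet> e j)) *\<^sub>R e j) sums sqrt_op \<mu> e x"
proof -
  have "summable (\<lambda>j. (sqrt (\<mu> j) * (x \<bullet> e j))\<^sup>2)"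
    using x \<mu> by (simp add: sqrt_domain_def power_mult_distrib)
  from orthonormal_series_convergent[OF e this] show ?thesis
    using x by (auto simp: sqrt_op_def sums_iff)
qed

lemma norm_sqrt_op:
  fixes e :: "nat \<Rightarrow> 'h::{real_inner,complete_space}"
  assumes e: "orthonormal_basis e" and \<mu>: "\<And>j. 0 \<le> \<mu> j" and x: "x \<in> sqrt_domain \<mu> e"
  shows "(\<lambda>j. \<mu> j * (x \<bullet> e j)\<^sup>2) sums (norm (sqrt_op \<mu> e x))\<^sup>2"
  using orthonormal_series_norm[OF e sqrt_op_sums[OF e \<mu> x]] \<mu> by (simp add: power_mult_distrib)

lemma basis_in_sqrt_domain:
  assumes e: "orthonormal_basis e"
  shows "e k \<in> sqrt_domain \<mu> e"
  unfolding sqrt_domain_def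
  by (auto simp: orthonormalD[OF e] intro!: summable_finite[of "{k}"] split: if_splits)

lemma subspace_sqrt_domain:
  assumes \<mu>: "\<And>j. 0 \<le> \<mu> j"
  shows "subspace (sqrt_domain \<mu> e)"
  unfolding subspace_def
proof (intro conjI ballI allI)
  show "0 \<in> sqrt_domain \<mu> e" by (simp add: sqrt_domain_def)
  fix x assume x: "x \<in> sqrt_domain \<mu> e"
  show "c *\<^sub>R x \<in> sqrt_domain \<mu> e" for c
    using summable_mult[of "\<lambda>j. \<mu> j * (x \<bullet> e j)\<^sup>2" "c\<^sup>2"] x
    by (simp add: sqrt_domain_def power_mult_distrib mult_ac)
  fix y assume y: "y \<in> sqrt_domain \<mu> e"
  have "summable (\<lambda>j. 2 * (\<mu> j * (x \<bullet> e j)\<^sup>2) + 2 * (\<mu> j * (y \<bullet> e j)\<^sup>2))"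
    using x y by (intro summable_add summable_mult) (auto simp: sqrt_domain_def)
  moreover have "\<mu> j * ((x + y) \<bullet> e j)\<^sup>2 \<le> 2 * (\<mu> j * (x \<bullet> e j)\<^sup>2) + 2 * (\<mu> j * (y \<bullet> e j)\<^sup>2)" for j
  proof -
    have "((x + y) \<bullet> e j)\<^sup>2 \<le> 2 * (x \<bullet> e j)\<^sup>2 + 2 * (y \<bullet> e j)\<^sup>2"
      using zero_le_power2[of "x \<bullet> e j - y \<bullet> e j"] by (simp add: inner_add_left power2_eq_square algebra_simps)
    from mult_left_mono[OF this \<mu>[of j]] show ?thesis by (simp add: algebra_simps)
  qed
  ultimately show "x + y \<in> sqrt_domain \<mu> e"
    unfolding sqrt_domain_def using \<mu> by (auto intro: summable_comparison_test')
qed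

lemma V_operator_basis:
  fixes e :: "nat \<Rightarrow> 'h::{real_inner,complete_space}"
  assumes e: "orthonormal_basis e" and \<mu>: "\<And>j. 0 \<le> \<mu> j" and x: "x \<in> sqrt_domain \<mu> e"
  shows "V_operator \<mu> e x (e k) = \<mu> k * (x \<bullet> e k)"
proof -
  have "(\<lambda>j. (sqrt (\<mu> j) * (e k \<bullet> e j)) *\<^sub>R e j) sums (sqrt (\<mu> k) *\<^sub>R e k)"
    using sums_single[of k "\<lambda>j. sqrt (\<mu> j) *\<^sub>R e j"]
    by (simp add: orthonormalD[OF e] if_distrib if_distribR eq_commute cong: if_cong)
  with sqrt_op_sums[OF e \<mu> basis_in_sqrt_domain[OF e]]
  have "sqrt_op \<mu> e (e k) = sqrt (\<mu> k) *\<^sub>R e k" by (rule sums_unique2)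
  then show ?thesis
    using orthonormal_series_inner[OF e sqrt_op_sums[OF e \<mu> x], of k] \<mu>[of k]
    by (simp add: V_operator_def)
qed

lemma norm_le_energy:
  fixes e :: "nat \<Rightarrow> 'h::{real_inner,complete_space}"
  assumes e: "orthonormal_basis e" and \<mu>0: "0 < \<mu>0" and \<mu>: "\<And>j. \<mu>0 \<le> \<mu> j"
    and s: "(\<lambda>j. \<mu> j * (x \<bullet> e j)\<^sup>2) sums q"
  shows "(norm x)\<^sup>2 \<le> q / \<mu>0"
proof -
  have "(x \<bullet> e j)\<^sup>2 \<le> \<mu> j * (x \<bullet> e j)\<^sup>2 / \<mu>0" for j
    using mult_right_mono[OF \<mu>[of j], of "(x \<bullet> e j)\<^sup>2"] \<mu>0 by (simp add: field_simps)
  moreover have "(\<lambda>j. \<mu> j * (x \<bullet> e j)\<^sup>2 / \<mu>0) sums (q / \<mu>0)" using s by (rule sums_divide)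
  ultimately show ?thesis by (rule sums_le[OF _ parseval[OF e]])
qed

lemma V_norm_le_energy:
  fixes e :: "nat \<Rightarrow> 'h::{real_inner,complete_space}"
  assumes e: "orthonormal_basis e" and \<mu>0: "0 < \<mu>0" and \<mu>: "\<And>j. \<mu>0 \<le> \<mu> j"
    and s: "(\<lambda>j. \<mu> j * (x \<bullet> e j)\<^sup>2) sums q"
  shows "x \<in> sqrt_domain \<mu> e" "V_norm \<mu> e x \<le> (1 + 1 / sqrt \<mu>0) * sqrt q"
proof -
  have \<mu>p: "\<And>j. 0 \<le> \<mu> j" using \<mu>0 \<mu> by (meson less_imp_le order_trans)
  show x: "x \<in> sqrt_domain \<mu> e" using s by (auto simp: sqrt_domain_def sums_iff)
  have q: "(norm (sqrt_op \<mu> e x))\<^sup>2 = q"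
    using norm_sqrt_op[OF e \<mu>p x] s by (rule sums_unique2)
  then have "norm (sqrt_op \<mu> e x) = sqrt q" by (metis norm_ge_zero real_sqrt_unique)
  moreover have "norm x \<le> sqrt q / sqrt \<mu>0"
    using norm_le_energy[OF e \<mu>0 \<mu> s] by (simp add: real_le_rsqrt flip: real_sqrt_divide)
  ultimately show "V_norm \<mu> e x \<le> (1 + 1 / sqrt \<mu>0) * sqrt q"
    by (simp add: V_norm_def algebra_simps)
qed

text \<open>The cancellation \<open>\<langle>B(u,v),v\<rangle> = 0\<close> removes the part of \<open>u\<close> along \<open>p\<close> from the trilinear term.\<close>

lemma trilinear_bound:
  assumes e: "orthonormal_basis e" and \<mu>0: "0 < \<mu>0" and \<mu>: "\<And>j. \<mu>0 \<le> \<mu> j"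
    and B: "condition_B \<mu> e B"
  shows "\<exists>C>0. \<forall>x p q. p \<in> sqrt_domain \<mu> e \<longrightarrow> (\<lambda>j. \<mu> j * ((x - p) \<bullet> e j)\<^sup>2) sums q \<longrightarrow>
           \<bar>B x x p\<bar> \<le> C * norm x * sqrt q * norm p"
proof -
  obtain C1 where C1: "0 < C1" and est: "\<And>u v. v \<in> sqrt_domain \<mu> e \<Longrightarrow>
           \<exists>h. B u v = H_to_V_dual \<mu> e h \<and> norm h \<le> C1 * norm u * V_norm \<mu> e v"
    and skew: "\<And>u v. v \<in> sqrt_domain \<mu> e \<Longrightarrow> B u v v = 0"
    using B unfolding condition_B_def by blast
  have lin: "\<And>u x. linear (\<lambda>v. B u v x)" using B unfolding condition_B_def by blast
  define C where "C = C1 * (1 + 1 / sqrt \<mu>0)"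
  have C: "0 < C" unfolding C_def using C1 \<mu>0 by (simp add: add_pos_pos)
  have "\<bar>B x x p\<bar> \<le> C * norm x * sqrt q * norm p"
    if p: "p \<in> sqrt_domain \<mu> e" and s: "(\<lambda>j. \<mu> j * ((x - p) \<bullet> e j)\<^sup>2) sums q" for x p q
  proof -
    note w = V_norm_le_energy[OF e \<mu>0 \<mu> s]
    obtain h where h: "B x (x - p) = H_to_V_dual \<mu> e h" "norm h \<le> C1 * norm x * V_norm \<mu> e (x - p)"
      using est[OF w(1)] by blast
    have "B x x p = B x (x - p) p + B x p p"
      using linear_diff[OF lin, of x x p p] by simp
    then have "\<bar>B x x p\<bar> = \<bar>h \<bullet> p\<bar>" using skew[OF p] h(1) p by (simp add: H_to_V_dual_def)
    also have "\<dots> \<le> norm h * norm p" by (rule Cauchy_Schwarz_ineq2)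
    also have "\<dots> \<le> (C1 * norm x * ((1 + 1 / sqrt \<mu>0) * sqrt q)) * norm p"
      by (intro mult_right_mono order_trans[OF h(2)] mult_left_mono w(2)) (use C1 in auto)
    finally show ?thesis by (simp add: C_def mult_ac)
  qed
  then show ?thesis using C by blast
qed

lemma V_dual_sum:
  fixes e :: "nat \<Rightarrow> 'h::real_inner"
  assumes f: "f \<in> V_dual \<mu> e" and e: "orthonormal_basis e" and \<mu>: "\<And>j. 0 \<le> \<mu> j"
  shows "f (\<Sum>j<n. c j *\<^sub>R e j) = (\<Sum>j<n. c j * f (e j))" "(\<Sum>j<n. c j *\<^sub>R e j) \<in> sqrt_domain \<mu> e"
proof (induction n)
  case 0
  note sub = subspace_sqrt_domain[where \<mu> = \<mu> and e = e, OF \<mu>]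
  have "f (0 *\<^sub>R 0) = 0 * f 0" using f subspace_0[OF sub] unfolding V_dual_def by blast
  then show "f (\<Sum>j<0. c j *\<^sub>R e j) = (\<Sum>j<0. c j * f (e j))" by simp
  show "(\<Sum>j<0. c j *\<^sub>R e j) \<in> sqrt_domain \<mu> e" using subspace_0[OF sub] by simp
next
  case (Suc n)
  note sub = subspace_sqrt_domain[where \<mu> = \<mu> and e = e, OF \<mu>]
  have en: "c n *\<^sub>R e n \<in> sqrt_domain \<mu> e" "e n \<in> sqrt_domain \<mu> e"
    using basis_in_sqrt_domain[OF e] subspace_scale[OF sub] by auto
  have "f ((\<Sum>j<n. c j *\<^sub>R e j) + c n *\<^sub>R e n) = f (\<Sum>j<n. c j *\<^sub>R e j) + f (c n *\<^sub>R e n)"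
    "f (c n *\<^sub>R e n) = c n * f (e n)"
    using f Suc en unfolding V_dual_def by blast+
  then show "f (\<Sum>j<Suc n. c j *\<^sub>R e j) = (\<Sum>j<Suc n. c j * f (e j))" using Suc by simp
  show "(\<Sum>j<Suc n. c j *\<^sub>R e j) \<in> sqrt_domain \<mu> e" using subspace_add[OF sub Suc(2) en(1)] by simp
qed

text \<open>The dual norm bounds a functional on the unit ball of \<open>V\<close>, hence the scaling of \<open>e k\<close> by \<open>r\<close> below.
  Continuity makes the nonlinearity measurable along a path.\<close>

lemma continuous_trilinear_basis:
  assumes e: "orthonormal_basis e" and B: "condition_B \<mu> e B"
  shows "\<exists>K. \<forall>u v. \<bar>B u v (e k)\<bar> \<le> K * norm u * norm v" "continuous_on UNIV (\<lambda>x. B x x (e k))"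
proof -
  obtain C0 where C0: "\<And>u v. V_dual_norm \<mu> e (B u v) \<le> C0 * norm u * norm v"
    using B unfolding condition_B_def by blast
  have dual: "\<And>u v. B u v \<in> V_dual \<mu> e" using B unfolding condition_B_def by blast
  have lin: "\<And>u x. linear (\<lambda>v. B u v x)" "\<And>v x. linear (\<lambda>u. B u v x)"
    using B unfolding condition_B_def by blast+
  define r where "r = V_norm \<mu> e (e k) + 1"
  have r: "0 < r" by (simp add: r_def V_norm_def add_nonneg_pos)
  note ek = basis_in_sqrt_domain[OF e, of k \<mu>]
  have bd: "\<bar>B u v (e k)\<bar> \<le> (r * C0) * norm u * norm v" for u v
  proof -
    obtain K where K: "\<And>x. x \<in> sqrt_domain \<mu> e \<Longrightarrow> \<bar>B u v x\<bar> \<le> K * V_norm \<mu> e x"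
      using dual[of u v] unfolding V_dual_def by blast
    have sc: "B u v ((1/r) *\<^sub>R e k) = (1/r) * B u v (e k)"
      using dual[of u v] ek unfolding V_dual_def by blast
    have sqrt_sc: "sqrt_op \<mu> e ((1/r) *\<^sub>R e k) = (1/r) *\<^sub>R sqrt_op \<mu> e (e k)"
    proof -
      have dom: "(1/r) *\<^sub>R e k \<in> sqrt_domain \<mu> e"
        using ek summable_mult[of "\<lambda>j. \<mu> j * (e k \<bullet> e j)\<^sup>2" "(1/r)\<^sup>2"]
        by (simp add: sqrt_domain_def power_mult_distrib mult_ac power_divide)
      have "(\<lambda>j. (sqrt (\<mu> j) * (e k \<bullet> e j)) *\<^sub>R e j) = (\<lambda>j. if j = k then sqrt (\<mu> j) *\<^sub>R e j else 0)"
        "(\<lambda>j. (sqrt (\<mu> j) * ((1/r) *\<^sub>R e k \<bullet> e j)) *\<^sub>R e j) = (\<lambda>j. if j = k then (1/r) *\<^sub>R sqrt (\<mu> j) *\<^sub>R e j else 0)"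
        by (auto simp: orthonormalD[OF e])
      then show ?thesis using dom ek unfolding sqrt_op_def
        by (simp add: sums_unique[OF sums_single, symmetric])
    qed
    have "bdd_above ((\<lambda>x. \<bar>B u v x\<bar>) ` {x \<in> sqrt_domain \<mu> e. V_norm \<mu> e x \<le> 1})"
    proof (rule bdd_aboveI2)
      fix x assume x: "x \<in> {x \<in> sqrt_domain \<mu> e. V_norm \<mu> e x \<le> 1}"
      have V0: "0 \<le> V_norm \<mu> e x" by (simp add: V_norm_def)
      have "\<bar>B u v x\<bar> \<le> K * V_norm \<mu> e x" using K x by blast
      also have "\<dots> \<le> \<bar>K\<bar> * 1" using x V0 by (intro mult_mono) auto
      finally show "\<bar>B u v x\<bar> \<le> \<bar>K\<bar> * 1" .
    qed
    moreover have "(1/r) *\<^sub>R e k \<in> {x \<in> sqrt_domain \<mu> e. V_norm \<mu> e x \<le> 1}"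
    proof -
      have "V_norm \<mu> e ((1/r) *\<^sub>R e k) = (1/r) * V_norm \<mu> e (e k)"
        using r by (simp add: V_norm_def sqrt_sc algebra_simps)
      also have "\<dots> \<le> 1" using r by (simp add: r_def)
      finally show ?thesis
        using ek summable_mult[of "\<lambda>j. \<mu> j * (e k \<bullet> e j)\<^sup>2" "(1/r)\<^sup>2"]
        by (simp add: sqrt_domain_def power_mult_distrib mult_ac power_divide)
    qed
    ultimately have "\<bar>B u v ((1/r) *\<^sub>R e k)\<bar> \<le> V_dual_norm \<mu> e (B u v)"
      unfolding V_dual_norm_def by (intro cSUP_upper) auto
    also have "\<dots> \<le> C0 * norm u * norm v" by (rule C0)
    also have "\<bar>B u v ((1/r) *\<^sub>R e k)\<bar> = \<bar>B u v (e k)\<bar> / r"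
      using r unfolding sc by (simp add: abs_mult)
    finally have "\<bar>B u v (e k)\<bar> \<le> (C0 * norm u * norm v) * r"
      using r by (simp only: pos_divide_le_eq)
    then show ?thesis by (simp only: mult_ac)
  qed
  then show "\<exists>K. \<forall>u v. \<bar>B u v (e k)\<bar> \<le> K * norm u * norm v" by blast
  have "bounded_bilinear (\<lambda>u v. B u v (e k))"
  proof
    show "B (a + a') b (e k) = B a b (e k) + B a' b (e k)" for a a' b
      by (rule linear_add[OF lin(2)])
    show "B a (b + b') (e k) = B a b (e k) + B a b' (e k)" for a b b'
      by (rule linear_add[OF lin(1)])
    show "B (r *\<^sub>R a) b (e k) = r *\<^sub>R B a b (e k)" for r a b
      by (rule linear_scale[OF lin(2)])
    show "B a (r *\<^sub>R b) (e k) = r *\<^sub>R B a b (e k)" for r a b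
      by (rule linear_scale[OF lin(1)])
    show "\<exists>K. \<forall>a b. norm (B a b (e k)) \<le> norm a * norm b * K"
      using bd by (intro exI[of _ "r * C0"]) (simp add: mult_ac)
  qed
  from bounded_bilinear.continuous_on[OF this continuous_on_id continuous_on_id]
  show "continuous_on UNIV (\<lambda>x. B x x (e k))" .
qed

section \<open>Indefinite integrals of integrable functions\<close>

definition primitive :: "(real \<Rightarrow> real) \<Rightarrow> real \<Rightarrow> real" where
  "primitive f t = (\<integral>s\<in>{0..t}. f s \<partial>lborel)"

lemma primitive_eq: "primitive f t = (\<integral>s. indicator {0..t} s * f s \<partial>lborel)"
  by (simp add: primitive_def set_lebesgue_integral_def)

lemma integrable_indicator_mult:
  fixes f :: "'a \<Rightarrow> real"
  assumes "integrable M f" "A \<in> sets M"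
  shows "integrable M (\<lambda>x. indicator A x * f x)"
  using integrable_mult_indicator[OF assms(2,1)] by simp

lemma primitive_cong:
  assumes "\<And>s. 0 \<le> s \<Longrightarrow> s \<le> t \<Longrightarrow> f s = g s"
  shows "primitive f t = primitive g t"
  unfolding primitive_def by (rule set_lebesgue_integral_cong) (use assms in auto)

lemma primitive_add:
  assumes "integrable lborel f" "integrable lborel g"
  shows "primitive (\<lambda>s. f s + g s) t = primitive f t + primitive g t"
  unfolding primitive_def set_lebesgue_integral_def
  using assms by (simp add: distrib_left integrable_indicator_mult)

lemma primitive_diff:
  assumes "integrable lborel f" "integrable lborel g"
  shows "primitive (\<lambda>s. f s - g s) t = primitive f t - primitive g t"
  unfolding primitive_def set_lebesgue_integral_def
  using assms by (simp add: right_diff_distrib integrable_indicator_mult)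

lemma primitive_cmult: "primitive (\<lambda>s. c * f s) t = c * primitive f t"
  unfolding primitive_def by (rule set_integral_mult_right)

lemma primitive_sum:
  assumes "\<And>i. i \<in> I \<Longrightarrow> integrable lborel (f i)"
  shows "primitive (\<lambda>s. \<Sum>i\<in>I. f i s) t = (\<Sum>i\<in>I. primitive (f i) t)"
  unfolding primitive_def set_lebesgue_integral_def
  using assms by (simp add: sum_distrib_left integrable_indicator_mult)

lemma primitive_mono_AE:
  assumes "integrable lborel f" "integrable lborel g"
    and "AE s in lborel. s \<in> {0..t} \<longrightarrow> f s \<le> g s"
  shows "primitive f t \<le> primitive g t"
  unfolding primitive_def set_lebesgue_integral_def real_scaleR_def
  by (rule integral_mono_AE) (use assms in \<open>auto intro!: integrable_indicator_mult elim!: eventually_mono split: split_indicator\<close>)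

lemma abs_primitive_le:
  assumes "integrable lborel f"
  shows "\<bar>primitive f t\<bar> \<le> (\<integral>s. \<bar>f s\<bar> \<partial>lborel)"
proof -
  have "\<bar>primitive f t\<bar> \<le> (\<integral>s. \<bar>indicator {0..t} s * f s\<bar> \<partial>lborel)"
    unfolding primitive_def set_lebesgue_integral_def real_scaleR_def by (rule integral_abs_bound)
  also have "\<dots> \<le> (\<integral>s. \<bar>f s\<bar> \<partial>lborel)"
    by (rule integral_mono) (use assms in \<open>auto intro!: integrable_indicator_mult integrable_abs split: split_indicator\<close>)
  finally show ?thesis .
qed

lemma measurable_primitive[measurable]:
  assumes [measurable]: "f \<in> borel_measurable borel"
  shows "primitive f \<in> borel_measurable borel"
proof -
  have [measurable]: "Measurable.pred (borel \<Otimes>\<^sub>M borel) (\<lambda>p::real \<times> real. snd p \<in> {0..fst p})"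
    by simp
  have "(\<lambda>t. \<integral>s. indicator {0..t} s * f s \<partial>lborel) \<in> borel_measurable borel"
    by (rule lborel.borel_measurable_lebesgue_integral)
      (simp add: case_prod_beta' indicator_def of_bool_def)
  then show ?thesis by (simp add: primitive_def[abs_def] set_lebesgue_integral_def)
qed

lemma integrable_product_kernel:
  fixes p q :: "real \<Rightarrow> real"
  assumes [measurable]: "k \<in> borel_measurable (borel \<Otimes>\<^sub>M borel)" and k: "\<And>x. \<bar>k x\<bar> \<le> 1"
    and p: "integrable lborel p" and q: "integrable lborel q"
  shows "integrable (lborel \<Otimes>\<^sub>M lborel) (\<lambda>(s, r). k (s, r) * (p s * q r) :: real)"
proof (rule Bochner_Integration.integrable_bound)
  have [measurable]: "p \<in> borel_measurable borel" "q \<in> borel_measurable borel"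
    using p q by auto
  show "integrable (lborel \<Otimes>\<^sub>M lborel) (\<lambda>(s, r). p s * q r)"
  proof (rule lborel_pair.Fubini_integrable)
    show "integrable lborel (\<lambda>s. \<integral>r. norm (case (s, r) of (s, r) \<Rightarrow> p s * q r) \<partial>lborel)"
      using p by (simp add: abs_mult)
    show "AE s in lborel. integrable lborel (\<lambda>r. case (s, r) of (s, r) \<Rightarrow> p s * q r)"
      using q by simp
  qed simp
  show "(\<lambda>(s, r). k (s, r) * (p s * q r)) \<in> borel_measurable (lborel \<Otimes>\<^sub>M lborel)" by simp
  show "AE x in lborel \<Otimes>\<^sub>M lborel. norm (case x of (s, r) \<Rightarrow> k (s, r) * (p s * q r))
          \<le> norm (case x of (s, r) \<Rightarrow> p s * q r)"
    using k by (auto simp: abs_mult mult_left_le_one_le split: prod.splits)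
qed

lemma integrable_mult_primitive:
  assumes p: "integrable lborel p" and q: "integrable lborel q"
  shows "integrable lborel (\<lambda>s. p s * primitive q s)"
proof (rule Bochner_Integration.integrable_bound)
  have [measurable]: "p \<in> borel_measurable borel" "q \<in> borel_measurable borel"
    using p q by auto
  show "integrable lborel (\<lambda>s. (\<integral>s. \<bar>q s\<bar> \<partial>lborel) * p s)" using p by simp
  show "(\<lambda>s. p s * primitive q s) \<in> borel_measurable lborel" by simp
  have "\<bar>p s * primitive q s\<bar> \<le> \<bar>(\<integral>s. \<bar>q s\<bar> \<partial>lborel) * p s\<bar>" for s
  proof -
    have "\<bar>p s\<bar> * \<bar>primitive q s\<bar> \<le> \<bar>p s\<bar> * (\<integral>s. \<bar>q s\<bar> \<partial>lborel)"
      using abs_primitive_le[OF q, of s] by (intro mult_left_mono) auto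
    then show ?thesis by (simp add: abs_mult mult.commute)
  qed
  then show "AE s in lborel. norm (p s * primitive q s) \<le> norm ((\<integral>s. \<bar>q s\<bar> \<partial>lborel) * p s)"
    by simp
qed

text \<open>For merely integrable integrands the product rule is Fubini's theorem on the square
  \<open>[0,t]\<^sup>2\<close>, cut along its diagonal.\<close>

lemma primitive_by_parts:
  assumes p: "integrable lborel p" and q: "integrable lborel q"
  shows "primitive (\<lambda>s. p s * primitive q s) t + primitive (\<lambda>s. q s * primitive p s) t
    = primitive p t * primitive q t"
proof -
  have [measurable]: "p \<in> borel_measurable borel" "q \<in> borel_measurable borel"
    using p q by auto
  define I where "I = (indicator {0..t} :: real \<Rightarrow> real)"
  define k where "k = (\<lambda>x::real \<times> real. I (fst x) * I (snd x) * (if snd x \<le> fst x then 1 else 0 :: real))"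
  define k' where "k' = (\<lambda>x::real \<times> real. I (fst x) * I (snd x) * (if snd x \<le> fst x then 0 else 1 :: real))"
  have km[measurable]: "k \<in> borel_measurable (borel \<Otimes>\<^sub>M borel)" "k' \<in> borel_measurable (borel \<Otimes>\<^sub>M borel)"
    unfolding k_def k'_def I_def by measurable
  have kb: "\<bar>k x\<bar> \<le> 1" "\<bar>k' x\<bar> \<le> 1" for x by (auto simp: k_def k'_def I_def split: split_indicator)
  note int = integrable_product_kernel[OF km(1) kb(1) p q] integrable_product_kernel[OF km(2) kb(2) p q]
  have 1: "(\<integral>r. k (s, r) * (p s * q r) \<partial>lborel) = I s * (p s * primitive q s)" for s
  proof -
    have "(\<integral>r. k (s, r) * (p s * q r) \<partial>lborel) = (\<integral>r. (I s * p s) * (indicator {0..s} r * q r) \<partial>lborel)"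
      by (rule Bochner_Integration.integral_cong) (auto simp: k_def I_def split: split_indicator)
    also have "\<dots> = (I s * p s) * primitive q s"
      unfolding primitive_eq by (rule integral_mult_right_zero)
    finally show ?thesis by (simp add: mult_ac)
  qed
  have 2: "(\<integral>s. k' (s, r) * (p s * q r) \<partial>lborel) = I r * (q r * primitive p r)" for r
  proof -
    have "(\<integral>s. k' (s, r) * (p s * q r) \<partial>lborel) = (\<integral>s. (I r * q r) * (indicator {0..r} s * p s) \<partial>lborel)"
    proof (rule integral_cong_AE)
      show "AE s in lborel. k' (s, r) * (p s * q r) = (I r * q r) * (indicator {0..r} s * p s)"
        using AE_lborel_singleton[of r]
        by eventually_elim (auto simp: k'_def I_def split: split_indicator)
    qed simp_all
    also have "\<dots> = (I r * q r) * primitive p r"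
      unfolding primitive_eq by (rule integral_mult_right_zero)
    finally show ?thesis by (simp add: mult_ac)
  qed
  have 3: "(\<integral>r. (k (s, r) + k' (s, r)) * (p s * q r) \<partial>lborel) = I s * p s * primitive q t" for s
  proof -
    have "(\<integral>r. (k (s, r) + k' (s, r)) * (p s * q r) \<partial>lborel) = (\<integral>r. (I s * p s) * (I r * q r) \<partial>lborel)"
      by (rule Bochner_Integration.integral_cong) (auto simp: k_def k'_def)
    also have "\<dots> = (I s * p s) * primitive q t"
      unfolding primitive_eq I_def by (rule integral_mult_right_zero)
    finally show ?thesis .
  qed
  have "primitive (\<lambda>s. p s * primitive q s) t + primitive (\<lambda>s. q s * primitive p s) t
      = (\<integral>s. (\<integral>r. k (s, r) * (p s * q r) \<partial>lborel) \<partial>lborel) + (\<integral>r. (\<integral>s. k' (s, r) * (p s * q r) \<partial>lborel) \<partial>lborel)"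
    unfolding 1 2 primitive_eq I_def ..
  also have "\<dots> = integral\<^sup>L (lborel \<Otimes>\<^sub>M lborel) (\<lambda>(s, r). k (s, r) * (p s * q r))
      + integral\<^sup>L (lborel \<Otimes>\<^sub>M lborel) (\<lambda>(s, r). k' (s, r) * (p s * q r))"
    using lborel_pair.integral_fst[OF int(1)] lborel_pair.integral_snd[OF int(2)] by simp
  also have "\<dots> = integral\<^sup>L (lborel \<Otimes>\<^sub>M lborel) (\<lambda>(s, r). (k (s, r) + k' (s, r)) * (p s * q r))"
    using Bochner_Integration.integral_add[OF int] by (simp add: case_prod_beta' distrib_right)
  also have "\<dots> = (\<integral>s. (\<integral>r. (k (s, r) + k' (s, r)) * (p s * q r) \<partial>lborel) \<partial>lborel)"
    using lborel_pair.integral_fst[of "\<lambda>s r. (k (s, r) + k' (s, r)) * (p s * q r)"]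
      Bochner_Integration.integrable_add[OF int] by (simp add: case_prod_beta' distrib_right)
  also have "\<dots> = primitive p t * primitive q t"
    unfolding 3 primitive_eq I_def by simp
  finally show ?thesis .
qed

lemma square_of_primitive:
  assumes f: "integrable lborel f"
  shows "(c + primitive f t)\<^sup>2 = c\<^sup>2 + 2 * primitive (\<lambda>s. f s * (c + primitive f s)) t"
proof -
  have "primitive (\<lambda>s. f s * (c + primitive f s)) t
      = primitive (\<lambda>s. c * f s + f s * primitive f s) t"
    by (rule primitive_cong) (simp add: algebra_simps)
  also have "\<dots> = c * primitive f t + primitive (\<lambda>s. f s * primitive f s) t"
    using f by (subst primitive_add) (auto intro: integrable_mult_primitive simp: primitive_cmult)
  also have "2 * \<dots> = 2 * c * primitive f t + (primitive f t)\<^sup>2"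
    using primitive_by_parts[OF f f, of t] by (simp add: power2_eq_square)
  finally show ?thesis by (simp add: power2_eq_square algebra_simps)
qed

subsection \<open>Smoothing by the linear semigroup\<close>

text \<open>The solution of \<open>z + a \<integral> z = m\<close>, written without differentials of the rough path \<open>m\<close>.\<close>

definition ou :: "real \<Rightarrow> (real \<Rightarrow> real) \<Rightarrow> real \<Rightarrow> real" where
  "ou a m t = m t - a * primitive (\<lambda>s. exp (- a * (t - s)) * m s) t"

lemma primitive_exp:
  assumes "0 < a" "0 \<le> t"
  shows "primitive (\<lambda>s. a * exp (- a * (t - s))) t = 1 - exp (- a * t)"
proof -
  have "(\<integral>s. indicator {0..t} s *\<^sub>R (a * exp (- a * (t - s))) \<partial>lborel)
      = exp (- a * (t - t)) - exp (- a * (t - 0))"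
    using assms by (intro integral_FTC_atLeastAtMost)
      (auto intro!: derivative_eq_intros continuous_intros simp flip: has_real_derivative_iff_has_vector_derivative)
  then show ?thesis unfolding primitive_eq by simp
qed

lemma primitive_exp_weighted:
  assumes "0 < a" "0 \<le> t"
  shows "primitive (\<lambda>s. a * exp (- a * (t - s)) * (t - s)) t = 1 / a - exp (- a * t) * (t + 1 / a)"
proof -
  have "(\<integral>s. indicator {0..t} s *\<^sub>R (a * exp (- a * (t - s)) * (t - s)) \<partial>lborel)
      = exp (- a * (t - t)) * (t - t + 1 / a) - exp (- a * (t - 0)) * (t - 0 + 1 / a)"
    using assms by (intro integral_FTC_atLeastAtMost)
      (auto intro!: derivative_eq_intros continuous_intros
        simp flip: has_real_derivative_iff_has_vector_derivative simp: field_simps)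
  then show ?thesis unfolding primitive_eq by simp
qed

lemma measurable_ou:
  assumes [measurable]: "m \<in> borel_measurable borel"
  shows "ou a m \<in> borel_measurable borel"
proof -
  have "primitive (\<lambda>s. exp (- a * (t - s)) * m s) t = exp (- a * t) * primitive (\<lambda>s. exp (a * s) * m s) t" for t
    unfolding primitive_cmult[symmetric]
    by (rule primitive_cong) (simp add: right_diff_distrib mult.assoc[symmetric] flip: exp_add)
  then show ?thesis unfolding ou_def by simp
qed

lemma ou_equation:
  assumes a: "0 < a" and t: "0 \<le> t" "t \<le> T" and m: "integrable lborel m"
  shows "ou a m t = m t - a * primitive (ou a m) t"
proof -
  have [measurable]: "m \<in> borel_measurable borel" using m by auto
  define I where "I = (indicator {0..T} :: real \<Rightarrow> real)"
  (* The convolution at time s is exp (- a s) times the primitive of q, and p is minus the derivative of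
     that factor; cutting off at T makes p and q integrable over the line. *)
  define p where "p s = I s * (a * exp (- a * s))" for s
  define q where "q s = I s * (exp (a * s) * m s)" for s
  have p: "integrable lborel p"
    unfolding p_def I_def
    using borel_integrable_atLeastAtMost'[of 0 T "\<lambda>s. a * exp (- a * s)"]
    by (simp add: set_integrable_def continuous_intros)
  have q: "integrable lborel q"
  proof (rule Bochner_Integration.integrable_bound)
    show "integrable lborel (\<lambda>s. exp (a * T) * m s)" using m by simp
    show "q \<in> borel_measurable lborel" unfolding q_def I_def by simp
    show "AE s in lborel. norm (q s) \<le> norm (exp (a * T) * m s)"
      using a by (auto simp: q_def I_def abs_mult intro!: mult_right_mono split: split_indicator)
  qed
  have Pp: "primitive p s = 1 - exp (- a * s)" if "0 \<le> s" "s \<le> T" for s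
  proof -
    have "(\<integral>r. indicator {0..s} r *\<^sub>R (a * exp (- a * r)) \<partial>lborel) = (- exp (- a * s)) - (- exp (- a * 0))"
      using that a \<open>0 \<le> s\<close> by (intro integral_FTC_atLeastAtMost)
        (auto intro!: derivative_eq_intros continuous_intros simp flip: has_real_derivative_iff_has_vector_derivative)
    moreover have "primitive p s = primitive (\<lambda>r. a * exp (- a * r)) s"
      using that by (intro primitive_cong) (auto simp: p_def I_def)
    ultimately show ?thesis unfolding primitive_eq by simp
  qed
  have Y: "primitive (\<lambda>r. exp (- a * (s - r)) * m r) s = exp (- a * s) * primitive q s"
    if "0 \<le> s" "s \<le> T" for s
    unfolding primitive_cmult[symmetric] using that
    by (intro primitive_cong) (auto simp: q_def I_def right_diff_distrib mult.assoc[symmetric] simp flip: exp_add)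
  have mI: "integrable lborel (\<lambda>s. I s * m s)" unfolding I_def using m by (simp add: integrable_indicator_mult)
  have "primitive (ou a m) t = primitive (\<lambda>s. I s * m s - p s * primitive q s) t"
  proof (rule primitive_cong)
    fix s assume s: "0 \<le> s" "s \<le> t"
    show "ou a m s = I s * m s - p s * primitive q s"
      using Y[of s] s t by (simp add: ou_def p_def I_def)
  qed
  also have "\<dots> = primitive (\<lambda>s. I s * m s) t - primitive (\<lambda>s. p s * primitive q s) t"
    by (intro primitive_diff mI integrable_mult_primitive p q)
  also have "primitive (\<lambda>s. p s * primitive q s) t = primitive p t * primitive q t - primitive (\<lambda>s. q s * primitive p s) t"
    using primitive_by_parts[OF p q, of t] by simp
  also have "primitive (\<lambda>s. q s * primitive p s) t = primitive (\<lambda>s. q s - I s * m s) t"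
  proof (rule primitive_cong)
    fix s assume s: "0 \<le> s" "s \<le> t"
    have "exp (a * s) * exp (- a * s) = 1" by (simp flip: exp_add)
    then have "q s * exp (- a * s) = I s * m s" by (simp add: q_def)
    then show "q s * primitive p s = q s - I s * m s" using s t by (simp add: Pp right_diff_distrib)
  qed
  also have "\<dots> = primitive q t - primitive (\<lambda>s. I s * m s) t"
    by (intro primitive_diff mI q)
  finally have "primitive (ou a m) t = exp (- a * t) * primitive q t"
    using Pp[OF t] by (simp add: algebra_simps)
  then show ?thesis using Y[OF t] by (simp add: ou_def)
qed

text \<open>The weights \<open>e\<^sup>-\<^sup>a\<^sup>t\<close> and \<open>a e\<^sup>-\<^sup>a\<^sup>(\<^sup>t\<^sup>-\<^sup>s\<^sup>) ds\<close> form a probability measure, and \<open>ou a m t\<close> is the mean of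
  \<open>m t\<close> and the increments \<open>m t - m s\<close> for it; this is Jensen's inequality for the square.\<close>

lemma ou_square_le:
  assumes a: "0 < a" and t: "0 \<le> t" and m: "integrable lborel m" and m2: "integrable lborel (\<lambda>s. (m s)\<^sup>2)"
  shows "(ou a m t)\<^sup>2 \<le> exp (- a * t) * (m t)\<^sup>2
    + primitive (\<lambda>s. a * exp (- a * (t - s)) * (m t - m s)\<^sup>2) t"
proof -
  have [measurable]: "m \<in> borel_measurable borel" using m by auto
  define z where "z = ou a m t"
  define w where "w s = indicator {0..t} s * (a * exp (- a * (t - s)))" for s
  have w0: "0 \<le> w s" "w s \<le> a" for s
    using a by (auto simp: w_def split: split_indicator)
  have wm: "integrable lborel (\<lambda>s. w s * f s)" if "integrable lborel f" for f
  proof (rule Bochner_Integration.integrable_bound)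
    show "integrable lborel (\<lambda>s. a * f s)" using that by simp
    show "(\<lambda>s. w s * f s) \<in> borel_measurable lborel" using that unfolding w_def by simp
    show "AE s in lborel. norm (w s * f s) \<le> norm (a * f s)"
      using w0 a by (auto simp: abs_mult intro!: mult_right_mono)
  qed
  have wi: "integrable lborel w"
    unfolding w_def using borel_integrable_atLeastAtMost'[of 0 t "\<lambda>s. a * exp (- a * (t - s))"]
    by (simp add: set_integrable_def continuous_intros)
  have E1: "(\<integral>s. w s \<partial>lborel) = 1 - exp (- a * t)"
    using primitive_exp[OF a t] unfolding primitive_eq w_def .
  define A1 where "A1 = (\<integral>s. w s * m s \<partial>lborel)"
  define A2 where "A2 = (\<integral>s. w s * (m s)\<^sup>2 \<partial>lborel)"
  have z: "z = m t - A1"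
  proof -
    have "a * primitive (\<lambda>s. exp (- a * (t - s)) * m s) t = A1"
      unfolding primitive_cmult[symmetric] unfolding A1_def primitive_eq w_def by (simp only: mult_ac)
    then show ?thesis unfolding z_def ou_def by simp
  qed
  have sq: "(\<integral>s. w s * (c - m s)\<^sup>2 \<partial>lborel) = c\<^sup>2 * (1 - exp (- a * t)) - 2 * c * A1 + A2" for c
  proof -
    have "(\<integral>s. w s * (c - m s)\<^sup>2 \<partial>lborel) = (\<integral>s. c\<^sup>2 * w s - 2 * c * (w s * m s) + w s * (m s)\<^sup>2 \<partial>lborel)"
      by (rule Bochner_Integration.integral_cong) (simp_all add: power2_eq_square algebra_simps)
    also have "\<dots> = c\<^sup>2 * (1 - exp (- a * t)) - 2 * c * A1 + A2"
      using wi wm[OF m] wm[OF m2] by (simp add: E1 A1_def A2_def)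
    finally show ?thesis .
  qed
  (* The variance with respect to the weights is nonnegative, and z is the mean. *)
  have "0 \<le> exp (- a * t) * (m t - z)\<^sup>2 + (\<integral>s. w s * ((m t - z) - m s)\<^sup>2 \<partial>lborel)"
    using w0 by (intro add_nonneg_nonneg integral_nonneg mult_nonneg_nonneg) auto
  also have "\<dots> = exp (- a * t) * (m t)\<^sup>2 + (\<integral>s. w s * (m t - m s)\<^sup>2 \<partial>lborel) - z\<^sup>2"
    unfolding sq by (simp add: z power2_eq_square algebra_simps)
  also have "(\<integral>s. w s * (m t - m s)\<^sup>2 \<partial>lborel) = primitive (\<lambda>s. a * exp (- a * (t - s)) * (m t - m s)\<^sup>2) t"
    unfolding primitive_eq w_def by (simp only: mult_ac)
  finally show ?thesis by (simp add: z_def)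
qed

section \<open>The energy estimate along a path\<close>

lemma measurable_inner_const[measurable (raw)]:
  fixes f :: "'a \<Rightarrow> 'h::real_inner"
  assumes "f \<in> borel_measurable M"
  shows "(\<lambda>x. f x \<bullet> y) \<in> borel_measurable M"
  by (rule measurable_compose[OF assms borel_measurable_continuous_onI]) (intro continuous_intros)

lemma integrable_of_square:
  fixes f :: "real \<Rightarrow> real"
  assumes [measurable]: "f \<in> borel_measurable borel" and f2: "integrable lborel (\<lambda>t. (f t)\<^sup>2)"
    and f0: "\<And>t. t \<notin> {0..T} \<Longrightarrow> f t = 0"
  shows "integrable lborel f"
proof (rule Bochner_Integration.integrable_bound)
  show "integrable lborel (\<lambda>t. indicator {0..T} t + (f t)\<^sup>2)"
    using f2 by (intro Bochner_Integration.integrable_add integrable_real_indicator)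
      (auto simp: emeasure_lborel_Icc_eq)
  have "\<bar>f t\<bar> \<le> indicator {0..T} t + (f t)\<^sup>2" for t
  proof (cases "t \<in> {0..T}")
    case True
    have "0 \<le> (\<bar>f t\<bar> - 1)\<^sup>2" by simp
    then have "2 * \<bar>f t\<bar> \<le> 1 + (f t)\<^sup>2" by (simp add: power2_eq_square algebra_simps abs_if split: if_splits)
    then show ?thesis using True by simp
  qed (simp add: f0)
  then show "AE t in lborel. norm (f t) \<le> norm (indicator {0..T} t + (f t)\<^sup>2)"
    by (simp add: order_trans[OF _ abs_ge_self])
qed simp

lemma suminf_ennreal_finite_sums:
  assumes "(\<Sum>j. ennreal (f j)) < \<infinity>" "\<And>j. 0 \<le> f j"
  shows "f sums enn2real (\<Sum>j. ennreal (f j))"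
proof -
  have "summable f" using assms by (intro summable_suminf_not_top) auto
  then show ?thesis using assms by (simp add: suminf_ennreal_eq[OF assms(2) summable_sums] summable_sums suminf_nonneg)
qed

text \<open>Everything is dominated by the energy density, as \<open>(norm x)\<^sup>2 \<le> (\<Sum>j. \<mu> j * (x \<bullet> e j)\<^sup>2) / \<mu>0\<close> and the
  nonlinearity grows quadratically.\<close>

lemma integrable_coordinates:
  fixes u :: "real \<Rightarrow> shell_space"
  assumes e: "orthonormal_basis e" and \<mu>0: "0 < \<mu>0" and \<mu>: "\<And>j. \<mu>0 \<le> \<mu> j"
    and B: "condition_B \<mu> e B"
    and [measurable]: "u \<in> borel_measurable borel" and u0: "\<And>t. t \<notin> {0..T} \<Longrightarrow> u t = 0"
    and fin: "(\<integral>\<^sup>+t. (\<Sum>j. ennreal (\<mu> j * (u t \<bullet> e j)\<^sup>2)) \<partial>lborel) < \<infinity>"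
  shows "integrable lborel (\<lambda>t. (u t \<bullet> e j)\<^sup>2)" "integrable lborel (\<lambda>t. u t \<bullet> e j)"
    "integrable lborel (\<lambda>t. B (u t) (u t) (e j))"
proof -
  have \<mu>p: "0 \<le> \<mu> j" for j using \<mu>0 \<mu>[of j] by linarith
  define G where "G t = (\<Sum>j. ennreal (\<mu> j * (u t \<bullet> e j)\<^sup>2))" for t
  have [measurable]: "G \<in> borel_measurable borel" unfolding G_def by measurable
  have ae: "AE t in lborel. G t < \<infinity>"
  proof -
    have "(\<integral>\<^sup>+t. G t \<partial>lborel) \<noteq> \<infinity>" using fin by (simp add: G_def less_top)
    then have "AE t in lborel. G t \<noteq> \<infinity>" by (intro nn_integral_noteq_infinite) auto
    then show ?thesis by (simp add: less_top)
  qed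
  have iG: "integrable lborel (\<lambda>t. enn2real (G t))"
  proof (rule integrableI_bounded)
    have "(\<integral>\<^sup>+t. ennreal (norm (enn2real (G t))) \<partial>lborel) = (\<integral>\<^sup>+t. G t \<partial>lborel)"
      using ae by (intro nn_integral_cong_AE) (auto elim!: eventually_mono)
    then show "(\<integral>\<^sup>+t. ennreal (norm (enn2real (G t))) \<partial>lborel) < \<infinity>" using fin by (simp add: G_def)
  qed simp
  have norm: "AE t in lborel. (norm (u t))\<^sup>2 \<le> enn2real (G t) / \<mu>0"
    using ae
  proof eventually_elim
    case (elim t)
    have "(\<lambda>j. \<mu> j * (u t \<bullet> e j)\<^sup>2) sums enn2real (G t)"
      unfolding G_def by (rule suminf_ennreal_finite_sums) (use elim \<mu>p in \<open>auto simp: G_def\<close>)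
    from norm_le_energy[OF e \<mu>0 \<mu> this] show ?case .
  qed
  show sq: "integrable lborel (\<lambda>t. (u t \<bullet> e j)\<^sup>2)"
  proof (rule Bochner_Integration.integrable_bound)
    show "integrable lborel (\<lambda>t. enn2real (G t) / \<mu>0)" using iG by simp
    show "AE t in lborel. norm ((u t \<bullet> e j)\<^sup>2) \<le> norm (enn2real (G t) / \<mu>0)"
      using norm
    proof eventually_elim
      case (elim t)
      have "\<bar>u t \<bullet> e j\<bar> \<le> norm (u t) * norm (e j)" by (rule Cauchy_Schwarz_ineq2)
      also have "norm (e j) = 1" by (simp add: norm_eq_sqrt_inner orthonormalD[OF e])
      finally have "(u t \<bullet> e j)\<^sup>2 \<le> (norm (u t))\<^sup>2"
        by (intro iffD1[OF abs_le_square_iff]) simp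
      then show ?case using elim \<mu>0 by simp
    qed
  qed simp
  show "integrable lborel (\<lambda>t. u t \<bullet> e j)"
    by (rule integrable_of_square[OF _ sq, of T]) (auto simp: u0)
  obtain K where K: "\<And>u v. \<bar>B u v (e j)\<bar> \<le> K * norm u * norm v"
    using continuous_trilinear_basis(1)[OF e B] by blast
  have [measurable]: "(\<lambda>x. B x x (e j)) \<in> borel_measurable borel"
    by (rule borel_measurable_continuous_onI[OF continuous_trilinear_basis(2)[OF e B]])
  show "integrable lborel (\<lambda>t. B (u t) (u t) (e j))"
  proof (rule Bochner_Integration.integrable_bound)
    show "integrable lborel (\<lambda>t. \<bar>K\<bar> * (enn2real (G t) / \<mu>0))" using iG by simp
    show "(\<lambda>t. B (u t) (u t) (e j)) \<in> borel_measurable lborel"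
      by (rule measurable_compose[of u _ borel]) auto
    show "AE t in lborel. norm (B (u t) (u t) (e j)) \<le> norm (\<bar>K\<bar> * (enn2real (G t) / \<mu>0))"
      using norm
    proof eventually_elim
      case (elim t)
      have "\<bar>B (u t) (u t) (e j)\<bar> \<le> K * (norm (u t))\<^sup>2"
        using K[of "u t" "u t"] by (simp add: power2_eq_square mult.assoc)
      also have "\<dots> \<le> \<bar>K\<bar> * (enn2real (G t) / \<mu>0)"
        using elim by (intro mult_mono) auto
      finally show ?case using \<mu>0 by (simp add: abs_mult)
    qed
  qed
qed

lemma ennreal_suminf_tail_small:
  fixes a :: "nat \<Rightarrow> ennreal"
  assumes "(\<Sum>j. a j) < \<infinity>" "0 < \<epsilon>"
  shows "\<exists>n. (\<Sum>j. a (j + n)) \<le> ennreal \<epsilon>"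
proof -
  define f where "f j = enn2real (a j)" for j
  have a: "a j = ennreal (f j)" for j
    using ennreal_suminf_lessD[OF assms(1), of j] by (simp add: f_def)
  have s: "summable f" using assms(1) unfolding a
    by (intro summable_suminf_not_top) (auto simp: f_def)
  obtain n where "norm (\<Sum>j. f (j + n)) < \<epsilon>"
    using suminf_exist_split[OF assms(2) s] by auto
  then have "(\<Sum>j. a (j + n)) \<le> ennreal \<epsilon>"
    unfolding a using summable_ignore_initial_segment[OF s, of n]
    by (subst suminf_ennreal2) (auto simp: f_def suminf_nonneg intro!: ennreal_leI)
  then show ?thesis ..
qed

lemma sqrt_le_weighted: 
  assumes "0 < \<eta>" "0 \<le> x" shows "sqrt x \<le> (x / \<eta> + \<eta>) / (2::real)"
proof -
  have "0 \<le> (sqrt x - \<eta>)\<^sup>2" by simp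
  then have "2 * sqrt x * \<eta> \<le> x + \<eta> * \<eta>" using assms by (simp add: power2_eq_square algebra_simps)
  then show ?thesis using assms by (simp add: field_simps)
qed

text \<open>Write \<open>E\<close> for the squared norm of the truncation \<open>p\<close> and \<open>g\<close> for the squared energy norm of \<open>u - p\<close>. The
  balance of energy and the bound on the trilinear form give
  \<open>E(t) + 2 c \<integral>\<^sub>0\<^sup>t E \<le> \<bar>\<xi>\<bar>\<^sup>2 + 2 C \<integral>\<^sub>0\<^sup>t \<bar>u\<bar> (g E)\<^sup>1\<^sup>/\<^sup>2\<close> with \<open>c = \<kappa> \<mu>0\<close>. Because
  \<open>\<bar>u\<bar> \<le> E\<^sup>1\<^sup>/\<^sup>2 + (g / \<mu>0)\<^sup>1\<^sup>/\<^sup>2\<close>, the last integral is controlled by \<open>sup E\<close> and \<open>\<integral> g \<le> \<gamma>\<close>, and is absorbed when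
  \<open>\<gamma>\<close> is small. So \<open>sup E\<close> and \<open>\<integral> E\<close> are bounded in terms of \<open>\<xi>\<close> alone, while a path that
  stays outside the ball of radius \<open>r\<close> has \<open>\<integral> \<bar>u\<bar>\<^sup>2 \<ge> r\<^sup>2 T\<close>.\<close>

lemma energy_estimate:
  fixes u :: "real \<Rightarrow> shell_space" and z :: "nat \<Rightarrow> real \<Rightarrow> real"
  assumes e: "orthonormal_basis e" and \<mu>0: "0 < \<mu>0" and \<mu>: "\<And>j. \<mu>0 \<le> \<mu> j" and \<kappa>: "0 < \<kappa>"
    and B: "condition_B \<mu> e B"
    and C: "0 < C" and tri: "\<And>x p q. p \<in> sqrt_domain \<mu> e \<Longrightarrow> (\<lambda>j. \<mu> j * ((x - p) \<bullet> e j)\<^sup>2) sums q \<Longrightarrow>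
           \<bar>B x x p\<bar> \<le> C * norm x * sqrt q * norm p"
    and T: "0 < T"
    and [measurable]: "u \<in> borel_measurable borel" and u0: "\<And>t. t \<notin> {0..T} \<Longrightarrow> u t = 0"
    and fin: "(\<integral>\<^sup>+t. (\<Sum>j. ennreal (\<mu> j * (u t \<bullet> e j)\<^sup>2)) \<partial>lborel) < \<infinity>"
    and [measurable]: "\<And>j. z j \<in> borel_measurable borel" and z0: "\<And>j t. t \<notin> {0..T} \<Longrightarrow> z j t = 0"
    and \<gamma>: "0 < \<gamma>" "\<gamma> \<le> 1" "8 * C\<^sup>2 * T * \<gamma> \<le> 1 / 8" "C * \<gamma> / sqrt \<mu>0 \<le> 1 / 4"
    and small: "(\<integral>\<^sup>+t. (\<Sum>j. ennreal (\<mu> j * (z j t)\<^sup>2)) \<partial>lborel) \<le> ennreal (\<gamma> / 2)"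
    and eq: "\<And>j t. t \<in> {0..T} \<Longrightarrow> u t \<bullet> e j - z j t = \<xi> \<bullet> e j
      - primitive (\<lambda>s. \<kappa> * \<mu> j * (u s \<bullet> e j - z j s) + B (u s) (u s) (e j)) t"
    and r: "0 < r" and T_large: "(4 * (norm \<xi>)\<^sup>2 + 1) / (2 * \<kappa> * \<mu>0) + 2 / \<mu>0 < r\<^sup>2 * T"
  shows "\<not> (AE t in lborel. t \<in> {0..T} \<longrightarrow> r \<le> norm (u t))"
proof
  assume far: "AE t in lborel. t \<in> {0..T} \<longrightarrow> r \<le> norm (u t)"
  have \<mu>p: "0 \<le> \<mu> j" for j using \<mu>0 \<mu>[of j] by linarith
  note coord = integrable_coordinates[OF e \<mu>0 \<mu> B \<open>u \<in> borel_measurable borel\<close> u0 fin]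
  have "(\<Sum>j. \<integral>\<^sup>+t. ennreal (\<mu> j * (u t \<bullet> e j)\<^sup>2) \<partial>lborel) < \<infinity>"
    using fin by (simp add: nn_integral_suminf)
  (* The modes from n on carry at most half of the admissible energy of u - p. *)
  from ennreal_suminf_tail_small[OF this half_gt_zero[OF \<gamma>(1)]]
  obtain n where n: "(\<Sum>j. \<integral>\<^sup>+t. ennreal (\<mu> (j + n) * (u t \<bullet> e (j + n))\<^sup>2) \<partial>lborel) \<le> ennreal (\<gamma> / 2)"
    by blast
  define gE where "gE t = (\<Sum>j. ennreal (\<mu> j * (if j < n then z j t else u t \<bullet> e j)\<^sup>2))" for t
  have [measurable]: "gE \<in> borel_measurable borel" unfolding gE_def by measurable
  have gE: "(\<integral>\<^sup>+t. gE t \<partial>lborel) \<le> ennreal \<gamma>"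
  proof -
    have "gE t = (\<Sum>j. ennreal (\<mu> (j + n) * (u t \<bullet> e (j + n))\<^sup>2)) + (\<Sum>j<n. ennreal (\<mu> j * (z j t)\<^sup>2))" for t
      unfolding gE_def by (subst suminf_offset[of _ n]) simp_all
    then have "(\<integral>\<^sup>+t. gE t \<partial>lborel) = (\<Sum>j. \<integral>\<^sup>+t. ennreal (\<mu> (j + n) * (u t \<bullet> e (j + n))\<^sup>2) \<partial>lborel)
        + (\<integral>\<^sup>+t. (\<Sum>j<n. ennreal (\<mu> j * (z j t)\<^sup>2)) \<partial>lborel)"
      by (simp add: nn_integral_add nn_integral_suminf)
    also have "(\<integral>\<^sup>+t. (\<Sum>j<n. ennreal (\<mu> j * (z j t)\<^sup>2)) \<partial>lborel) \<le> (\<integral>\<^sup>+t. (\<Sum>j. ennreal (\<mu> j * (z j t)\<^sup>2)) \<partial>lborel)"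
      by (intro nn_integral_mono sum_le_suminf) auto
    also note small
    also note n
    also have "ennreal (\<gamma> / 2) + ennreal (\<gamma> / 2) = ennreal \<gamma>" using \<gamma> by (simp flip: ennreal_plus)
    finally show ?thesis by (simp add: add_mono)
  qed
  have gfin: "AE t in lborel. gE t < \<infinity>"
  proof -
    have "(\<integral>\<^sup>+t. gE t \<partial>lborel) \<noteq> \<infinity>" using gE by (auto simp: top_unique)
    then have "AE t in lborel. gE t \<noteq> \<infinity>" by (intro nn_integral_noteq_infinite) auto
    then show ?thesis by (simp add: less_top)
  qed
  define g where "g t = enn2real (gE t)" for t
  have [measurable]: "g \<in> borel_measurable borel" unfolding g_def by measurable
  have g0: "0 \<le> g t" for t by (simp add: g_def)
  have nng: "(\<integral>\<^sup>+t. ennreal (g t) \<partial>lborel) \<le> ennreal \<gamma>"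
  proof -
    have "(\<integral>\<^sup>+t. ennreal (g t) \<partial>lborel) = (\<integral>\<^sup>+t. gE t \<partial>lborel)"
      using gfin by (intro nn_integral_cong_AE) (auto simp: g_def elim!: eventually_mono)
    then show ?thesis using gE by simp
  qed
  have gi: "integrable lborel g"
    by (rule integrableI_bounded) (use le_less_trans[OF nng ennreal_less_top] g0 in auto)
  have gint: "(\<integral>t. g t \<partial>lborel) \<le> \<gamma>"
    using nng nn_integral_eq_integral[OF gi] g0 \<gamma> by simp
  have zi: "integrable lborel (z j)" if "j < n" for j
  proof (rule integrable_of_square)
    have "(\<integral>\<^sup>+t. ennreal (\<mu>0 * (z j t)\<^sup>2) \<partial>lborel) \<le> (\<integral>\<^sup>+t. ennreal (\<mu> j * (z j t)\<^sup>2) \<partial>lborel)"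
      using \<mu> by (intro nn_integral_mono ennreal_leI mult_right_mono) auto
    also have "\<dots> \<le> (\<integral>\<^sup>+t. (\<Sum>j. ennreal (\<mu> j * (z j t)\<^sup>2)) \<partial>lborel)"
    proof (intro nn_integral_mono)
      fix t show "ennreal (\<mu> j * (z j t)\<^sup>2) \<le> (\<Sum>j. ennreal (\<mu> j * (z j t)\<^sup>2))"
        using sum_le_suminf[of "\<lambda>j. ennreal (\<mu> j * (z j t)\<^sup>2)" "{j}"] by simp
    qed
    also note small
    finally have "(\<integral>\<^sup>+t. ennreal (\<mu>0 * (z j t)\<^sup>2) \<partial>lborel) < \<infinity>"
      by (rule le_less_trans) simp
    then have "integrable lborel (\<lambda>t. \<mu>0 * (z j t)\<^sup>2)"
      using \<mu>0 by (intro integrableI_bounded) auto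
    then show "integrable lborel (\<lambda>t. (z j t)\<^sup>2)" using \<mu>0 by simp
  qed (use z0 in auto)
  define f where "f j s = - (\<kappa> * \<mu> j * (u s \<bullet> e j - z j s) + B (u s) (u s) (e j))" for j s
  have fi: "integrable lborel (f j)" if "j < n" for j
    unfolding f_def using coord(2,3) zi[OF that] by auto
  (* On [0,T] this is u_j - z_j; unlike that difference, it is a primitive on the whole line. *)
  define v where "v j t = \<xi> \<bullet> e j + primitive (f j) t" for j t
  have v: "v j t = u t \<bullet> e j - z j t" if "t \<in> {0..T}" for j t
  proof -
    have "f j = (\<lambda>s. -1 * (\<kappa> * \<mu> j * (u s \<bullet> e j - z j s) + B (u s) (u s) (e j)))"
      by (simp add: f_def fun_eq_iff)
    then have "primitive (f j) t
        = -1 * primitive (\<lambda>s. \<kappa> * \<mu> j * (u s \<bullet> e j - z j s) + B (u s) (u s) (e j)) t"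
      by (simp only: primitive_cmult)
    then show ?thesis using eq[OF that, of j] by (simp add: v_def)
  qed
  define E where "E t = (\<Sum>j<n. (v j t)\<^sup>2)" for t
  define p where "p t = (\<Sum>j<n. v j t *\<^sub>R e j)" for t
  have E0: "0 \<le> E t" for t by (simp add: E_def sum_nonneg)
  have normp: "norm (p t) = sqrt (E t)" for t
    using norm2_orthonormal_sum[OF e, of "{..<n}" "\<lambda>j. v j t"]
    by (simp add: p_def E_def real_sqrt_unique)
  have fv: "integrable lborel (\<lambda>s. f j s * v j s)" if "j < n" for j
    unfolding v_def using fi[OF that] integrable_mult_primitive[OF fi fi, OF that that] by (simp add: distrib_left)
  have Eeq: "E t = (\<Sum>j<n. (\<xi> \<bullet> e j)\<^sup>2) + 2 * primitive (\<lambda>s. \<Sum>j<n. f j s * v j s) t" for t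
  proof -
    have "E t = (\<Sum>j<n. (\<xi> \<bullet> e j)\<^sup>2 + 2 * primitive (\<lambda>s. f j s * v j s) t)"
      unfolding E_def v_def by (rule sum.cong) (auto simp: square_of_primitive[OF fi])
    also have "\<dots> = (\<Sum>j<n. (\<xi> \<bullet> e j)\<^sup>2) + 2 * primitive (\<lambda>s. \<Sum>j<n. f j s * v j s) t"
      using fv by (subst primitive_sum) (auto simp: sum.distrib sum_distrib_left)
    finally show ?thesis .
  qed
  have sums: "AE s in lborel. s \<in> {0..T} \<longrightarrow> (\<lambda>j. \<mu> j * ((u s - p s) \<bullet> e j)\<^sup>2) sums g s"
    using gfin
  proof (eventually_elim, intro impI)
    fix s assume fin: "gE s < \<infinity>" and s: "s \<in> {0..T}"
    have "(u s - p s) \<bullet> e j = (if j < n then z j s else u s \<bullet> e j)" for j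
      using v[OF s, of j] by (simp add: inner_diff_left p_def inner_orthonormal_sum[OF e])
    then have "(\<lambda>j. \<mu> j * ((u s - p s) \<bullet> e j)\<^sup>2) = (\<lambda>j. \<mu> j * (if j < n then z j s else u s \<bullet> e j)\<^sup>2)"
      by (simp only:)
    also have "\<dots> sums g s"
      unfolding g_def gE_def
      by (rule suminf_ennreal_finite_sums) (use fin \<mu>p in \<open>auto simp: gE_def\<close>)
    finally show "(\<lambda>j. \<mu> j * ((u s - p s) \<bullet> e j)\<^sup>2) sums g s" .
  qed
  have normu: "AE s in lborel. s \<in> {0..T} \<longrightarrow> norm (u s) \<le> sqrt (E s) + sqrt (g s) / sqrt \<mu>0"
    using sums
  proof (eventually_elim, intro impI)
    fix s assume s: "s \<in> {0..T} \<longrightarrow> (\<lambda>j. \<mu> j * ((u s - p s) \<bullet> e j)\<^sup>2) sums g s" "s \<in> {0..T}"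
    have "(norm (u s - p s))\<^sup>2 \<le> g s / \<mu>0"
      by (rule norm_le_energy[where \<mu> = \<mu>, OF e \<mu>0 \<mu>]) (use s in blast)
    then have "norm (u s - p s) \<le> sqrt (g s) / sqrt \<mu>0"
      by (simp add: real_le_rsqrt flip: real_sqrt_divide)
    moreover have "norm (u s) \<le> norm (p s) + norm (u s - p s)"
      using norm_triangle_sub by (simp add: add.commute norm_triangle_sub)
    ultimately show "norm (u s) \<le> sqrt (E s) + sqrt (g s) / sqrt \<mu>0" by (simp add: normp)
  qed
  define c where "c = \<kappa> * \<mu>0"
  have c: "0 < c" using \<kappa> \<mu>0 by (simp add: c_def)
  have diss: "AE s in lborel. s \<in> {0..T} \<longrightarrow>
      (\<Sum>j<n. f j s * v j s) \<le> - c * E s + C * (sqrt (E s) + sqrt (g s) / sqrt \<mu>0) * sqrt (g s) * sqrt (E s)"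
    using sums normu
  proof (eventually_elim, intro impI)
    fix s assume *: "s \<in> {0..T} \<longrightarrow> (\<lambda>j. \<mu> j * ((u s - p s) \<bullet> e j)\<^sup>2) sums g s" and s: "s \<in> {0..T}"
      and nu: "s \<in> {0..T} \<longrightarrow> norm (u s) \<le> sqrt (E s) + sqrt (g s) / sqrt \<mu>0"
    have dual: "B (u s) (u s) \<in> V_dual \<mu> e" using B unfolding condition_B_def by blast
    note Bp = V_dual_sum[where c = "\<lambda>j. v j s" and n = n, OF dual e \<mu>p, folded p_def]
    have "(\<Sum>j<n. f j s * v j s) = (\<Sum>j<n. - (\<kappa> * \<mu> j * (v j s)\<^sup>2) - v j s * B (u s) (u s) (e j))"
      by (rule sum.cong) (auto simp: f_def v[OF s] power2_eq_square algebra_simps)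
    also have "\<dots> = - (\<Sum>j<n. \<kappa> * \<mu> j * (v j s)\<^sup>2) - B (u s) (u s) (p s)"
      by (simp add: Bp sum_subtractf sum_negf)
    finally have f: "(\<Sum>j<n. f j s * v j s) = - (\<Sum>j<n. \<kappa> * \<mu> j * (v j s)\<^sup>2) - B (u s) (u s) (p s)" .
    have "c * E s \<le> (\<Sum>j<n. \<kappa> * \<mu> j * (v j s)\<^sup>2)"
      unfolding E_def sum_distrib_left c_def using \<kappa> \<mu> by (intro sum_mono mult_right_mono) auto
    moreover have "\<bar>B (u s) (u s) (p s)\<bar> \<le> C * norm (u s) * sqrt (g s) * norm (p s)"
      using tri[OF Bp(2)] * s by blast
    moreover have "C * norm (u s) * sqrt (g s) * norm (p s)
        \<le> C * (sqrt (E s) + sqrt (g s) / sqrt \<mu>0) * sqrt (g s) * sqrt (E s)"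
      unfolding normp using nu s C g0[of s] E0[of s] by (intro mult_right_mono mult_left_mono) auto
    ultimately show "(\<Sum>j<n. f j s * v j s) \<le> - c * E s + C * (sqrt (E s) + sqrt (g s) / sqrt \<mu>0) * sqrt (g s) * sqrt (E s)"
      unfolding f by linarith
  qed
  define S where "S = (SUP t\<in>{0..T}. E t)"
  obtain K where K: "\<And>t. E t \<le> K"
  proof
    fix t
    have "\<bar>v j t\<bar> \<le> \<bar>\<xi> \<bullet> e j\<bar> + (\<integral>s. \<bar>f j s\<bar> \<partial>lborel)" if "j < n" for j
      using abs_primitive_le[OF fi[OF that], of t] unfolding v_def by linarith
    then show "E t \<le> (\<Sum>j<n. (\<bar>\<xi> \<bullet> e j\<bar> + (\<integral>s. \<bar>f j s\<bar> \<partial>lborel))\<^sup>2)"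
      unfolding E_def by (intro sum_mono) (metis abs_ge_zero lessThan_iff power2_abs power_mono)
  qed
  have bdd: "bdd_above (E ` {0..T})" using K by (rule bdd_aboveI2)
  have ES: "E t \<le> S" if "t \<in> {0..T}" for t unfolding S_def using that bdd by (rule cSUP_upper)
  have S0: "0 \<le> S" using ES[of 0] E0[of 0] T by auto
  (* The weight in sqrt g \<le> (g / \<eta> + \<eta>) / 2 that makes C \<eta> T = 1/8. *)
  define \<eta> where "\<eta> = 1 / (8 * C * T)"
  have \<eta>: "0 < \<eta>" using C T by (simp add: \<eta>_def)
  define I where "I = (indicator {0..T} :: real \<Rightarrow> real)"
  have Ii: "integrable lborel I" and IT: "(\<integral>s. I s \<partial>lborel) = T"
    unfolding I_def using T by (auto simp: emeasure_lborel_Icc_eq intro!: integrable_real_indicator)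
  define \<alpha> where "\<alpha> = C * (S / (2 * \<eta>) + (1 + S) / (2 * sqrt \<mu>0))"
  have \<alpha>: "0 \<le> \<alpha>" using C S0 \<eta> \<mu>0 by (simp add: \<alpha>_def)
  define h where "h s = \<alpha> * g s + (C * \<eta> * S / 2) * I s" for s
  have hi: "integrable lborel h" unfolding h_def using gi Ii by (intro Bochner_Integration.integrable_add integrable_mult_right)
  have vm[measurable]: "v j \<in> borel_measurable borel" if "j < n" for j
    unfolding v_def using fi[OF that] by (auto intro!: borel_measurable_add measurable_primitive)
  have Em[measurable]: "E \<in> borel_measurable borel" unfolding E_def by (intro borel_measurable_sum borel_measurable_power vm) simp
  have Ei: "integrable lborel (\<lambda>s. I s * E s)"
  proof (rule Bochner_Integration.integrable_bound)
    show "integrable lborel (\<lambda>s. K * I s)" using Ii by (rule integrable_mult_right)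
    show "AE s in lborel. norm (I s * E s) \<le> norm (K * I s)"
      using K E0 order_trans[OF E0 K] by (auto simp: I_def abs_mult mult.commute split: split_indicator)
  qed (simp add: I_def)
  have prim_h: "primitive h t \<le> \<alpha> * \<gamma> + C * \<eta> * S / 2 * T" for t
  proof -
    have "primitive h t \<le> \<bar>primitive h t\<bar>" by simp
    also have "\<dots> \<le> (\<integral>s. \<bar>h s\<bar> \<partial>lborel)" by (rule abs_primitive_le[OF hi])
    also have "\<dots> = (\<integral>s. h s \<partial>lborel)"
      using \<alpha> g0 C \<eta> S0 by (intro Bochner_Integration.integral_cong) (auto simp: h_def I_def)
    also have "\<dots> = \<alpha> * (\<integral>s. g s \<partial>lborel) + C * \<eta> * S / 2 * T"
      unfolding h_def using gi Ii IT by simp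
    finally show ?thesis using mult_left_mono[OF gint \<alpha>] by linarith
  qed
  have main: "E t + 2 * c * primitive (\<lambda>s. I s * E s) t \<le> (norm \<xi>)\<^sup>2 + 1 / 4 + S / 2" if t: "t \<in> {0..T}" for t
  proof -
    have "primitive (\<lambda>s. \<Sum>j<n. f j s * v j s) t \<le> primitive (\<lambda>s. - c * (I s * E s) + h s) t"
    proof (rule primitive_mono_AE)
      show "integrable lborel (\<lambda>s. \<Sum>j<n. f j s * v j s)" using fv by auto
      show "integrable lborel (\<lambda>s. - c * (I s * E s) + h s)" using Ei hi by simp
      show "AE s in lborel. s \<in> {0..t} \<longrightarrow> (\<Sum>j<n. f j s * v j s) \<le> - c * (I s * E s) + h s"
        using diss
      proof (eventually_elim, intro impI)
        fix s assume s: "s \<in> {0..t}" and d: "s \<in> {0..T} \<longrightarrow>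
          (\<Sum>j<n. f j s * v j s) \<le> - c * E s + C * (sqrt (E s) + sqrt (g s) / sqrt \<mu>0) * sqrt (g s) * sqrt (E s)"
        have sT: "s \<in> {0..T}" using s t by auto
        have sE: "sqrt (E s) \<le> (1 + S) / 2"
          using sqrt_le_weighted[of 1 "E s"] E0 ES[OF sT] by simp
        have "C * (sqrt (E s) + sqrt (g s) / sqrt \<mu>0) * sqrt (g s) * sqrt (E s)
            = C * (sqrt (g s) * E s + g s / sqrt \<mu>0 * sqrt (E s))"
        proof -
          have "C * (sqrt (E s) + sqrt (g s) / sqrt \<mu>0) * sqrt (g s) * sqrt (E s)
            = C * (sqrt (g s) * (sqrt (E s) * sqrt (E s)) + sqrt (g s) * sqrt (g s) / sqrt \<mu>0 * sqrt (E s))"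
            by (simp only: distrib_left distrib_right times_divide_eq_left times_divide_eq_right mult_ac)
          then show ?thesis using E0 g0 by simp
        qed
        also have "\<dots> \<le> C * ((g s / \<eta> + \<eta>) / 2 * S + g s / sqrt \<mu>0 * ((1 + S) / 2))"
          using C g0 E0 \<mu>0 ES[OF sT] sE sqrt_le_weighted[OF \<eta> g0[of s]] \<eta>
          by (intro mult_left_mono add_mono mult_mono) auto
        also have "\<dots> = h s"
          using sT by (simp add: h_def I_def \<alpha>_def algebra_simps add_divide_distrib)
        finally show "(\<Sum>j<n. f j s * v j s) \<le> - c * (I s * E s) + h s"
          using d sT by (simp add: I_def)
      qed
    qed
    also have "\<dots> = - c * primitive (\<lambda>s. I s * E s) t + primitive h t"
      unfolding primitive_cmult[symmetric] using Ei hi by (intro primitive_add) auto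
    finally have "E t + 2 * c * primitive (\<lambda>s. I s * E s) t \<le> (\<Sum>j<n. (\<xi> \<bullet> e j)\<^sup>2) + 2 * primitive h t"
      using Eeq[of t] by (simp add: algebra_simps)
    also have "\<dots> \<le> (norm \<xi>)\<^sup>2 + 2 * (\<alpha> * \<gamma> + C * \<eta> * S / 2 * T)"
      using prim_h[of t] bessel_finite[OF e, of \<xi> n] by (intro add_mono mult_left_mono) simp_all
    also have "2 * (\<alpha> * \<gamma> + C * \<eta> * S / 2 * T) = (8 * C\<^sup>2 * T * \<gamma>) * S + (C * \<gamma> / sqrt \<mu>0) * (1 + S) + S / 8"
      using C T \<mu>0 by (simp add: \<alpha>_def \<eta>_def field_simps power2_eq_square)
    also have "\<dots> \<le> (1 / 8) * S + (1 / 4) * (1 + S) + S / 8"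
      using \<gamma> S0 by (intro add_mono mult_right_mono) auto
    finally show ?thesis by (simp add: field_simps)
  qed
  have prim0: "0 \<le> primitive (\<lambda>s. I s * E s) t" for t
    unfolding primitive_eq using E0 by (intro Bochner_Integration.integral_nonneg) (auto simp: I_def)
  have "S \<le> (norm \<xi>)\<^sup>2 + 1 / 4 + S / 2"
  proof -
    have "E t \<le> (norm \<xi>)\<^sup>2 + 1 / 4 + S / 2" if "t \<in> {0..T}" for t
      using main[OF that] mult_nonneg_nonneg[OF less_imp_le[OF c] prim0[of t]] by linarith
    then show "S \<le> (norm \<xi>)\<^sup>2 + 1 / 4 + S / 2"
      unfolding S_def using T by (intro cSUP_least) (auto simp: S_def)
  qed
  (* The supremum is finite, so its half can be subtracted. *)
  then have S: "S \<le> 2 * (norm \<xi>)\<^sup>2 + 1 / 2" by simp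
  have PE: "primitive (\<lambda>s. I s * E s) T = (\<integral>s. I s * E s \<partial>lborel)"
    unfolding primitive_eq by (rule Bochner_Integration.integral_cong) (auto simp: I_def indicator_def)
  have "2 * c * (\<integral>s. I s * E s \<partial>lborel) \<le> 2 * (norm \<xi>)\<^sup>2 + 1 / 2"
    using main[of T] E0[of T] S T unfolding PE by simp
  then have IE: "(\<integral>s. I s * E s \<partial>lborel) \<le> (4 * (norm \<xi>)\<^sup>2 + 1) / (4 * c)"
    using c by (simp add: field_simps)
  have "r\<^sup>2 * T = (\<integral>s. r\<^sup>2 * I s \<partial>lborel)" using IT by simp
  also have "\<dots> \<le> (\<integral>s. 2 * (I s * E s) + 2 / \<mu>0 * g s \<partial>lborel)"
  proof (rule integral_mono_AE)
    show "integrable lborel (\<lambda>s. r\<^sup>2 * I s)" using Ii by (rule integrable_mult_right)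
    show "integrable lborel (\<lambda>s. 2 * (I s * E s) + 2 / \<mu>0 * g s)" using Ei gi by simp
    show "AE s in lborel. r\<^sup>2 * I s \<le> 2 * (I s * E s) + 2 / \<mu>0 * g s"
      using far normu
    proof eventually_elim
      case (elim s)
      show ?case
      proof (cases "s \<in> {0..T}")
        case True
        have "r \<le> sqrt (E s) + sqrt (g s) / sqrt \<mu>0" using elim True by simp
        then have "r\<^sup>2 \<le> (sqrt (E s) + sqrt (g s) / sqrt \<mu>0)\<^sup>2" using r by (intro power_mono) auto
        also have "\<dots> \<le> 2 * (sqrt (E s))\<^sup>2 + 2 * (sqrt (g s) / sqrt \<mu>0)\<^sup>2"
          using zero_le_power2[of "sqrt (E s) - sqrt (g s) / sqrt \<mu>0"] unfolding power2_sum power2_diff by linarith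
        also have "\<dots> = 2 * E s + 2 / \<mu>0 * g s" using E0 g0 \<mu>0 by (simp add: power_divide)
        finally show ?thesis using True by (simp add: I_def)
      qed (use g0 \<mu>0 in \<open>simp add: I_def\<close>)
    qed
  qed
  also have "\<dots> = 2 * (\<integral>s. I s * E s \<partial>lborel) + 2 / \<mu>0 * (\<integral>s. g s \<partial>lborel)"
    using Ei gi by simp
  also have "\<dots> \<le> 2 * ((4 * (norm \<xi>)\<^sup>2 + 1) / (4 * c)) + 2 / \<mu>0 * 1"
    using IE gint \<gamma> \<mu>0 by (intro add_mono mult_left_mono) auto
  also have "\<dots> = (4 * (norm \<xi>)\<^sup>2 + 1) / (2 * \<kappa> * \<mu>0) + 2 / \<mu>0"
    using \<kappa> \<mu>0 by (simp add: c_def field_simps)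
  finally show False using T_large by simp
qed

section \<open>Second moments of Poisson integrals\<close>

definition poisson_weight :: "real \<Rightarrow> nat \<Rightarrow> real" where
  "poisson_weight l n = l ^ n / fact n * exp (- l)"

lemma poisson_weight_nonneg: "0 \<le> l \<Longrightarrow> 0 \<le> poisson_weight l n"
  by (simp add: poisson_weight_def)

lemma poisson_weight_sums: "poisson_weight l sums 1"
proof -
  have "(\<lambda>n. l ^ n /\<^sub>R fact n * exp (- l)) sums (exp l * exp (- l))"
    by (intro sums_mult2 exp_converges)
  then show ?thesis by (simp add: poisson_weight_def[abs_def] divide_inverse mult_ac exp_minus)
qed

lemma poisson_weight_Suc: "real (Suc n) * poisson_weight l (Suc n) = l * poisson_weight l n"
proof -
  have "fact (Suc n) = real (Suc n) * fact n" by simp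
  then show ?thesis unfolding poisson_weight_def by (simp only: power_Suc) (simp add: divide_simps del: of_nat_Suc)
qed

lemma poisson_first_moment: "(\<lambda>n. real n * poisson_weight l n) sums l"
proof (rule sums_Suc_imp)
  show "(\<lambda>n. real (Suc n) * poisson_weight l (Suc n)) sums l"
    unfolding poisson_weight_Suc using sums_mult[OF poisson_weight_sums, of l l] by simp
qed simp

lemma poisson_second_moment: "(\<lambda>n. (real n)\<^sup>2 * poisson_weight l n) sums (l\<^sup>2 + l)"
proof (rule sums_Suc_imp)
  have "(\<lambda>n. l * (real n * poisson_weight l n + poisson_weight l n)) sums (l * (l + 1))"
    by (intro sums_mult sums_add poisson_first_moment poisson_weight_sums)
  also have "(\<lambda>n. l * (real n * poisson_weight l n + poisson_weight l n))
      = (\<lambda>n. (real (Suc n))\<^sup>2 * poisson_weight l (Suc n))"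
  proof
    fix n
    have "(real (Suc n))\<^sup>2 * poisson_weight l (Suc n) = real (Suc n) * (l * poisson_weight l n)"
      unfolding poisson_weight_Suc[symmetric] by (simp add: power2_eq_square)
    then show "l * (real n * poisson_weight l n + poisson_weight l n) = (real (Suc n))\<^sup>2 * poisson_weight l (Suc n)"
      by (simp add: algebra_simps)
  qed
  finally show "(\<lambda>n. (real (Suc n))\<^sup>2 * poisson_weight l (Suc n)) sums (l\<^sup>2 + l)"
    by (simp add: power2_eq_square algebra_simps)
qed simp

text \<open>The probability measure \<open>Q\<close> varies: it is the original one or a conditional one.\<close>

definition random_measure_on :: "'w measure \<Rightarrow> 'a measure \<Rightarrow> ('w \<Rightarrow> 'a measure) \<Rightarrow> bool" where
  "random_measure_on Q \<mu> \<eta> \<longleftrightarrow> (\<forall>\<omega>\<in>space Q. sets (\<eta> \<omega>) = sets \<mu>) \<and>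
     (\<forall>A\<in>sets \<mu>. (\<lambda>\<omega>. emeasure (\<eta> \<omega>) A) \<in> borel_measurable Q)"

lemma nn_integral_seq_SUP:
  assumes "\<And>i. U i \<in> borel_measurable N" "incseq U"
  shows "(\<integral>\<^sup>+x. (SUP i. U i) x \<partial>N) = (SUP i. \<integral>\<^sup>+x. U i x \<partial>N)"
  using nn_integral_monotone_convergence_SUP[OF assms(2,1)] by (simp add: image_comp)

lemma random_measure_on_facts:
  assumes R: "random_measure_on Q \<mu> \<eta>" and \<omega>: "\<omega> \<in> space Q"
  shows "sets (\<eta> \<omega>) = sets \<mu>" "space (\<eta> \<omega>) = space \<mu>"
    "f \<in> borel_measurable \<mu> \<Longrightarrow> f \<in> borel_measurable (\<eta> \<omega>)"
proof -
  show s: "sets (\<eta> \<omega>) = sets \<mu>" using R \<omega> by (auto simp: random_measure_on_def)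
  show "space (\<eta> \<omega>) = space \<mu>" using s by (rule sets_eq_imp_space_eq)
  show "f \<in> borel_measurable \<mu> \<Longrightarrow> f \<in> borel_measurable (\<eta> \<omega>)"
    using s by (simp cong: measurable_cong_sets)
qed

lemma random_measure_measurable:
  assumes R: "random_measure_on Q \<mu> \<eta>" and f: "f \<in> borel_measurable \<mu>"
  shows "(\<lambda>\<omega>. \<integral>\<^sup>+x. f x \<partial>\<eta> \<omega>) \<in> borel_measurable Q"
  using f
proof (induction f rule: borel_measurable_induct)
  case (cong f g)
  have "(\<integral>\<^sup>+x. g x \<partial>\<eta> \<omega>) = (\<integral>\<^sup>+x. f x \<partial>\<eta> \<omega>)" if "\<omega> \<in> space Q" for \<omega>
    using random_measure_on_facts(2)[OF R that] cong.hyps(3) by (intro nn_integral_cong) simp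
  then show ?case using cong.IH by (simp cong: measurable_cong)
next
  case (set A)
  have "(\<integral>\<^sup>+x. indicator A x \<partial>\<eta> \<omega>) = emeasure (\<eta> \<omega>) A" if "\<omega> \<in> space Q" for \<omega>
    using random_measure_on_facts(1)[OF R that] set by (intro nn_integral_indicator) simp
  then show ?case using R set by (auto simp: random_measure_on_def cong: measurable_cong)
next
  case (mult u c)
  have "(\<integral>\<^sup>+x. c * u x \<partial>\<eta> \<omega>) = c * (\<integral>\<^sup>+x. u x \<partial>\<eta> \<omega>)" if "\<omega> \<in> space Q" for \<omega>
    by (rule nn_integral_cmult, rule random_measure_on_facts(3)[OF R that mult.hyps(2)])
  then show ?case using mult.IH by (simp cong: measurable_cong)
next
  case (add u v)
  have "(\<integral>\<^sup>+x. v x + u x \<partial>\<eta> \<omega>) = (\<integral>\<^sup>+x. v x \<partial>\<eta> \<omega>) + (\<integral>\<^sup>+x. u x \<partial>\<eta> \<omega>)" if "\<omega> \<in> space Q" for \<omega>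
    by (rule nn_integral_add; rule random_measure_on_facts(3)[OF R that]) (rule add.hyps)+
  then show ?case using add.IH by (simp cong: measurable_cong)
next
  case (seq U)
  have "(\<integral>\<^sup>+x. (SUP i. U i) x \<partial>\<eta> \<omega>) = (SUP i. \<integral>\<^sup>+x. U i x \<partial>\<eta> \<omega>)" if "\<omega> \<in> space Q" for \<omega>
    by (rule nn_integral_seq_SUP[OF random_measure_on_facts(3)[OF R that seq.hyps(1)] seq.hyps(3)])
  then show ?case using seq.IH by (simp cong: measurable_cong)
qed

lemma incseq_nn_integral: "incseq U \<Longrightarrow> incseq (\<lambda>i. \<integral>\<^sup>+x. U i x \<partial>N)"
  by (auto simp: incseq_def le_fun_def intro!: nn_integral_mono)

text \<open>For a fixed factor \<open>Y\<close>, the mixed moment is additive and monotonically continuous in \<open>f\<close>, so it is enough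
  to know it for indicators. Applied first with \<open>Y\<close> a count and then with \<open>Y\<close> an integral, this extends a formula
  for pairs of sets to pairs of functions.\<close>

lemma mixed_moment_extend:
  fixes h :: "'a \<Rightarrow> ennreal" and Y :: "'w \<Rightarrow> ennreal"
  assumes R: "random_measure_on Q \<mu> \<eta>" and D: "D \<in> sets \<mu>"
    and [measurable]: "Y \<in> borel_measurable Q" "h \<in> borel_measurable \<mu>"
    and base: "\<And>A. A \<in> sets \<mu> \<Longrightarrow> A \<subseteq> D \<Longrightarrow>
      (\<integral>\<^sup>+\<omega>. emeasure (\<eta> \<omega>) A * Y \<omega> \<partial>Q) = emeasure \<mu> A * c + (\<integral>\<^sup>+x. indicator A x * h x \<partial>\<mu>)"
    and f: "f \<in> borel_measurable \<mu>"
  shows "(\<integral>\<^sup>+\<omega>. (\<integral>\<^sup>+x. f x * indicator D x \<partial>\<eta> \<omega>) * Y \<omega> \<partial>Q)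
    = (\<integral>\<^sup>+x. f x * indicator D x \<partial>\<mu>) * c + (\<integral>\<^sup>+x. f x * indicator D x * h x \<partial>\<mu>)"
  using f
proof (induction f rule: borel_measurable_induct)
  case (cong f g)
  have "(\<integral>\<^sup>+\<omega>. (\<integral>\<^sup>+x. f x * indicator D x \<partial>\<eta> \<omega>) * Y \<omega> \<partial>Q) = (\<integral>\<^sup>+\<omega>. (\<integral>\<^sup>+x. g x * indicator D x \<partial>\<eta> \<omega>) * Y \<omega> \<partial>Q)"
    using cong.hyps(3) random_measure_on_facts(2)[OF R]
    by (intro nn_integral_cong arg_cong2[where f = "(*)"]) (auto intro!: nn_integral_cong)
  moreover have "(\<integral>\<^sup>+x. f x * indicator D x \<partial>\<mu>) = (\<integral>\<^sup>+x. g x * indicator D x \<partial>\<mu>)"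
    "(\<integral>\<^sup>+x. f x * indicator D x * h x \<partial>\<mu>) = (\<integral>\<^sup>+x. g x * indicator D x * h x \<partial>\<mu>)"
    using cong.hyps(3) by (auto intro!: nn_integral_cong)
  ultimately show ?case using cong.IH by simp
next
  case (set A)
  have AD: "A \<inter> D \<in> sets \<mu>" using set D by auto
  have 1: "(\<integral>\<^sup>+x. indicator A x * indicator D x \<partial>\<eta> \<omega>) = emeasure (\<eta> \<omega>) (A \<inter> D)" if "\<omega> \<in> space Q" for \<omega>
    using AD random_measure_on_facts(1)[OF R that] by (simp flip: indicator_inter_arith)
  have 2: "(\<integral>\<^sup>+x. indicator A x * indicator D x \<partial>\<mu>) = emeasure \<mu> (A \<inter> D)"
    using AD by (simp flip: indicator_inter_arith)
  have "(\<integral>\<^sup>+\<omega>. (\<integral>\<^sup>+x. indicator A x * indicator D x \<partial>\<eta> \<omega>) * Y \<omega> \<partial>Q) = (\<integral>\<^sup>+\<omega>. emeasure (\<eta> \<omega>) (A \<inter> D) * Y \<omega> \<partial>Q)"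
    by (intro nn_integral_cong) (simp add: 1)
  then show ?case unfolding 2 using base[OF AD] by (simp add: indicator_inter_arith)
next
  case (mult u k)
  note [measurable] = D mult.hyps(2)
  have [measurable]: "(\<lambda>\<omega>. \<integral>\<^sup>+x. u x * indicator D x \<partial>\<eta> \<omega>) \<in> borel_measurable Q"
    by (rule random_measure_measurable[OF R]) simp
  have 1: "(\<integral>\<^sup>+x. k * u x * indicator D x \<partial>\<eta> \<omega>) = k * (\<integral>\<^sup>+x. u x * indicator D x \<partial>\<eta> \<omega>)" if "\<omega> \<in> space Q" for \<omega>
    unfolding mult.assoc
    by (rule nn_integral_cmult, rule random_measure_on_facts(3)[OF R that]) simp
  have "(\<integral>\<^sup>+\<omega>. (\<integral>\<^sup>+x. k * u x * indicator D x \<partial>\<eta> \<omega>) * Y \<omega> \<partial>Q) = (\<integral>\<^sup>+\<omega>. k * ((\<integral>\<^sup>+x. u x * indicator D x \<partial>\<eta> \<omega>) * Y \<omega>) \<partial>Q)"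
    by (intro nn_integral_cong, subst 1) (auto simp: mult.assoc)
  also have "\<dots> = k * ((\<integral>\<^sup>+x. u x * indicator D x \<partial>\<mu>) * c + (\<integral>\<^sup>+x. u x * indicator D x * h x \<partial>\<mu>))"
    by (simp add: nn_integral_cmult mult.IH)
  also have "\<dots> = (\<integral>\<^sup>+x. k * u x * indicator D x \<partial>\<mu>) * c + (\<integral>\<^sup>+x. k * u x * indicator D x * h x \<partial>\<mu>)"
    by (simp add: nn_integral_cmult mult.assoc distrib_left)
  finally show ?case .
next
  case (add u v)
  note [measurable] = D add.hyps(1,3)
  have [measurable]: "(\<lambda>\<omega>. \<integral>\<^sup>+x. u x * indicator D x \<partial>\<eta> \<omega>) \<in> borel_measurable Q"
    "(\<lambda>\<omega>. \<integral>\<^sup>+x. v x * indicator D x \<partial>\<eta> \<omega>) \<in> borel_measurable Q"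
    by (rule random_measure_measurable[OF R], simp)+
  have 1: "(\<integral>\<^sup>+x. (v x + u x) * indicator D x \<partial>\<eta> \<omega>)
      = (\<integral>\<^sup>+x. v x * indicator D x \<partial>\<eta> \<omega>) + (\<integral>\<^sup>+x. u x * indicator D x \<partial>\<eta> \<omega>)" if "\<omega> \<in> space Q" for \<omega>
    unfolding distrib_right
    by (rule nn_integral_add; rule random_measure_on_facts(3)[OF R that]) simp_all
  have "(\<integral>\<^sup>+\<omega>. (\<integral>\<^sup>+x. (v x + u x) * indicator D x \<partial>\<eta> \<omega>) * Y \<omega> \<partial>Q)
      = (\<integral>\<^sup>+\<omega>. (\<integral>\<^sup>+x. v x * indicator D x \<partial>\<eta> \<omega>) * Y \<omega> + (\<integral>\<^sup>+x. u x * indicator D x \<partial>\<eta> \<omega>) * Y \<omega> \<partial>Q)"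
    by (intro nn_integral_cong, subst 1) (auto simp: distrib_right)
  also have "\<dots> = ((\<integral>\<^sup>+x. v x * indicator D x \<partial>\<mu>) * c + (\<integral>\<^sup>+x. v x * indicator D x * h x \<partial>\<mu>))
      + ((\<integral>\<^sup>+x. u x * indicator D x \<partial>\<mu>) * c + (\<integral>\<^sup>+x. u x * indicator D x * h x \<partial>\<mu>))"
    by (simp add: nn_integral_add add.IH)
  also have "\<dots> = (\<integral>\<^sup>+x. (v x + u x) * indicator D x \<partial>\<mu>) * c + (\<integral>\<^sup>+x. (v x + u x) * indicator D x * h x \<partial>\<mu>)"
    unfolding distrib_right by (simp add: nn_integral_add distrib_right)
  finally show ?case .
next
  case (seq U)
  note [measurable] = D seq.hyps(1)
  have inc: "incseq (\<lambda>i x. U i x * indicator D x * g x)" for g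
    using seq.hyps(3) by (auto simp: incseq_def le_fun_def intro!: mult_right_mono)
  have inc': "incseq (\<lambda>i x. U i x * indicator D x)"
    using seq.hyps(3) by (auto simp: incseq_def le_fun_def intro!: mult_right_mono)
  have [measurable]: "(\<lambda>\<omega>. \<integral>\<^sup>+x. U i x * indicator D x \<partial>\<eta> \<omega>) \<in> borel_measurable Q" for i
    by (rule random_measure_measurable[OF R]) simp
  have 1: "(\<integral>\<^sup>+x. (SUP i. U i) x * indicator D x \<partial>\<eta> \<omega>) = (SUP i. \<integral>\<^sup>+x. U i x * indicator D x \<partial>\<eta> \<omega>)" if "\<omega> \<in> space Q" for \<omega>
    unfolding SUP_apply SUP_mult_right_ennreal
    by (rule nn_integral_monotone_convergence_SUP[OF inc'], rule random_measure_on_facts(3)[OF R that]) simp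
  have "(\<integral>\<^sup>+\<omega>. (\<integral>\<^sup>+x. (SUP i. U i) x * indicator D x \<partial>\<eta> \<omega>) * Y \<omega> \<partial>Q)
      = (\<integral>\<^sup>+\<omega>. (SUP i. (\<integral>\<^sup>+x. U i x * indicator D x \<partial>\<eta> \<omega>) * Y \<omega>) \<partial>Q)"
    by (intro nn_integral_cong, subst 1) (auto simp: SUP_mult_right_ennreal)
  also have "\<dots> = (SUP i. \<integral>\<^sup>+\<omega>. (\<integral>\<^sup>+x. U i x * indicator D x \<partial>\<eta> \<omega>) * Y \<omega> \<partial>Q)"
    using seq.hyps(3) by (intro nn_integral_monotone_convergence_SUP)
      (auto simp: incseq_def le_fun_def intro!: mult_right_mono nn_integral_mono)
  also have "\<dots> = (SUP i. (\<integral>\<^sup>+x. U i x * indicator D x \<partial>\<mu>) * c + (\<integral>\<^sup>+x. U i x * indicator D x * h x \<partial>\<mu>))"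
    by (simp add: seq.IH)
  also have "\<dots> = (SUP i. (\<integral>\<^sup>+x. U i x * indicator D x \<partial>\<mu>) * c) + (SUP i. \<integral>\<^sup>+x. U i x * indicator D x * h x \<partial>\<mu>)"
    using incseq_nn_integral[OF inc'] incseq_nn_integral[OF inc[of h]]
    by (intro ennreal_SUP_add) (auto simp: incseq_def intro!: mult_right_mono)
  also have "\<dots> = (\<integral>\<^sup>+x. (SUP i. U i) x * indicator D x \<partial>\<mu>) * c + (\<integral>\<^sup>+x. (SUP i. U i) x * indicator D x * h x \<partial>\<mu>)"
    unfolding SUP_apply SUP_mult_right_ennreal
    by (simp add: nn_integral_monotone_convergence_SUP[OF inc'] nn_integral_monotone_convergence_SUP[OF inc[of h]]
        SUP_mult_right_ennreal)
  finally show ?case .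
qed

lemma second_moment_finite:
  assumes R: "random_measure_on Q \<mu> \<eta>" and D: "D \<in> sets \<mu>"
    and pair: "\<And>A B. A \<in> sets \<mu> \<Longrightarrow> B \<in> sets \<mu> \<Longrightarrow> A \<subseteq> D \<Longrightarrow> B \<subseteq> D \<Longrightarrow>
      (\<integral>\<^sup>+\<omega>. emeasure (\<eta> \<omega>) A * emeasure (\<eta> \<omega>) B \<partial>Q) = emeasure \<mu> A * emeasure \<mu> B + emeasure \<mu> (A \<inter> B)"
    and f[measurable]: "f \<in> borel_measurable \<mu>"
  shows "(\<integral>\<^sup>+\<omega>. (\<integral>\<^sup>+x. f x * indicator D x \<partial>\<eta> \<omega>)\<^sup>2 \<partial>Q)
    = (\<integral>\<^sup>+x. f x * indicator D x \<partial>\<mu>)\<^sup>2 + (\<integral>\<^sup>+x. (f x)\<^sup>2 * indicator D x \<partial>\<mu>)"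
proof -
  note [measurable] = D
  have count[measurable]: "(\<lambda>\<omega>. emeasure (\<eta> \<omega>) B) \<in> borel_measurable Q" if "B \<in> sets \<mu>" for B
    using R that by (auto simp: random_measure_on_def)
  have 1: "(\<integral>\<^sup>+\<omega>. (\<integral>\<^sup>+x. f x * indicator D x \<partial>\<eta> \<omega>) * emeasure (\<eta> \<omega>) B \<partial>Q)
      = (\<integral>\<^sup>+x. f x * indicator D x \<partial>\<mu>) * emeasure \<mu> B + (\<integral>\<^sup>+x. f x * indicator D x * indicator B x \<partial>\<mu>)"
    if B: "B \<in> sets \<mu>" "B \<subseteq> D" for B
  proof (rule mixed_moment_extend[OF R D])
    fix A assume A: "A \<in> sets \<mu>" "A \<subseteq> D"
    show "(\<integral>\<^sup>+\<omega>. emeasure (\<eta> \<omega>) A * emeasure (\<eta> \<omega>) B \<partial>Q)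
        = emeasure \<mu> A * emeasure \<mu> B + (\<integral>\<^sup>+x. indicator A x * indicator B x \<partial>\<mu>)"
      using pair[OF A(1) B(1) A(2) B(2)] A B by (simp flip: indicator_inter_arith)
  qed (use B in auto)
  let ?Y = "\<lambda>\<omega>. \<integral>\<^sup>+x. f x * indicator D x \<partial>\<eta> \<omega>"
  have "(\<integral>\<^sup>+\<omega>. ?Y \<omega> * ?Y \<omega> \<partial>Q)
      = (\<integral>\<^sup>+x. f x * indicator D x \<partial>\<mu>) * (\<integral>\<^sup>+x. f x * indicator D x \<partial>\<mu>) + (\<integral>\<^sup>+x. f x * indicator D x * (f x * indicator D x) \<partial>\<mu>)"
  proof (rule mixed_moment_extend[OF R D])
    show "?Y \<in> borel_measurable Q" by (rule random_measure_measurable[OF R]) simp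
    fix B assume B: "B \<in> sets \<mu>" "B \<subseteq> D"
    show "(\<integral>\<^sup>+\<omega>. emeasure (\<eta> \<omega>) B * ?Y \<omega> \<partial>Q)
        = emeasure \<mu> B * (\<integral>\<^sup>+x. f x * indicator D x \<partial>\<mu>) + (\<integral>\<^sup>+x. indicator B x * (f x * indicator D x) \<partial>\<mu>)"
      using 1[OF B] by (simp only: mult_ac)
  qed simp_all
  moreover have "f x * indicator D x * (f x * indicator D x) = (f x)\<^sup>2 * indicator D x" for x
    by (simp add: power2_eq_square split: split_indicator)
  ultimately show ?thesis by (simp add: power2_eq_square)
qed

lemma square_SUP_le:
  fixes X :: "nat \<Rightarrow> ennreal"
  assumes "incseq X"
  shows "(SUP i. X i)\<^sup>2 \<le> (SUP i. (X i)\<^sup>2)"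
proof -
  have "X i * X j \<le> (SUP i. (X i)\<^sup>2)" for i j
  proof -
    have "X i * X j \<le> X (max i j) * X (max i j)"
      using assms by (intro mult_mono) (auto simp: incseq_def)
    also have "\<dots> = (X (max i j))\<^sup>2" by (simp add: power2_eq_square)
    also have "\<dots> \<le> (SUP i. (X i)\<^sup>2)" by (rule SUP_upper) simp
    finally show ?thesis .
  qed
  then have "(SUP i. SUP j. X i * X j) \<le> (SUP i. (X i)\<^sup>2)"
    by (intro SUP_least)
  also have "(SUP i. SUP j. X i * X j) = (SUP i. X i)\<^sup>2"
    by (simp only: power2_eq_square SUP_mult_left_ennreal[symmetric] SUP_mult_right_ennreal[symmetric])
  finally show ?thesis .
qed

text \<open>Sets of finite intensity exhaust \<open>S\<close>, and both sides pass to the monotone limit.\<close>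

lemma second_moment_le:
  fixes \<mu> :: "'a measure"
  assumes R: "random_measure_on Q \<mu> \<eta>" and "sigma_finite_measure \<mu>" and S: "S \<in> sets \<mu>"
    and pair: "\<And>A B. A \<in> sets \<mu> \<Longrightarrow> B \<in> sets \<mu> \<Longrightarrow> A \<subseteq> S \<Longrightarrow> B \<subseteq> S \<Longrightarrow>
      emeasure \<mu> A < \<infinity> \<Longrightarrow> emeasure \<mu> B < \<infinity> \<Longrightarrow>
      (\<integral>\<^sup>+\<omega>. emeasure (\<eta> \<omega>) A * emeasure (\<eta> \<omega>) B \<partial>Q) = emeasure \<mu> A * emeasure \<mu> B + emeasure \<mu> (A \<inter> B)"
    and f[measurable]: "f \<in> borel_measurable \<mu>" and f0: "\<And>x. x \<in> space \<mu> - S \<Longrightarrow> f x = 0"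
  shows "(\<integral>\<^sup>+\<omega>. (\<integral>\<^sup>+x. f x \<partial>\<eta> \<omega>)\<^sup>2 \<partial>Q) \<le> (\<integral>\<^sup>+x. f x \<partial>\<mu>)\<^sup>2 + (\<integral>\<^sup>+x. (f x)\<^sup>2 \<partial>\<mu>)"
proof -
  interpret sigma_finite_measure \<mu> by fact
  note [measurable] = S
  obtain W :: "nat \<Rightarrow> 'a set" where W: "range W \<subseteq> sets \<mu>" "(\<Union>i. W i) = space \<mu>" "\<And>i. emeasure \<mu> (W i) \<noteq> \<infinity>" "incseq W"
    using sigma_finite_incseq by metis
  define D where "D i = W i \<inter> S" for i
  have D[measurable]: "D i \<in> sets \<mu>" for i using W S by (auto simp: D_def)
  have Dfin: "emeasure \<mu> A < \<infinity>" if "A \<subseteq> D i" "A \<in> sets \<mu>" for A i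
  proof -
    have "emeasure \<mu> A \<le> emeasure \<mu> (W i)"
      using that W(1) by (intro emeasure_mono) (auto simp: D_def)
    also have "\<dots> < \<infinity>" using W(3) by (simp add: less_top)
    finally show ?thesis .
  qed
  have Dinc: "incseq (\<lambda>i x. f x * indicator (D i) x)"
    using W(4) by (auto simp: incseq_def le_fun_def D_def split: split_indicator)
  have fD: "(SUP i. f x * indicator (D i) x) = f x" if x: "x \<in> space \<mu>" for x
  proof (cases "x \<in> S")
    case True
    obtain i where "x \<in> W i" using W x by blast
    then have "f x \<le> (SUP i. f x * indicator (D i) x)"
      using True by (intro SUP_upper2[of i]) (auto simp: D_def)
    moreover have "(SUP i. f x * indicator (D i) x) \<le> f x"
      by (intro SUP_least) (auto split: split_indicator)
    ultimately show ?thesis by (rule antisym[rotated])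
  qed (use f0 x in auto)
  have "(\<integral>\<^sup>+\<omega>. (\<integral>\<^sup>+x. f x \<partial>\<eta> \<omega>)\<^sup>2 \<partial>Q) \<le> (\<integral>\<^sup>+\<omega>. (SUP i. (\<integral>\<^sup>+x. f x * indicator (D i) x \<partial>\<eta> \<omega>)\<^sup>2) \<partial>Q)"
  proof (rule nn_integral_mono)
    fix \<omega> assume \<omega>: "\<omega> \<in> space Q"
    have "(\<integral>\<^sup>+x. f x \<partial>\<eta> \<omega>) = (\<integral>\<^sup>+x. (SUP i. f x * indicator (D i) x) \<partial>\<eta> \<omega>)"
      using random_measure_on_facts(2)[OF R \<omega>] by (intro nn_integral_cong) (simp add: fD)
    also have "\<dots> = (SUP i. \<integral>\<^sup>+x. f x * indicator (D i) x \<partial>\<eta> \<omega>)"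
      by (rule nn_integral_monotone_convergence_SUP[OF Dinc], rule random_measure_on_facts(3)[OF R \<omega>]) simp
    finally show "(\<integral>\<^sup>+x. f x \<partial>\<eta> \<omega>)\<^sup>2 \<le> (SUP i. (\<integral>\<^sup>+x. f x * indicator (D i) x \<partial>\<eta> \<omega>)\<^sup>2)"
      using square_SUP_le[OF incseq_nn_integral[OF Dinc]] by simp
  qed
  also have "\<dots> = (SUP i. \<integral>\<^sup>+\<omega>. (\<integral>\<^sup>+x. f x * indicator (D i) x \<partial>\<eta> \<omega>)\<^sup>2 \<partial>Q)"
  proof (rule nn_integral_monotone_convergence_SUP)
    show "(\<lambda>\<omega>. (\<integral>\<^sup>+x. f x * indicator (D i) x \<partial>\<eta> \<omega>)\<^sup>2) \<in> borel_measurable Q" for i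
      by (intro borel_measurable_power_ennreal random_measure_measurable[OF R]) simp
    show "incseq (\<lambda>i \<omega>. (\<integral>\<^sup>+x. f x * indicator (D i) x \<partial>\<eta> \<omega>)\<^sup>2)"
      using incseq_nn_integral[OF Dinc] by (auto simp: incseq_def le_fun_def intro!: power_mono)
  qed
  also have "\<dots> \<le> (\<integral>\<^sup>+x. f x \<partial>\<mu>)\<^sup>2 + (\<integral>\<^sup>+x. (f x)\<^sup>2 \<partial>\<mu>)"
  proof (rule SUP_least)
    fix i
    have "(\<integral>\<^sup>+\<omega>. (\<integral>\<^sup>+x. f x * indicator (D i) x \<partial>\<eta> \<omega>)\<^sup>2 \<partial>Q)
        = (\<integral>\<^sup>+x. f x * indicator (D i) x \<partial>\<mu>)\<^sup>2 + (\<integral>\<^sup>+x. (f x)\<^sup>2 * indicator (D i) x \<partial>\<mu>)"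
    proof (rule second_moment_finite[OF R D _ f])
      fix A B assume *: "A \<in> sets \<mu>" "B \<in> sets \<mu>" "A \<subseteq> D i" "B \<subseteq> D i"
      then have "A \<subseteq> S" "B \<subseteq> S" by (auto simp: D_def)
      then show "(\<integral>\<^sup>+\<omega>. emeasure (\<eta> \<omega>) A * emeasure (\<eta> \<omega>) B \<partial>Q) = emeasure \<mu> A * emeasure \<mu> B + emeasure \<mu> (A \<inter> B)"
        using * by (intro pair Dfin[of _ i])
    qed
    also have "\<dots> \<le> (\<integral>\<^sup>+x. f x \<partial>\<mu>)\<^sup>2 + (\<integral>\<^sup>+x. (f x)\<^sup>2 \<partial>\<mu>)"
      by (intro add_mono power_mono nn_integral_mono) (auto split: split_indicator)
    finally show "(\<integral>\<^sup>+\<omega>. (\<integral>\<^sup>+x. f x * indicator (D i) x \<partial>\<eta> \<omega>)\<^sup>2 \<partial>Q) \<le> (\<integral>\<^sup>+x. f x \<partial>\<mu>)\<^sup>2 + (\<integral>\<^sup>+x. (f x)\<^sup>2 \<partial>\<mu>)" .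
  qed
  finally show ?thesis .
qed

text \<open>The joint law of the counts on two disjoint sets is all that second moments see, so this much
  independence is recorded, and only for subsets of \<open>S\<close>; taking one of the sets empty gives the law of
  a single count.\<close>

definition poisson_counts_on :: "'w measure \<Rightarrow> 'a measure \<Rightarrow> ('w \<Rightarrow> 'a measure) \<Rightarrow> 'a set \<Rightarrow> bool" where
  "poisson_counts_on Q \<mu> \<eta> S \<longleftrightarrow> (\<forall>A\<in>sets \<mu>. \<forall>B\<in>sets \<mu>. A \<subseteq> S \<longrightarrow> B \<subseteq> S \<longrightarrow> A \<inter> B = {} \<longrightarrow>
     emeasure \<mu> A < \<infinity> \<longrightarrow> emeasure \<mu> B < \<infinity> \<longrightarrow>
     (\<forall>n m. emeasure Q {\<omega>\<in>space Q. emeasure (\<eta> \<omega>) A = of_nat n \<and> emeasure (\<eta> \<omega>) B = of_nat m}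
        = ennreal (poisson_weight (measure \<mu> A) n * poisson_weight (measure \<mu> B) m)))"

lemma suminf_ennreal_sums: "f sums s \<Longrightarrow> (\<And>n. 0 \<le> f n) \<Longrightarrow> (\<Sum>n. ennreal (f n)) = ennreal s"
  by (rule suminf_ennreal_eq)

text \<open>The weights sum to \<open>1\<close>, so both counts are almost surely finite and the expectation is a double series.\<close>

lemma poisson_counts_pair:
  assumes Q: "prob_space Q" and R: "random_measure_on Q \<mu> \<eta>" and C: "poisson_counts_on Q \<mu> \<eta> S"
    and A: "A \<in> sets \<mu>" "A \<subseteq> S" "emeasure \<mu> A < \<infinity>"
    and B: "B \<in> sets \<mu>" "B \<subseteq> S" "emeasure \<mu> B < \<infinity>" and AB: "A \<inter> B = {}"
  shows "(\<integral>\<^sup>+\<omega>. \<phi> (emeasure (\<eta> \<omega>) A) (emeasure (\<eta> \<omega>) B) \<partial>Q)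
    = (\<Sum>n. \<Sum>m. \<phi> (of_nat n) (of_nat m) * ennreal (poisson_weight (measure \<mu> A) n * poisson_weight (measure \<mu> B) m))"
proof -
  interpret prob_space Q by fact
  have [measurable]: "(\<lambda>\<omega>. emeasure (\<eta> \<omega>) A) \<in> borel_measurable Q" "(\<lambda>\<omega>. emeasure (\<eta> \<omega>) B) \<in> borel_measurable Q"
    using R A B by (auto simp: random_measure_on_def)
  define F where "F n m = {\<omega>\<in>space Q. emeasure (\<eta> \<omega>) A = of_nat n \<and> emeasure (\<eta> \<omega>) B = of_nat m}" for n m :: nat
  have F[measurable]: "F n m \<in> sets Q" for n m unfolding F_def by measurable
  have FQ: "emeasure Q (F n m) = ennreal (poisson_weight (measure \<mu> A) n * poisson_weight (measure \<mu> B) m)" for n m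
    using C A B AB unfolding poisson_counts_on_def F_def by blast
  have "(\<Sum>n. \<Sum>m. emeasure Q (F n m)) = 1"
  proof -
    have "(\<Sum>m. emeasure Q (F n m)) = ennreal (poisson_weight (measure \<mu> A) n)" for n
      unfolding FQ using sums_mult[OF poisson_weight_sums, of "poisson_weight (measure \<mu> A) n" "measure \<mu> B"]
      by (subst suminf_ennreal_sums) (auto intro!: mult_nonneg_nonneg poisson_weight_nonneg)
    then show ?thesis
      using suminf_ennreal_sums[OF poisson_weight_sums poisson_weight_nonneg[OF measure_nonneg], of \<mu> A] by simp
  qed
  moreover have disj: "disjoint_family (\<lambda>m. F n m)" "disjoint_family (\<lambda>n. \<Union>m. F n m)" for n
    by (auto simp: disjoint_family_on_def F_def)
  moreover have "(\<Sum>m. emeasure Q (F n m)) = emeasure Q (\<Union>m. F n m)" for n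
    by (rule suminf_emeasure) (use disj in auto)
  moreover have "(\<Sum>n. emeasure Q (\<Union>m. F n m)) = emeasure Q (\<Union>n m. F n m)"
    by (rule suminf_emeasure) (use disj in auto)
  ultimately have "emeasure Q (\<Union>n m. F n m) = 1" by simp
  then have ae: "AE \<omega> in Q. \<omega> \<in> (\<Union>n m. F n m)"
    by (intro AE_prob_1) (simp add: measure_def)
  have "(\<integral>\<^sup>+\<omega>. \<phi> (emeasure (\<eta> \<omega>) A) (emeasure (\<eta> \<omega>) B) \<partial>Q)
      = (\<integral>\<^sup>+\<omega>. (\<Sum>n. \<Sum>m. \<phi> (of_nat n) (of_nat m) * indicator (F n m) \<omega>) \<partial>Q)"
  proof (rule nn_integral_cong_AE)
    show "AE \<omega> in Q. \<phi> (emeasure (\<eta> \<omega>) A) (emeasure (\<eta> \<omega>) B)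
        = (\<Sum>n. \<Sum>m. \<phi> (of_nat n) (of_nat m) * indicator (F n m) \<omega>)"
      using ae
    proof eventually_elim
      case (elim \<omega>)
      then obtain a b where ab: "\<omega> \<in> F a b" by blast
      have ind: "indicator (F n m) \<omega> = (if n = a \<and> m = b then 1 else 0 :: ennreal)" for n m
        using ab by (auto simp: F_def split: split_indicator)
      have "(\<Sum>m. \<phi> (of_nat n) (of_nat m) * indicator (F n m) \<omega>) = (if n = a then \<phi> (of_nat a) (of_nat b) else 0)" for n
        using sums_unique[OF sums_single[of b "\<lambda>m. \<phi> (of_nat a) (of_nat m)"]]
        by (auto simp: ind if_distrib cong: if_cong)
      then have "(\<Sum>n. \<Sum>m. \<phi> (of_nat n) (of_nat m) * indicator (F n m) \<omega>) = \<phi> (of_nat a) (of_nat b)"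
        using sums_unique[OF sums_single[of a "\<lambda>n. \<phi> (of_nat a) (of_nat b)"]] by simp
      then show ?case using ab by (simp add: F_def)
    qed
  qed
  also have "\<dots> = (\<Sum>n. \<Sum>m. \<phi> (of_nat n) (of_nat m) * emeasure Q (F n m))"
    by (simp add: nn_integral_suminf nn_integral_cmult)
  finally show ?thesis unfolding FQ .
qed

lemma poisson_counts_moments:
  assumes Q: "prob_space Q" and R: "random_measure_on Q \<mu> \<eta>" and C: "poisson_counts_on Q \<mu> \<eta> S"
    and A: "A \<in> sets \<mu>" "A \<subseteq> S" "emeasure \<mu> A < \<infinity>"
    and B: "B \<in> sets \<mu>" "B \<subseteq> S" "emeasure \<mu> B < \<infinity>" and AB: "A \<inter> B = {}"
  shows "(\<integral>\<^sup>+\<omega>. emeasure (\<eta> \<omega>) A * emeasure (\<eta> \<omega>) B \<partial>Q) = emeasure \<mu> A * emeasure \<mu> B"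
    "(\<integral>\<^sup>+\<omega>. emeasure (\<eta> \<omega>) A * emeasure (\<eta> \<omega>) A \<partial>Q) = emeasure \<mu> A * emeasure \<mu> A + emeasure \<mu> A"
proof -
  define a b where "a = measure \<mu> A" and "b = measure \<mu> B"
  have a: "emeasure \<mu> A = ennreal a" "0 \<le> a" and b: "emeasure \<mu> B = ennreal b" "0 \<le> b"
    using A B by (auto simp: a_def b_def emeasure_eq_ennreal_measure less_top)
  have w: "0 \<le> poisson_weight a n" "0 \<le> poisson_weight b n" for n
    using a b by (auto intro: poisson_weight_nonneg)
  have "(\<Sum>m. of_nat n * of_nat m * ennreal (poisson_weight a n * poisson_weight b m)) = ennreal (real n * poisson_weight a n * b)" for n
  proof -
    have "(\<Sum>m. of_nat n * of_nat m * ennreal (poisson_weight a n * poisson_weight b m))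
        = (\<Sum>m. ennreal (real n * poisson_weight a n * (real m * poisson_weight b m)))"
      using w by (intro suminf_cong) (simp add: ennreal_mult ennreal_of_nat_eq_real_of_nat mult_ac)
    also have "\<dots> = ennreal (real n * poisson_weight a n * b)"
      using w by (intro suminf_ennreal_sums sums_mult poisson_first_moment) auto
    finally show ?thesis .
  qed
  moreover have "(\<Sum>n. ennreal (real n * poisson_weight a n * b)) = ennreal (a * b)"
    using sums_mult2[OF poisson_first_moment, of a b] w b by (intro suminf_ennreal_sums) auto
  ultimately show "(\<integral>\<^sup>+\<omega>. emeasure (\<eta> \<omega>) A * emeasure (\<eta> \<omega>) B \<partial>Q) = emeasure \<mu> A * emeasure \<mu> B"
    using poisson_counts_pair[OF Q R C A B AB, of "(*)"] a b by (simp add: a_def[symmetric] b_def[symmetric] ennreal_mult)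
  have "(\<Sum>m. of_nat n * of_nat n * ennreal (poisson_weight a n * poisson_weight b m)) = ennreal ((real n)\<^sup>2 * poisson_weight a n)" for n
  proof -
    have "(\<Sum>m. of_nat n * of_nat n * ennreal (poisson_weight a n * poisson_weight b m))
        = (\<Sum>m. ennreal ((real n)\<^sup>2 * poisson_weight a n * poisson_weight b m))"
      using w by (intro suminf_cong) (simp add: ennreal_mult ennreal_of_nat_eq_real_of_nat mult_ac power2_eq_square)
    also have "\<dots> = ennreal ((real n)\<^sup>2 * poisson_weight a n * 1)"
      using w by (intro suminf_ennreal_sums sums_mult poisson_weight_sums) auto
    finally show ?thesis by simp
  qed
  moreover have "(\<Sum>n. ennreal ((real n)\<^sup>2 * poisson_weight a n)) = ennreal (a\<^sup>2 + a)"
    using poisson_second_moment[of a] w by (intro suminf_ennreal_sums) auto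
  ultimately show "(\<integral>\<^sup>+\<omega>. emeasure (\<eta> \<omega>) A * emeasure (\<eta> \<omega>) A \<partial>Q) = emeasure \<mu> A * emeasure \<mu> A + emeasure \<mu> A"
    using poisson_counts_pair[OF Q R C A B AB, of "\<lambda>x y. x * x"] a
    by (simp add: a_def[symmetric] b_def[symmetric] ennreal_mult power2_eq_square)
qed

text \<open>The inequality form of \<open>E X\<^sup>2 = (E X)\<^sup>2 + Var X\<close> for \<open>X = \<integral> f d\<eta>\<close>. Overlapping sets \<open>A\<close>, \<open>B\<close> are
  cut into \<open>A - B\<close>, \<open>B - A\<close>, \<open>A \<inter> B\<close>.\<close>

lemma poisson_counts_second_moment:
  fixes \<mu> :: "'a measure"
  assumes Q: "prob_space Q" and R: "random_measure_on Q \<mu> \<eta>" and C: "poisson_counts_on Q \<mu> \<eta> S"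
    and sf: "sigma_finite_measure \<mu>" and S: "S \<in> sets \<mu>"
    and f: "f \<in> borel_measurable \<mu>" and f0: "\<And>x. x \<in> space \<mu> - S \<Longrightarrow> f x = 0"
  shows "(\<integral>\<^sup>+\<omega>. (\<integral>\<^sup>+x. f x \<partial>\<eta> \<omega>)\<^sup>2 \<partial>Q) \<le> (\<integral>\<^sup>+x. f x \<partial>\<mu>)\<^sup>2 + (\<integral>\<^sup>+x. (f x)\<^sup>2 \<partial>\<mu>)"
proof (rule second_moment_le[OF R sf S _ f f0])
  fix A B assume A: "A \<in> sets \<mu>" "A \<subseteq> S" "emeasure \<mu> A < \<infinity>" and B: "B \<in> sets \<mu>" "B \<subseteq> S" "emeasure \<mu> B < \<infinity>"
  define a b c where "a = A - B" and "b = B - A" and "c = A \<inter> B"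
  have abc: "a \<in> sets \<mu>" "a \<subseteq> S" "b \<in> sets \<mu>" "b \<subseteq> S" "c \<in> sets \<mu>" "c \<subseteq> S"
    "a \<inter> b = {}" "a \<inter> c = {}" "b \<inter> c = {}"
    using A B by (auto simp: a_def b_def c_def)
  have fin: "emeasure \<mu> a < \<infinity>" "emeasure \<mu> b < \<infinity>" "emeasure \<mu> c < \<infinity>"
    using A B emeasure_mono[of a A \<mu>] emeasure_mono[of b B \<mu>] emeasure_mono[of c A \<mu>]
    by (auto simp: a_def b_def c_def intro: le_less_trans)
  have split: "emeasure N A = emeasure N a + emeasure N c" "emeasure N B = emeasure N b + emeasure N c"
    if "sets N = sets \<mu>" for N
    using abc that by (auto simp: plus_emeasure a_def b_def c_def intro!: arg_cong2[where f = emeasure])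
  note [measurable] = abc(1,3,5)
  have [measurable]: "(\<lambda>\<omega>. emeasure (\<eta> \<omega>) X) \<in> borel_measurable Q" if "X \<in> sets \<mu>" for X
    using R that by (auto simp: random_measure_on_def)
  have "(\<integral>\<^sup>+\<omega>. emeasure (\<eta> \<omega>) A * emeasure (\<eta> \<omega>) B \<partial>Q)
      = (\<integral>\<^sup>+\<omega>. (emeasure (\<eta> \<omega>) a * emeasure (\<eta> \<omega>) b + emeasure (\<eta> \<omega>) a * emeasure (\<eta> \<omega>) c)
          + (emeasure (\<eta> \<omega>) b * emeasure (\<eta> \<omega>) c + emeasure (\<eta> \<omega>) c * emeasure (\<eta> \<omega>) c) \<partial>Q)"
    by (intro nn_integral_cong, simp only: split random_measure_on_facts(1)[OF R])
      (simp add: distrib_left distrib_right ac_simps)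
  also have "\<dots> = (emeasure \<mu> a * emeasure \<mu> b + emeasure \<mu> a * emeasure \<mu> c)
      + (emeasure \<mu> b * emeasure \<mu> c + (emeasure \<mu> c * emeasure \<mu> c + emeasure \<mu> c))"
    using abc fin by (simp add: nn_integral_add poisson_counts_moments(1)[OF Q R C] poisson_counts_moments(2)[OF Q R C, of c a] Int_commute)
  also have "\<dots> = emeasure \<mu> A * emeasure \<mu> B + emeasure \<mu> (A \<inter> B)"
    by (simp only: split[OF refl] c_def[symmetric]) (simp add: distrib_left distrib_right ac_simps)
  finally show "(\<integral>\<^sup>+\<omega>. emeasure (\<eta> \<omega>) A * emeasure (\<eta> \<omega>) B \<partial>Q) = emeasure \<mu> A * emeasure \<mu> B + emeasure \<mu> (A \<inter> B)" .
qed

section \<open>Conditioning the driving measures on prescribed counts\<close>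

definition count_event :: "'w measure \<Rightarrow> ('w \<Rightarrow> 'a measure) \<Rightarrow> (nat \<Rightarrow> 'a set) \<Rightarrow> (nat \<Rightarrow> nat) \<Rightarrow> nat \<Rightarrow> 'w set" where
  "count_event M \<eta> A c n = {\<omega>\<in>space M. \<forall>l<n. emeasure (\<eta> \<omega>) (A l) = of_nat (c l)}"

lemma count_event_in_events:
  assumes "\<And>l. l < n \<Longrightarrow> A l \<in> \<A>"
  shows "count_event M \<eta> A c n \<in> random_measure_events M \<eta> \<A>"
  using assms
proof (induction n)
  case 0
  show ?case by (simp add: count_event_def random_measure_events_def sigma_sets_top)
next
  case (Suc n)
  interpret sigma_algebra "space M" "random_measure_events M \<eta> \<A>"
    unfolding random_measure_events_def by (rule sigma_algebra_sigma_sets) auto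
  have "(\<lambda>\<omega>. emeasure (\<eta> \<omega>) (A n)) -` {of_nat (c n)} \<inter> space M \<in> random_measure_events M \<eta> \<A>"
    unfolding random_measure_events_def using Suc(2)[of n]
    by (intro sigma_sets.Basic CollectI exI[of _ "A n"] exI[of _ "{of_nat (c n)}"]) auto
  moreover have "count_event M \<eta> A c (Suc n)
      = count_event M \<eta> A c n \<inter> ((\<lambda>\<omega>. emeasure (\<eta> \<omega>) (A n)) -` {of_nat (c n)} \<inter> space M)"
    by (auto simp: count_event_def less_Suc_eq)
  moreover have "count_event M \<eta> A c n \<in> random_measure_events M \<eta> \<A>" using Suc by simp
  ultimately show ?case by (simp only: Int)
qed

lemma poisson_random_measureD:
  assumes "poisson_random_measure M \<mu> \<eta>"
  shows "random_measure_on M \<mu> \<eta>"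
    "A \<in> sets \<mu> \<Longrightarrow> emeasure \<mu> A < \<infinity> \<Longrightarrow>
      measure M {\<omega> \<in> space M. emeasure (\<eta> \<omega>) A = of_nat n} = poisson_weight (measure \<mu> A) n"
    "range D \<subseteq> sets \<mu> \<Longrightarrow> disjoint_family D \<Longrightarrow>
      prob_space.indep_vars M (\<lambda>_. borel) (\<lambda>i \<omega>. emeasure (\<eta> \<omega>) (D i)) (UNIV :: nat set)"
  using assms unfolding poisson_random_measure_def random_measure_on_def poisson_weight_def by blast+

lemma count_event_prob:
  assumes M: "prob_space M" and P: "poisson_random_measure M \<mu> \<eta>"
    and A: "\<And>l. l < n \<Longrightarrow> A l \<in> sets \<mu>" "\<And>l. l < n \<Longrightarrow> emeasure \<mu> (A l) < \<infinity>"
    and disj: "disjoint_family_on A {..<n}"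
  shows "measure M (count_event M \<eta> A c n) = (\<Prod>l<n. poisson_weight (measure \<mu> (A l)) (c l))"
proof (cases "n = 0")
  case True
  then show ?thesis using prob_space.prob_space[OF M] by (simp add: count_event_def)
next
  case False
  interpret prob_space M by fact
  define D where "D l = (if l < n then A l else {})" for l
  have "disjoint_family D" using disj by (auto simp: disjoint_family_on_def D_def)
  moreover have "range D \<subseteq> sets \<mu>" using A by (auto simp: D_def)
  ultimately have ind: "indep_vars (\<lambda>_. borel) (\<lambda>i \<omega>. emeasure (\<eta> \<omega>) (D i)) (UNIV :: nat set)"
    using poisson_random_measureD(3)[OF P] by blast
  have "prob (\<Inter>l\<in>{..<n}. (\<lambda>\<omega>. emeasure (\<eta> \<omega>) (D l)) -` {of_nat (c l)} \<inter> space M)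
      = (\<Prod>l\<in>{..<n}. prob ((\<lambda>\<omega>. emeasure (\<eta> \<omega>) (D l)) -` {of_nat (c l)} \<inter> space M))"
    using False by (intro indep_varsD[OF ind]) auto
  also have "(\<Inter>l\<in>{..<n}. (\<lambda>\<omega>. emeasure (\<eta> \<omega>) (D l)) -` {of_nat (c l)} \<inter> space M) = count_event M \<eta> A c n"
    using False by (auto simp: count_event_def D_def)
  also have "(\<Prod>l\<in>{..<n}. prob ((\<lambda>\<omega>. emeasure (\<eta> \<omega>) (D l)) -` {of_nat (c l)} \<inter> space M))
      = (\<Prod>l<n. poisson_weight (measure \<mu> (A l)) (c l))"
  proof (rule prod.cong[OF refl])
    fix l assume "l \<in> {..<n}"
    moreover have "(\<lambda>\<omega>. emeasure (\<eta> \<omega>) (A l)) -` {of_nat (c l)} \<inter> space M = {\<omega> \<in> space M. emeasure (\<eta> \<omega>) (A l) = of_nat (c l)}"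
      by auto
    ultimately show "prob ((\<lambda>\<omega>. emeasure (\<eta> \<omega>) (D l)) -` {of_nat (c l)} \<inter> space M) = poisson_weight (measure \<mu> (A l)) (c l)"
      using poisson_random_measureD(2)[OF P] A by (simp add: D_def)
  qed
  finally show ?thesis .
qed

text \<open>Two more disjoint sets join the family, so the counts on them contribute two more factors.\<close>

lemma count_event_insert_pair:
  assumes M: "prob_space M" and P: "poisson_random_measure M \<mu> \<eta>"
    and A: "\<And>l. l < n \<Longrightarrow> A l \<in> sets \<mu>" "\<And>l. l < n \<Longrightarrow> emeasure \<mu> (A l) < \<infinity>"
    and disj: "disjoint_family_on A {..<n}"
    and B: "B1 \<in> sets \<mu>" "B2 \<in> sets \<mu>" "emeasure \<mu> B1 < \<infinity>" "emeasure \<mu> B2 < \<infinity>" "B1 \<inter> B2 = {}"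
    and BA: "\<And>l. l < n \<Longrightarrow> A l \<inter> (B1 \<union> B2) = {}"
  shows "measure M (count_event M \<eta> A c n \<inter> {\<omega>\<in>space M. emeasure (\<eta> \<omega>) B1 = of_nat a \<and> emeasure (\<eta> \<omega>) B2 = of_nat b})
    = measure M (count_event M \<eta> A c n) * (poisson_weight (measure \<mu> B1) a * poisson_weight (measure \<mu> B2) b)"
    "count_event M \<eta> A c n \<inter> {\<omega>\<in>space M. emeasure (\<eta> \<omega>) B1 = of_nat a \<and> emeasure (\<eta> \<omega>) B2 = of_nat b}
      \<in> random_measure_events M \<eta> (sets \<mu>)"
proof -
  define A' where "A' l = (if l < n then A l else if l = n then B1 else B2)" for l
  define c' where "c' l = (if l < n then c l else if l = n then a else b)" for l
  have eq: "count_event M \<eta> A c n \<inter> {\<omega>\<in>space M. emeasure (\<eta> \<omega>) B1 = of_nat a \<and> emeasure (\<eta> \<omega>) B2 = of_nat b}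
      = count_event M \<eta> A' c' (Suc (Suc n))"
    by (auto simp: count_event_def A'_def c'_def less_Suc_eq)
  have A': "A' l \<in> sets \<mu>" "emeasure \<mu> (A' l) < \<infinity>" if "l < Suc (Suc n)" for l
    using A B that by (auto simp: A'_def)
  have base: "measure M (count_event M \<eta> A c n) = (\<Prod>l<n. poisson_weight (measure \<mu> (A l)) (c l))"
    by (rule count_event_prob[OF M P A disj])
  have "disjoint_family_on A' {..<Suc (Suc n)}"
    using disj B(5) BA unfolding disjoint_family_on_def A'_def by (auto simp: less_Suc_eq; blast)
  from count_event_prob[where A = A' and n = "Suc (Suc n)", OF M P A' this, of c']
  show "measure M (count_event M \<eta> A c n \<inter> {\<omega>\<in>space M. emeasure (\<eta> \<omega>) B1 = of_nat a \<and> emeasure (\<eta> \<omega>) B2 = of_nat b})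
    = measure M (count_event M \<eta> A c n) * (poisson_weight (measure \<mu> B1) a * poisson_weight (measure \<mu> B2) b)"
    unfolding eq base by (simp add: A'_def c'_def mult_ac)
  show "count_event M \<eta> A c n \<inter> {\<omega>\<in>space M. emeasure (\<eta> \<omega>) B1 = of_nat a \<and> emeasure (\<eta> \<omega>) B2 = of_nat b}
      \<in> random_measure_events M \<eta> (sets \<mu>)"
    unfolding eq by (rule count_event_in_events) (use A' in auto)
qed

text \<open>Complete randomness and the independence of the components: an event that fixes finitely many counts in finitely many
  components leaves the Poisson law of the counts on disjoint regions, and in the other components, unchanged.\<close>

lemma poisson_counts_conditioned:
  assumes M: "prob_space M" and P: "\<And>k. poisson_random_measure M \<mu> (\<eta> k)"
    and ind: "prob_space.indep_sets M (\<lambda>k. random_measure_events M (\<eta> k) (sets \<mu>)) (UNIV :: nat set)"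
    and A: "\<And>l. l < n \<Longrightarrow> A l \<in> sets \<mu>" "\<And>l. l < n \<Longrightarrow> emeasure \<mu> (A l) < \<infinity>"
    and disj: "disjoint_family_on A {..<n}"
    and pos: "\<And>l. l < n \<Longrightarrow> 0 < poisson_weight (measure \<mu> (A l)) (c l)"
    and G: "G = {\<omega>\<in>space M. \<forall>k<N. \<omega> \<in> count_event M (\<eta> k) A c n}"
  shows "G \<in> sets M" "0 < emeasure M G"
    "k < N \<Longrightarrow> (\<And>l. l < n \<Longrightarrow> A l \<inter> S = {}) \<Longrightarrow> poisson_counts_on (uniform_measure M G) \<mu> (\<eta> k) S"
    "N \<le> k \<Longrightarrow> poisson_counts_on (uniform_measure M G) \<mu> (\<eta> k) (space \<mu>)"
proof -
  interpret prob_space M by fact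
  define nn where "nn i = (if i < N then n else 0)" for i
  define E where "E i = count_event M (\<eta> i) A c (nn i)" for i
  have A': "\<And>i l. l < nn i \<Longrightarrow> A l \<in> sets \<mu>" "\<And>i l. l < nn i \<Longrightarrow> emeasure \<mu> (A l) < \<infinity>"
    "\<And>i. disjoint_family_on A {..<nn i}"
    using A disj by (auto simp: nn_def split: if_splits) (auto simp: disjoint_family_on_def)
  have ev: "random_measure_events M (\<eta> i) (sets \<mu>) \<subseteq> events" for i
    using indep_setsD(1)[OF ind] ind unfolding indep_sets_def by blast
  have E_in: "E i \<in> random_measure_events M (\<eta> i) (sets \<mu>)" for i
    unfolding E_def by (rule count_event_in_events) (rule A'(1))
  have GE: "G = (\<Inter>i\<in>insert k {..<N}. E i)" for k
    by (auto simp: G E_def nn_def count_event_def split: if_splits)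
  have prodG: "prob G = (\<Prod>i\<in>insert k {..<N}. prob (E i))" for k
    unfolding GE[of k] by (rule indep_setsD[OF ind]) (use E_in in auto)
  have Epos: "0 < prob (E i)" for i
    unfolding E_def using count_event_prob[where A = A and n = "nn i" and \<eta> = "\<eta> i" and c = c, OF M P A'(1,2,3)] pos
    by (auto simp: nn_def intro!: prod_pos split: if_splits)
  show Gs: "G \<in> events" unfolding GE[of 0] using E_in ev by (intro sets.finite_INT) auto
  have Gpos: "0 < prob G" unfolding prodG[of 0] using Epos by (intro prod_pos) auto
  then show "0 < emeasure M G" by (simp add: emeasure_eq_measure)
  have main: "poisson_counts_on (uniform_measure M G) \<mu> (\<eta> k) S" if S: "\<And>l. l < nn k \<Longrightarrow> A l \<inter> S = {}" for k S
    unfolding poisson_counts_on_def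
  proof (intro ballI impI allI)
    fix B1 B2 a b assume B: "B1 \<in> sets \<mu>" "B2 \<in> sets \<mu>" and BS: "B1 \<subseteq> S" "B2 \<subseteq> S" and B12: "B1 \<inter> B2 = {}"
      and Bfin: "emeasure \<mu> B1 < \<infinity>" "emeasure \<mu> B2 < \<infinity>"
    let ?H = "{\<omega>\<in>space M. emeasure (\<eta> k \<omega>) B1 = of_nat a \<and> emeasure (\<eta> k \<omega>) B2 = of_nat b}"
    let ?w = "poisson_weight (measure \<mu> B1) a * poisson_weight (measure \<mu> B2) b"
    have BA: "A l \<inter> (B1 \<union> B2) = {}" if "l < nn k" for l using S[OF that] BS by blast
    note pair = count_event_insert_pair[where A = A and n = "nn k" and \<eta> = "\<eta> k" and c = c and a = a and b = b,
      OF M P A'(1,2,3) B Bfin B12 BA, folded E_def]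
    define E' where "E' i = (if i = k then E k \<inter> ?H else E i)" for i
    have "G \<inter> ?H = (\<Inter>i\<in>insert k {..<N}. E' i)" unfolding GE[of k] E'_def by (auto split: if_splits)
    also have "prob \<dots> = (\<Prod>i\<in>insert k {..<N}. prob (E' i))"
      by (rule indep_setsD[OF ind]) (use E_in pair(2) in \<open>auto simp: E'_def\<close>)
    also have "\<dots> = prob (E' k) * (\<Prod>i\<in>{..<N} - {k}. prob (E' i))"
      by (simp add: prod.insert_remove)
    also have "(\<Prod>i\<in>{..<N} - {k}. prob (E' i)) = (\<Prod>i\<in>{..<N} - {k}. prob (E i))"
      by (rule prod.cong) (auto simp: E'_def)
    also have "prob (E' k) = prob (E k) * ?w" using pair(1) by (simp add: E'_def)
    also have "prob (E k) * ?w * (\<Prod>i\<in>{..<N} - {k}. prob (E i)) = prob G * ?w"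
      unfolding prodG[of k] by (simp add: prod.insert_remove)
    finally have GH: "prob (G \<inter> ?H) = prob G * ?w" .
    have H: "?H \<in> events"
    proof -
      have "(\<lambda>\<omega>. emeasure (\<eta> k \<omega>) B1) \<in> borel_measurable M" "(\<lambda>\<omega>. emeasure (\<eta> k \<omega>) B2) \<in> borel_measurable M"
        using poisson_random_measureD(1)[OF P] B by (auto simp: random_measure_on_def)
      then show ?thesis by measurable
    qed
    have "emeasure (uniform_measure M G) ?H = emeasure M (G \<inter> ?H) / emeasure M G"
      using Gs H by simp
    also have "\<dots> = ennreal (prob G * ?w / prob G)"
      unfolding emeasure_eq_measure GH using Gpos by (intro divide_ennreal) (auto intro!: mult_nonneg_nonneg poisson_weight_nonneg)
    also have "prob G * ?w / prob G = ?w" using Gpos by simp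
    finally show "emeasure (uniform_measure M G) {\<omega> \<in> space (uniform_measure M G). emeasure (\<eta> k \<omega>) B1 = of_nat a \<and> emeasure (\<eta> k \<omega>) B2 = of_nat b}
        = ennreal ?w" by simp
  qed
  show "poisson_counts_on (uniform_measure M G) \<mu> (\<eta> k) S" if "k < N" "\<And>l. l < n \<Longrightarrow> A l \<inter> S = {}"
    by (rule main) (use that in \<open>simp add: nn_def\<close>)
  show "poisson_counts_on (uniform_measure M G) \<mu> (\<eta> k) (space \<mu>)" if "N \<le> k"
    by (rule main) (use that in \<open>simp add: nn_def\<close>)
qed

section \<open>Jump sums\<close>

text \<open>What the argument needs of the Levy measure: finite first and second moments, also near \<open>0\<close>, which make
  the compensator of the small jumps a plain drift, and jumps of every size.\<close>

locale jump_law =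
  fixes \<nu> :: "real measure"
  assumes sets_nu: "sets \<nu> = sets (restrict_space borel (- {0}))"
    and sigma_finite_nu: "sigma_finite_measure \<nu>"
    and abs_moment: "(\<integral>\<^sup>+z. ennreal \<bar>z\<bar> \<partial>\<nu>) < \<infinity>"
    and square_moment: "(\<integral>\<^sup>+z. ennreal (z\<^sup>2) \<partial>\<nu>) < \<infinity>"
    and full_support: "\<And>a b. a < b \<Longrightarrow> 0 \<notin> {a<..<b} \<Longrightarrow> 0 < emeasure \<nu> {a<..<b}"
begin

lemma space_nu: "space \<nu> = - {0}"
  using sets_eq_imp_space_eq[OF sets_nu] by (simp add: space_restrict_space)

lemma sets_nu_iff: "Z \<in> sets \<nu> \<longleftrightarrow> Z \<in> sets borel \<and> 0 \<notin> Z"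
  unfolding sets_nu by (subst sets_restrict_space_iff) auto

lemma borel_measurable_nu: "f \<in> borel_measurable borel \<Longrightarrow> f \<in> borel_measurable \<nu>"
  unfolding measurable_cong_sets[OF sets_nu refl] by (rule measurable_restrict_space1)

definition J :: "(real \<times> real) measure" where "J = jump_intensity \<nu>"

lemma sigma_finite_time: "sigma_finite_measure (restrict_space lborel {0::real..})"
  by (rule sigma_finite_measure_restrict_space) (auto intro: lborel.sigma_finite_measure_axioms)

lemma sigma_finite_J: "sigma_finite_measure J"
proof -
  interpret pair_sigma_finite \<nu> "restrict_space lborel {0::real..}"
    using sigma_finite_nu sigma_finite_time by (simp add: pair_sigma_finite_def)
  show ?thesis unfolding J_def jump_intensity_def by unfold_locales
qed

lemma sets_time: "0 \<le> a \<Longrightarrow> {a<..b} \<in> sets (restrict_space lborel {0::real..})"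
  by (subst sets_restrict_space_iff) auto

lemma rectangle_in_J: "Z \<in> sets \<nu> \<Longrightarrow> 0 \<le> a \<Longrightarrow> Z \<times> {a<..b} \<in> sets J"
  unfolding J_def jump_intensity_def by (intro pair_measureI sets_time)

lemma space_J: "space J = (- {0}) \<times> {0..}"
  by (simp add: J_def jump_intensity_def space_pair_measure space_nu space_restrict_space)

lemma fst_measurable_J: "f \<in> borel_measurable borel \<Longrightarrow> (\<lambda>p. f (fst p)) \<in> borel_measurable J"
  unfolding J_def jump_intensity_def
  by (rule measurable_compose[OF measurable_fst borel_measurable_nu])

lemma time_emeasure: "0 \<le> a \<Longrightarrow> a \<le> b \<Longrightarrow> emeasure (restrict_space lborel {0::real..}) {a<..b} = ennreal (b - a)"
  by (subst emeasure_restrict_space) auto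

lemma nn_integral_J:
  assumes f: "f \<in> borel_measurable borel" and Z: "Z \<in> sets \<nu>" and ab: "0 \<le> a" "a \<le> b"
  shows "(\<integral>\<^sup>+p. f (fst p) * indicator (Z \<times> {a<..b}) p \<partial>J) = (\<integral>\<^sup>+z. f z * indicator Z z \<partial>\<nu>) * ennreal (b - a)"
proof -
  let ?R = "restrict_space lborel {0::real..}"
  interpret T: sigma_finite_measure ?R by (rule sigma_finite_time)
  note [measurable] = borel_measurable_nu[OF f] Z
  have m: "(\<lambda>p. f (fst p) * indicator (Z \<times> {a<..b}) p) \<in> borel_measurable (\<nu> \<Otimes>\<^sub>M ?R)"
    using fst_measurable_J[OF f] rectangle_in_J[OF Z ab(1), of b] unfolding J_def jump_intensity_def by simp
  have "(\<integral>\<^sup>+p. f (fst p) * indicator (Z \<times> {a<..b}) p \<partial>J)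
      = (\<integral>\<^sup>+z. (\<integral>\<^sup>+t. f z * indicator (Z \<times> {a<..b}) (z, t) \<partial>?R) \<partial>\<nu>)"
    unfolding J_def jump_intensity_def using T.nn_integral_fst[OF m] by simp
  also have "\<dots> = (\<integral>\<^sup>+z. (f z * indicator Z z) * ennreal (b - a) \<partial>\<nu>)"
  proof (rule nn_integral_cong)
    fix z
    have "(\<integral>\<^sup>+t. f z * indicator (Z \<times> {a<..b}) (z, t) \<partial>?R) = (\<integral>\<^sup>+t. (f z * indicator Z z) * indicator {a<..b} t \<partial>?R)"
      by (rule nn_integral_cong) (auto split: split_indicator)
    then show "(\<integral>\<^sup>+t. f z * indicator (Z \<times> {a<..b}) (z, t) \<partial>?R) = (f z * indicator Z z) * ennreal (b - a)"
      using sets_time[OF ab(1), of b] by (simp add: nn_integral_cmult_indicator time_emeasure[OF ab])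
  qed
  also have "\<dots> = (\<integral>\<^sup>+z. f z * indicator Z z \<partial>\<nu>) * ennreal (b - a)"
    by (rule nn_integral_multc) simp
  finally show ?thesis .
qed

lemma emeasure_J:
  assumes Z: "Z \<in> sets \<nu>" and ab: "0 \<le> a" "a \<le> b"
  shows "emeasure J (Z \<times> {a<..b}) = emeasure \<nu> Z * ennreal (b - a)"
  using nn_integral_J[of "\<lambda>_. 1", OF _ Z ab] rectangle_in_J[OF Z ab(1), of b] Z by simp

text \<open>Total absolute size and sum of the jumps with sizes in \<open>Z\<close> at times in \<open>(a, b]\<close>. The former is defined
  for every measure and dominates the latter, which is \<open>0\<close> when the jumps are not summable.\<close>

definition jump_mass :: "(real \<times> real) measure \<Rightarrow> real set \<Rightarrow> real \<Rightarrow> real \<Rightarrow> ennreal" where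
  "jump_mass m Z a b = (\<integral>\<^sup>+p. ennreal \<bar>fst p\<bar> * indicator (Z \<times> {a<..b}) p \<partial>m)"

definition jump_sum :: "(real \<times> real) measure \<Rightarrow> real set \<Rightarrow> real \<Rightarrow> real \<Rightarrow> real" where
  "jump_sum m Z a b = (\<integral>p\<in>Z \<times> {a<..b}. fst p \<partial>m)"

definition first_moment :: "real set \<Rightarrow> ennreal" where
  "first_moment Z = (\<integral>\<^sup>+z. ennreal \<bar>z\<bar> * indicator Z z \<partial>\<nu>)"

definition second_moment :: "real set \<Rightarrow> ennreal" where
  "second_moment Z = (\<integral>\<^sup>+z. ennreal (z\<^sup>2) * indicator Z z \<partial>\<nu>)"

lemma moments_finite: "first_moment Z < \<infinity>" "second_moment Z < \<infinity>"
proof -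
  have "first_moment Z \<le> (\<integral>\<^sup>+z. ennreal \<bar>z\<bar> \<partial>\<nu>)" "second_moment Z \<le> (\<integral>\<^sup>+z. ennreal (z\<^sup>2) \<partial>\<nu>)"
    unfolding first_moment_def second_moment_def by (auto intro!: nn_integral_mono split: split_indicator)
  then show "first_moment Z < \<infinity>" "second_moment Z < \<infinity>"
    using abs_moment square_moment by (auto intro: le_less_trans)
qed

lemma abs_jump_sum_le: "ennreal \<bar>jump_sum m Z a b\<bar> \<le> jump_mass m Z a b"
proof (cases "set_integrable m (Z \<times> {a<..b}) fst")
  case True
  have "ennreal \<bar>jump_sum m Z a b\<bar> \<le> (\<integral>\<^sup>+p. ennreal (norm (indicator (Z \<times> {a<..b}) p *\<^sub>R fst p)) \<partial>m)"
    unfolding jump_sum_def set_lebesgue_integral_def real_norm_def[symmetric]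
    using True unfolding set_integrable_def by (rule integral_norm_bound_ennreal)
  also have "\<dots> = jump_mass m Z a b"
    unfolding jump_mass_def by (intro nn_integral_cong) (auto split: split_indicator)
  finally show ?thesis .
next
  case False
  then have "jump_sum m Z a b = 0"
    unfolding jump_sum_def set_lebesgue_integral_def set_integrable_def by (rule not_integrable_integral_eq)
  then show ?thesis by simp
qed

lemma jump_mass_mono: "Z \<subseteq> Z' \<Longrightarrow> a' \<le> a \<Longrightarrow> b \<le> b' \<Longrightarrow> jump_mass m Z a b \<le> jump_mass m Z' a' b'"
  unfolding jump_mass_def by (intro nn_integral_mono) (auto split: split_indicator)

lemma measurable_of_sets_J:
  assumes "sets m = sets J"
  shows "f \<in> borel_measurable J \<Longrightarrow> f \<in> borel_measurable m"
  using assms by (simp cong: measurable_cong_sets)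

lemma jump_integrable:
  assumes m: "sets m = sets J" and Z: "Z \<in> sets \<nu>" "0 \<le> a" and fin: "jump_mass m Z a b < \<infinity>"
  shows "set_integrable m (Z \<times> {a<..b}) fst"
  unfolding set_integrable_def
proof (rule integrableI_bounded)
  show "(\<lambda>p. indicator (Z \<times> {a<..b}) p *\<^sub>R fst p) \<in> borel_measurable m"
    using fst_measurable_J[of "\<lambda>x. x"] rectangle_in_J[OF Z, of b]
    by (intro measurable_of_sets_J[OF m]) simp
  have "(\<integral>\<^sup>+p. ennreal (norm (indicator (Z \<times> {a<..b}) p *\<^sub>R fst p)) \<partial>m) = jump_mass m Z a b"
    unfolding jump_mass_def by (intro nn_integral_cong) (auto split: split_indicator)
  then show "(\<integral>\<^sup>+p. ennreal (norm (indicator (Z \<times> {a<..b}) p *\<^sub>R fst p)) \<partial>m) < \<infinity>" using fin by simp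
qed

lemma jump_sum_Un:
  assumes m: "sets m = sets J" and Z: "Z1 \<in> sets \<nu>" "Z2 \<in> sets \<nu>" "Z1 \<inter> Z2 = {}" "0 \<le> a"
    and fin: "jump_mass m (Z1 \<union> Z2) a b < \<infinity>"
  shows "jump_sum m (Z1 \<union> Z2) a b = jump_sum m Z1 a b + jump_sum m Z2 a b"
proof -
  have "jump_mass m Z1 a b < \<infinity>" "jump_mass m Z2 a b < \<infinity>"
    using fin jump_mass_mono[of Z1 "Z1 \<union> Z2" a a b b m] jump_mass_mono[of Z2 "Z1 \<union> Z2" a a b b m]
    by (auto intro: le_less_trans)
  then show ?thesis
    unfolding jump_sum_def Sigma_Un_distrib1
    using Z by (intro set_integral_Un jump_integrable[OF m]) auto
qed

lemma jump_sum_time: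
  assumes m: "sets m = sets J" and Z: "Z \<in> sets \<nu>" and ab: "0 \<le> a" "a \<le> b" "b \<le> c"
    and fin: "jump_mass m Z a c < \<infinity>"
  shows "jump_sum m Z a c = jump_sum m Z a b + jump_sum m Z b c"
proof -
  have fin': "jump_mass m Z a b < \<infinity>" "jump_mass m Z b c < \<infinity>"
    using fin jump_mass_mono[of Z Z a a b c m] jump_mass_mono[of Z Z a b c c m] ab
    by (auto intro: le_less_trans)
  have "{a<..c} = {a<..b} \<union> {b<..c}" using ab by auto
  then have "Z \<times> {a<..c} = Z \<times> {a<..b} \<union> Z \<times> {b<..c}" by auto
  then show ?thesis
    unfolding jump_sum_def using Z ab fin' by (simp only:) (intro set_integral_Un jump_integrable[OF m]; auto)
qed

lemma jump_mass_J:
  assumes "Z \<in> sets \<nu>" "0 \<le> a" "a \<le> b"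
  shows "jump_mass J Z a b = first_moment Z * ennreal (b - a)"
  unfolding jump_mass_def first_moment_def
  using nn_integral_J[of "\<lambda>z. ennreal \<bar>z\<bar>", OF _ assms] by simp

lemma jump_sum_J:
  assumes Z: "Z \<in> sets \<nu>" and ab: "0 \<le> a" "a \<le> b"
  shows "jump_sum J Z a b = (\<integral>z\<in>Z. z \<partial>\<nu>) * (b - a)"
proof -
  let ?R = "restrict_space lborel {0::real..}"
  interpret pair_sigma_finite \<nu> ?R
    using sigma_finite_nu sigma_finite_time by (simp add: pair_sigma_finite_def)
  have "jump_mass J Z a b < \<infinity>"
    unfolding jump_mass_J[OF assms] using moments_finite[of Z] by (simp add: ennreal_mult_less_top)
  from jump_integrable[OF refl Z ab(1) this]
  have int: "integrable (\<nu> \<Otimes>\<^sub>M ?R) (\<lambda>p. indicator (Z \<times> {a<..b}) p * fst p)"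
    unfolding set_integrable_def J_def jump_intensity_def by simp
  have "jump_sum J Z a b = (\<integral>z. (\<integral>t. indicator (Z \<times> {a<..b}) (z, t) * z \<partial>?R) \<partial>\<nu>)"
    using integral_fst'[OF int] by (simp add: jump_sum_def set_lebesgue_integral_def J_def jump_intensity_def)
  also have "\<dots> = (\<integral>z. indicator Z z * z * (b - a) \<partial>\<nu>)"
  proof (rule Bochner_Integration.integral_cong[OF refl])
    fix z
    have "(\<integral>t. indicator (Z \<times> {a<..b}) (z, t) * z \<partial>?R) = (\<integral>t. (indicator Z z * z) * indicator {a<..b} t \<partial>?R)"
      by (rule Bochner_Integration.integral_cong) (auto split: split_indicator)
    also have "\<dots> = indicator Z z * z * measure ?R {a<..b}"
      using sets_time[OF ab(1), of b] by (simp add: space_restrict_space) (metis Int_absorb2 ab(1) atLeast_iff greaterThanAtMost_iff less_eq_real_def order_trans subsetI)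
    also have "measure ?R {a<..b} = b - a" using time_emeasure[OF ab] ab by (simp add: measure_def)
    finally show "(\<integral>t. indicator (Z \<times> {a<..b}) (z, t) * z \<partial>?R) = indicator Z z * z * (b - a)" .
  qed
  also have "\<dots> = (\<integral>z\<in>Z. z \<partial>\<nu>) * (b - a)"
    by (simp add: set_lebesgue_integral_def)
  finally show ?thesis .
qed

lemma measurable_jump_mass:
  assumes R: "random_measure_on Q J \<eta>" and Z: "Z \<in> sets \<nu>" "0 \<le> a"
  shows "(\<lambda>\<omega>. jump_mass (\<eta> \<omega>) Z a b) \<in> borel_measurable Q"
  unfolding jump_mass_def
  using fst_measurable_J[of "\<lambda>x. ennreal \<bar>x\<bar>"] rectangle_in_J[OF Z, of b]
  by (intro random_measure_measurable[OF R]) simp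

text \<open>The integral of a function against a random measure is a measurable expression in two nonnegative integrals.\<close>

lemma measurable_jump_sum:
  assumes R: "random_measure_on Q J \<eta>" and Z: "Z \<in> sets \<nu>" "0 \<le> a"
  shows "(\<lambda>\<omega>. jump_sum (\<eta> \<omega>) Z a b) \<in> borel_measurable Q"
proof -
  define P where "P s \<omega> = (\<integral>\<^sup>+p. ennreal (s * fst p) * indicator (Z \<times> {a<..b}) p \<partial>\<eta> \<omega>)" for s \<omega>
  have [measurable]: "P s \<in> borel_measurable Q" for s
    unfolding P_def using fst_measurable_J[of "\<lambda>x. ennreal (s * x)"] rectangle_in_J[OF Z, of b]
    by (intro random_measure_measurable[OF R]) simp
  note [measurable] = measurable_jump_mass[OF R Z, of b]
  have "jump_sum (\<eta> \<omega>) Z a b = (if jump_mass (\<eta> \<omega>) Z a b < \<infinity> then enn2real (P 1 \<omega>) - enn2real (P (-1) \<omega>) else 0)"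
    if \<omega>: "\<omega> \<in> space Q" for \<omega>
  proof (cases "jump_mass (\<eta> \<omega>) Z a b < \<infinity>")
    case True
    have P: "P s \<omega> = (\<integral>\<^sup>+p. ennreal (s * (indicator (Z \<times> {a<..b}) p * fst p)) \<partial>\<eta> \<omega>)" for s
      unfolding P_def by (intro nn_integral_cong) (auto split: split_indicator)
    show ?thesis
      using True real_lebesgue_integral_def[OF jump_integrable[OF random_measure_on_facts(1)[OF R \<omega>] Z True, unfolded set_integrable_def]]
      by (simp add: P jump_sum_def set_lebesgue_integral_def)
  next
    case False
    have "\<not> set_integrable (\<eta> \<omega>) (Z \<times> {a<..b}) fst"
    proof
      assume "set_integrable (\<eta> \<omega>) (Z \<times> {a<..b}) fst"
      then have "(\<integral>\<^sup>+p. ennreal (norm (indicator (Z \<times> {a<..b}) p *\<^sub>R fst p)) \<partial>\<eta> \<omega>) < \<infinity>"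
        unfolding set_integrable_def integrable_iff_bounded by blast
      also have "(\<integral>\<^sup>+p. ennreal (norm (indicator (Z \<times> {a<..b}) p *\<^sub>R fst p)) \<partial>\<eta> \<omega>) = jump_mass (\<eta> \<omega>) Z a b"
        unfolding jump_mass_def by (intro nn_integral_cong) (auto split: split_indicator)
      finally show False using False by simp
    qed
    then show ?thesis using False
      unfolding jump_sum_def set_lebesgue_integral_def set_integrable_def by (simp add: not_integrable_integral_eq)
  qed
  then show ?thesis by (simp cong: measurable_cong)
qed

lemma jump_mass_second_moment:
  assumes Q: "prob_space Q" and R: "random_measure_on Q J \<eta>" and C: "poisson_counts_on Q J \<eta> S"
    and Z: "Z \<in> sets \<nu>" and ab: "0 \<le> a" "a \<le> b" and S: "Z \<times> {a<..b} \<subseteq> S"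
  shows "(\<integral>\<^sup>+\<omega>. (jump_mass (\<eta> \<omega>) Z a b)\<^sup>2 \<partial>Q) \<le> (first_moment Z * ennreal (b - a))\<^sup>2 + second_moment Z * ennreal (b - a)"
proof -
  let ?Z = "Z \<times> {a<..b}" and ?f = "\<lambda>p::real \<times> real. ennreal \<bar>fst p\<bar> * indicator (Z \<times> {a<..b}) p"
  have C': "poisson_counts_on Q J \<eta> ?Z"
    using C S unfolding poisson_counts_on_def by (meson order_trans)
  have fm: "?f \<in> borel_measurable J"
    using fst_measurable_J[of "\<lambda>x. ennreal \<bar>x\<bar>"] rectangle_in_J[OF Z ab(1), of b] by simp
  have "(\<integral>\<^sup>+\<omega>. (jump_mass (\<eta> \<omega>) Z a b)\<^sup>2 \<partial>Q) \<le> (\<integral>\<^sup>+p. ?f p \<partial>J)\<^sup>2 + (\<integral>\<^sup>+p. (?f p)\<^sup>2 \<partial>J)"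
    unfolding jump_mass_def
    by (rule poisson_counts_second_moment[OF Q R C' sigma_finite_J rectangle_in_J[OF Z ab(1)] fm]) auto
  also have "(\<integral>\<^sup>+p. ?f p \<partial>J) = first_moment Z * ennreal (b - a)"
    using jump_mass_J[OF Z ab] by (simp add: jump_mass_def)
  also have "(\<integral>\<^sup>+p. (?f p)\<^sup>2 \<partial>J) = (\<integral>\<^sup>+p. ennreal ((fst p)\<^sup>2) * indicator (Z \<times> {a<..b}) p \<partial>J)"
    by (intro nn_integral_cong) (auto simp: ennreal_power split: split_indicator)
  also have "\<dots> = second_moment Z * ennreal (b - a)"
    unfolding second_moment_def using nn_integral_J[of "\<lambda>z. ennreal (z\<^sup>2)", OF _ Z ab] by simp
  finally show ?thesis .
qed

lemma AE_jump_mass_finite: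
  assumes Q: "prob_space Q" and R: "random_measure_on Q J \<eta>" and C: "poisson_counts_on Q J \<eta> (space J)" and b: "0 \<le> b"
  shows "AE \<omega> in Q. jump_mass (\<eta> \<omega>) (- {0}) 0 b < \<infinity>"
proof -
  have Z: "- {0} \<in> sets \<nu>" by (simp add: sets_nu_iff)
  have "(\<integral>\<^sup>+\<omega>. (jump_mass (\<eta> \<omega>) (- {0}) 0 b)\<^sup>2 \<partial>Q)
      \<le> (first_moment (- {0}) * ennreal (b - 0))\<^sup>2 + second_moment (- {0}) * ennreal (b - 0)"
    by (rule jump_mass_second_moment[OF Q R C Z]) (use b in \<open>auto simp: space_J\<close>)
  also have "\<dots> < \<infinity>"
    using moments_finite[of "- {0}"] by (simp add: ennreal_mult_less_top power2_eq_square)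
  finally have "(\<integral>\<^sup>+\<omega>. (jump_mass (\<eta> \<omega>) (- {0}) 0 b)\<^sup>2 \<partial>Q) \<noteq> \<infinity>" by simp
  moreover have "(\<lambda>\<omega>. (jump_mass (\<eta> \<omega>) (- {0}) 0 b)\<^sup>2) \<in> borel_measurable Q"
    by (intro borel_measurable_power_ennreal measurable_jump_mass[OF R Z]) simp
  ultimately have "AE \<omega> in Q. (jump_mass (\<eta> \<omega>) (- {0}) 0 b)\<^sup>2 \<noteq> \<infinity>" by (rule nn_integral_noteq_infinite[rotated])
  then show ?thesis
    by eventually_elim (auto simp: less_top power2_eq_square ennreal_mult_eq_top_iff)
qed

lemma moments_vanish:
  "(\<lambda>n. first_moment {z. z \<noteq> 0 \<and> \<bar>z\<bar> \<le> 1 / real (Suc n)}) \<longlonglongrightarrow> 0"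
  "(\<lambda>n. second_moment {z. z \<noteq> 0 \<and> \<bar>z\<bar> \<le> 1 / real (Suc n)}) \<longlonglongrightarrow> 0"
proof -
  have gen: "(\<lambda>n. \<integral>\<^sup>+z. f z * indicator {z. z \<noteq> 0 \<and> \<bar>z\<bar> \<le> 1 / real (Suc n)} z \<partial>\<nu>) \<longlonglongrightarrow> 0"
    if f: "f \<in> borel_measurable borel" and fin: "(\<integral>\<^sup>+z. f z \<partial>\<nu>) < \<infinity>" for f :: "real \<Rightarrow> ennreal"
  proof -
    note [measurable] = borel_measurable_nu[OF f]
    have Z: "{z. z \<noteq> 0 \<and> \<bar>z\<bar> \<le> 1 / real (Suc n)} \<in> sets \<nu>" for n
      by (simp add: sets_nu_iff)
    have "(\<lambda>n. \<integral>\<^sup>+z. f z * indicator {z. z \<noteq> 0 \<and> \<bar>z\<bar> \<le> 1 / real (Suc n)} z \<partial>\<nu>) \<longlonglongrightarrow> (\<integral>\<^sup>+z. 0 \<partial>\<nu>)"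
    proof (rule nn_integral_dominated_convergence[where w = f])
      show "(\<lambda>z. f z * indicator {z. z \<noteq> 0 \<and> \<bar>z\<bar> \<le> 1 / real (Suc n)} z) \<in> borel_measurable \<nu>" for n
        by (intro borel_measurable_times_ennreal borel_measurable_indicator Z borel_measurable_nu[OF f])
      show "AE z in \<nu>. (\<lambda>n. f z * indicator {z. z \<noteq> 0 \<and> \<bar>z\<bar> \<le> 1 / real (Suc n)} z) \<longlonglongrightarrow> 0"
      proof (rule AE_I2)
        fix z assume "z \<in> space \<nu>"
        then have "0 < \<bar>z\<bar>" by (simp add: space_nu)
        then obtain n0 where n0: "inverse (real (Suc n0)) < \<bar>z\<bar>" using reals_Archimedean by blast
        have "f z * indicator {z. z \<noteq> 0 \<and> \<bar>z\<bar> \<le> 1 / real (Suc n)} z = 0" if "n \<ge> n0" for n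
        proof -
          have "1 / real (Suc n) \<le> inverse (real (Suc n0))" using that by (simp add: field_simps)
          then show ?thesis using n0 by simp
        qed
        then show "(\<lambda>n. f z * indicator {z. z \<noteq> 0 \<and> \<bar>z\<bar> \<le> 1 / real (Suc n)} z) \<longlonglongrightarrow> 0"
          by (intro tendsto_eventually) (auto simp: eventually_sequentially)
      qed
    qed (use fin in \<open>auto split: split_indicator\<close>)
    then show ?thesis by simp
  qed
  show "(\<lambda>n. first_moment {z. z \<noteq> 0 \<and> \<bar>z\<bar> \<le> 1 / real (Suc n)}) \<longlonglongrightarrow> 0"
    unfolding first_moment_def by (rule gen) (use abs_moment in auto)
  show "(\<lambda>n. second_moment {z. z \<noteq> 0 \<and> \<bar>z\<bar> \<le> 1 / real (Suc n)}) \<longlonglongrightarrow> 0"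
    unfolding second_moment_def by (rule gen) (use square_moment in auto)
qed

subsection \<open>The driving paths\<close>

text \<open>The jumps above \<open>1\<close> are not compensated.\<close>

definition drift :: real where
  "drift = (\<integral>z\<in>{z. z \<noteq> 0 \<and> \<bar>z\<bar> \<le> 1}. z \<partial>\<nu>)"

definition levy_path :: "(real \<times> real) measure \<Rightarrow> real \<Rightarrow> real" where
  "levy_path m t = jump_sum m (- {0}) 0 t - drift * t"

lemma ennreal_square_add_le: "((a::ennreal) + b)\<^sup>2 \<le> 2 * a\<^sup>2 + 2 * b\<^sup>2"
proof (cases "a = \<top> \<or> b = \<top>")
  case False
  then obtain x y where xy: "a = ennreal x" "0 \<le> x" "b = ennreal y" "0 \<le> y"
    by (metis ennreal_cases)
  have "(x + y)\<^sup>2 \<le> 2 * x\<^sup>2 + 2 * y\<^sup>2"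
    using zero_le_power2[of "x - y"] by (simp add: power2_eq_square algebra_simps)
  then have "ennreal ((x + y)\<^sup>2) \<le> ennreal (2 * x\<^sup>2 + 2 * y\<^sup>2)" by (rule ennreal_leI)
  also have "\<dots> = 2 * (ennreal x)\<^sup>2 + 2 * (ennreal y)\<^sup>2" using xy by (simp add: ennreal_mult ennreal_power)
  also have "ennreal ((x + y)\<^sup>2) = (ennreal x + ennreal y)\<^sup>2"
    using xy by (simp add: ennreal_power flip: ennreal_plus)
  finally show ?thesis using xy by simp
qed (auto simp: power2_eq_square ennreal_mult_top ennreal_top_mult)

lemma ennreal_square_of_abs_le:
  assumes "ennreal \<bar>x\<bar> \<le> a"
  shows "ennreal (x\<^sup>2) \<le> a\<^sup>2"
proof -
  have "ennreal (x\<^sup>2) = (ennreal \<bar>x\<bar>)\<^sup>2" by (simp add: ennreal_power)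
  also have "\<dots> \<le> a\<^sup>2" using assms by (rule power_mono) simp
  finally show ?thesis .
qed

text \<open>As the jumps are summable, the compensated integral is the sum of the jumps minus the drift. The
  truncated integrals differ from this by the jumps below \<open>\<epsilon>\<close> and their mean, which vanish in mean
  square, and a mean square limit is unique.\<close>

lemma small_jump_integral_eq:
  assumes Q: "prob_space M" and R: "random_measure_on M J \<eta>" and C: "poisson_counts_on M J \<eta> (space J)"
    and t: "0 \<le> t" and X: "is_small_jump_integral M \<nu> \<eta> t X"
  shows "AE \<omega> in M. X \<omega> = jump_sum (\<eta> \<omega>) {z. z \<noteq> 0 \<and> \<bar>z\<bar> \<le> 1} 0 t - drift * t"
proof -
  interpret prob_space M by fact
  define Zs where "Zs n = {z::real. z \<noteq> 0 \<and> \<bar>z\<bar> \<le> 1 / real (Suc n)}" for n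
  define Zl where "Zl n = {z::real. 1 / real (Suc n) < \<bar>z\<bar> \<and> \<bar>z\<bar> \<le> 1}" for n
  define Z where "Z = {z::real. z \<noteq> 0 \<and> \<bar>z\<bar> \<le> 1}"
  have Zsets: "Zs n \<in> sets \<nu>" "Zl n \<in> sets \<nu>" "Z \<in> sets \<nu>" for n
    by (auto simp: sets_nu_iff Zs_def Zl_def Z_def)
  have ZU: "Z = Zs n \<union> Zl n" "Zs n \<inter> Zl n = {}" for n
  proof -
    have "{z. z \<noteq> 0 \<and> \<bar>z\<bar> \<le> 1} = {z. z \<noteq> 0 \<and> \<bar>z\<bar> \<le> i} \<union> {z. i < \<bar>z\<bar> \<and> \<bar>z\<bar> \<le> 1}"
      "{z. z \<noteq> 0 \<and> \<bar>z\<bar> \<le> i} \<inter> {z. i < \<bar>z\<bar> \<and> \<bar>z\<bar> \<le> 1} = {}" if "0 < i" "i \<le> 1" for i :: real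
      using that by auto
    from this[of "1 / real (Suc n)"] show "Z = Zs n \<union> Zl n" "Zs n \<inter> Zl n = {}"
      unfolding Z_def Zs_def Zl_def by simp_all
  qed
  define XX where "XX \<omega> = jump_sum (\<eta> \<omega>) Z 0 t - drift * t" for \<omega>
  define \<epsilon> where "\<epsilon> n = 1 / real (Suc n)" for n
  have Xm[measurable]: "X \<in> borel_measurable M" using X by (simp add: is_small_jump_integral_def)
  have eps: "filterlim \<epsilon> (at_right 0) sequentially"
    unfolding filterlim_at \<epsilon>_def using LIMSEQ_inverse_real_of_nat by (auto simp: inverse_eq_divide)
  define a where "a n = (\<integral>\<^sup>+\<omega>. ennreal ((truncated_small_jumps \<nu> (\<eta> \<omega>) t (\<epsilon> n) - X \<omega>)\<^sup>2) \<partial>M)" for n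
  have a: "a \<longlonglongrightarrow> 0"
    using X filterlim_compose[OF _ eps] unfolding is_small_jump_integral_def a_def by blast
  have trunc: "truncated_small_jumps \<nu> m t (\<epsilon> n) = jump_sum m (Zl n) 0 t - jump_sum J (Zl n) 0 t" for m n
    by (simp add: truncated_small_jumps_def jump_sum_def Zl_def \<epsilon>_def J_def)
  note [measurable] = measurable_jump_sum[OF R Zsets(2)] measurable_jump_sum[OF R Zsets(3)] measurable_jump_mass[OF R Zsets(1)]
  have [measurable]: "(\<lambda>\<omega>. truncated_small_jumps \<nu> (\<eta> \<omega>) t (\<epsilon> n)) \<in> borel_measurable M" for n
    unfolding trunc by measurable
  have [measurable]: "XX \<in> borel_measurable M" unfolding XX_def by measurable
  define r where "r n = first_moment (Zs n) * ennreal t" for n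
  have diff: "AE \<omega> in M. \<forall>n. ennreal \<bar>truncated_small_jumps \<nu> (\<eta> \<omega>) t (\<epsilon> n) - XX \<omega>\<bar> \<le> jump_mass (\<eta> \<omega>) (Zs n) 0 t + r n"
    using AE_jump_mass_finite[OF Q R C t] AE_space
  proof (eventually_elim, intro allI)
    fix \<omega> n assume fin: "jump_mass (\<eta> \<omega>) (- {0}) 0 t < \<infinity>" and \<omega>: "\<omega> \<in> space M"
    have m: "sets (\<eta> \<omega>) = sets J" by (rule random_measure_on_facts(1)[OF R \<omega>])
    have fin': "jump_mass (\<eta> \<omega>) (Zs n \<union> Zl n) 0 t < \<infinity>"
      by (rule le_less_trans[OF jump_mass_mono fin]) (auto simp: Zs_def Zl_def)
    have finJ: "jump_mass J (Zs n \<union> Zl n) 0 t < \<infinity>"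
      using jump_mass_J[of "Zs n \<union> Zl n" 0 t] Zsets t moments_finite[of "Zs n \<union> Zl n"] by (simp add: ennreal_mult_less_top)
    have "XX \<omega> = jump_sum (\<eta> \<omega>) Z 0 t - jump_sum J Z 0 t"
      using jump_sum_J[OF Zsets(3) order_refl t] by (simp add: XX_def drift_def Z_def)
    also have "\<dots> = (jump_sum (\<eta> \<omega>) (Zs n) 0 t + jump_sum (\<eta> \<omega>) (Zl n) 0 t) - (jump_sum J (Zs n) 0 t + jump_sum J (Zl n) 0 t)"
      unfolding ZU(1)[of n] using jump_sum_Un[OF m Zsets(1,2) ZU(2) order_refl fin'] jump_sum_Un[OF refl Zsets(1,2) ZU(2) order_refl finJ]
      by simp
    finally have "\<bar>truncated_small_jumps \<nu> (\<eta> \<omega>) t (\<epsilon> n) - XX \<omega>\<bar> \<le> \<bar>jump_sum (\<eta> \<omega>) (Zs n) 0 t\<bar> + \<bar>jump_sum J (Zs n) 0 t\<bar>"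
      unfolding trunc by linarith
    then have "ennreal \<bar>truncated_small_jumps \<nu> (\<eta> \<omega>) t (\<epsilon> n) - XX \<omega>\<bar> \<le> ennreal \<bar>jump_sum (\<eta> \<omega>) (Zs n) 0 t\<bar> + ennreal \<bar>jump_sum J (Zs n) 0 t\<bar>"
      by (simp add: ennreal_leI flip: ennreal_plus)
    also have "\<dots> \<le> jump_mass (\<eta> \<omega>) (Zs n) 0 t + r n"
      using abs_jump_sum_le[of J "Zs n" 0 t] jump_mass_J[OF Zsets(1) order_refl t, of n]
      by (intro add_mono abs_jump_sum_le) (simp add: r_def)
    finally show "ennreal \<bar>truncated_small_jumps \<nu> (\<eta> \<omega>) t (\<epsilon> n) - XX \<omega>\<bar> \<le> jump_mass (\<eta> \<omega>) (Zs n) 0 t + r n" .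
  qed
  define b where "b n = 2 * ((r n)\<^sup>2 + second_moment (Zs n) * ennreal t) + 2 * (r n)\<^sup>2" for n
  (* Compare both X and XX with the integral truncated at 1 / (n + 1). *)
  have bound: "(\<integral>\<^sup>+\<omega>. ennreal ((X \<omega> - XX \<omega>)\<^sup>2) \<partial>M) \<le> 2 * a n + 2 * b n" for n
  proof -
    have "(\<integral>\<^sup>+\<omega>. ennreal ((X \<omega> - XX \<omega>)\<^sup>2) \<partial>M)
        \<le> (\<integral>\<^sup>+\<omega>. 2 * ennreal ((truncated_small_jumps \<nu> (\<eta> \<omega>) t (\<epsilon> n) - X \<omega>)\<^sup>2)
              + 2 * (2 * (jump_mass (\<eta> \<omega>) (Zs n) 0 t)\<^sup>2 + 2 * (r n)\<^sup>2) \<partial>M)"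
    proof (rule nn_integral_mono_AE, use diff in eventually_elim)
      case (elim \<omega>)
      let ?T = "truncated_small_jumps \<nu> (\<eta> \<omega>) t (\<epsilon> n)"
      have "(X \<omega> - XX \<omega>)\<^sup>2 \<le> 2 * (?T - X \<omega>)\<^sup>2 + 2 * (?T - XX \<omega>)\<^sup>2"
        using zero_le_power2[of "2 * ?T - X \<omega> - XX \<omega>"] by (simp add: power2_eq_square algebra_simps)
      then have "ennreal ((X \<omega> - XX \<omega>)\<^sup>2) \<le> ennreal (2 * (?T - X \<omega>)\<^sup>2 + 2 * (?T - XX \<omega>)\<^sup>2)" by (rule ennreal_leI)
      also have "\<dots> = 2 * ennreal ((?T - X \<omega>)\<^sup>2) + 2 * ennreal ((?T - XX \<omega>)\<^sup>2)" by (simp add: ennreal_mult)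
      also have "ennreal ((?T - XX \<omega>)\<^sup>2) \<le> (jump_mass (\<eta> \<omega>) (Zs n) 0 t + r n)\<^sup>2"
        using elim by (intro ennreal_square_of_abs_le) blast
      also have "\<dots> \<le> 2 * (jump_mass (\<eta> \<omega>) (Zs n) 0 t)\<^sup>2 + 2 * (r n)\<^sup>2" by (rule ennreal_square_add_le)
      finally show ?case by (simp add: add_mono mult_mono)
    qed
    also have "\<dots> = 2 * a n + 2 * (2 * (\<integral>\<^sup>+\<omega>. (jump_mass (\<eta> \<omega>) (Zs n) 0 t)\<^sup>2 \<partial>M) + 2 * (r n)\<^sup>2)"
      unfolding a_def by (simp add: nn_integral_add nn_integral_cmult emeasure_space_1)
    also have "\<dots> \<le> 2 * a n + 2 * b n"
    proof -
      have "(\<integral>\<^sup>+\<omega>. (jump_mass (\<eta> \<omega>) (Zs n) 0 t)\<^sup>2 \<partial>M) \<le> (first_moment (Zs n) * ennreal (t - 0))\<^sup>2 + second_moment (Zs n) * ennreal (t - 0)"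
        by (rule jump_mass_second_moment[OF Q R C Zsets(1) order_refl t]) (auto simp: space_J Zs_def)
      then show ?thesis unfolding b_def r_def by (intro add_mono mult_left_mono order_refl) auto
    qed
    finally show ?thesis .
  qed
  have "(\<lambda>n. 2 * a n + 2 * b n) \<longlonglongrightarrow> 2 * 0 + 2 * (2 * ((0 * ennreal t)\<^sup>2 + 0 * ennreal t) + 2 * (0 * ennreal t)\<^sup>2)"
    unfolding b_def r_def Zs_def power2_eq_square
    by (intro tendsto_add tendsto_mult_ennreal a moments_vanish tendsto_const) (auto simp: ennreal_mult_eq_top_iff)
  then have "(\<integral>\<^sup>+\<omega>. ennreal ((X \<omega> - XX \<omega>)\<^sup>2) \<partial>M) \<le> 0"
    using bound by (intro LIMSEQ_le_const[of "\<lambda>n. 2 * a n + 2 * b n"]) auto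
  then have "AE \<omega> in M. ennreal ((X \<omega> - XX \<omega>)\<^sup>2) = 0"
    by (subst nn_integral_0_iff_AE[symmetric]) auto
  then show ?thesis by eventually_elim (simp add: XX_def Z_def)
qed

lemma noise_coordinates:
  assumes Q: "prob_space M" and R: "\<And>k. random_measure_on M J (\<eta> k)"
    and C: "\<And>k. poisson_counts_on M J (\<eta> k) (space J)"
    and e: "orthonormal_basis e" and L: "is_noise M \<nu> \<eta> \<beta> e L" and t: "0 \<le> t"
  shows "AE \<omega> in M. L t \<omega> \<bullet> e j = \<beta> j * levy_path (\<eta> j \<omega>) t"
proof -
  obtain X where X: "\<And>k. is_small_jump_integral M \<nu> (\<eta> k) t (X k)"
    and s: "AE \<omega> in M. (\<lambda>k. (\<beta> k * (X k \<omega> + large_jump_integral (\<eta> k \<omega>) t)) *\<^sub>R e k) sums L t \<omega>"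
    using L t unfolding is_noise_def by blast
  show ?thesis
    using s small_jump_integral_eq[OF Q R C t X, of j] AE_jump_mass_finite[OF Q R C t, of j] AE_space
  proof eventually_elim
    case (elim \<omega>)
    have m: "sets (\<eta> j \<omega>) = sets J" by (rule random_measure_on_facts(1)[OF R elim(4)])
    have U: "{z. z \<noteq> 0 \<and> \<bar>z\<bar> \<le> 1} \<union> {z. 1 < \<bar>z\<bar>} = - {0::real}" by auto
    have "jump_sum (\<eta> j \<omega>) (- {0}) 0 t
        = jump_sum (\<eta> j \<omega>) {z. z \<noteq> 0 \<and> \<bar>z\<bar> \<le> 1} 0 t + jump_sum (\<eta> j \<omega>) {z. 1 < \<bar>z\<bar>} 0 t"
      by (subst U[symmetric], rule jump_sum_Un[OF m])
        (use elim(3) in \<open>simp_all only: U\<close>, auto simp: sets_nu_iff)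
    then show ?case
      using orthonormal_series_inner[OF e elim(1), of j] elim(2)
      by (simp add: levy_path_def large_jump_integral_def jump_sum_def)
  qed
qed

lemma levy_path_increment_moment:
  assumes Q: "prob_space Q" and R: "random_measure_on Q J \<eta>" and C: "poisson_counts_on Q J \<eta> (space J)"
    and st: "0 \<le> s" "s \<le> t" "t \<le> T"
  shows "(\<integral>\<^sup>+\<omega>. ennreal ((levy_path (\<eta> \<omega>) t - levy_path (\<eta> \<omega>) s)\<^sup>2) \<partial>Q)
    \<le> ennreal ((2 * (enn2real (first_moment (- {0})))\<^sup>2 * T + 2 * enn2real (second_moment (- {0})) + 2 * drift\<^sup>2 * T) * (t - s))"
proof -
  interpret prob_space Q by fact
  define f1 f2 where "f1 = enn2real (first_moment (- {0}))" and "f2 = enn2real (second_moment (- {0}))"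
  have f: "first_moment (- {0}) = ennreal f1" "second_moment (- {0}) = ennreal f2" "0 \<le> f1" "0 \<le> f2"
    using moments_finite[of "- {0}"] by (auto simp: f1_def f2_def)
  have Z: "- {0} \<in> sets \<nu>" by (simp add: sets_nu_iff)
  have t0: "0 \<le> t" using st by simp
  note [measurable] = measurable_jump_mass[OF R Z st(1), of t]
  have "(\<integral>\<^sup>+\<omega>. ennreal ((levy_path (\<eta> \<omega>) t - levy_path (\<eta> \<omega>) s)\<^sup>2) \<partial>Q)
      \<le> (\<integral>\<^sup>+\<omega>. 2 * (jump_mass (\<eta> \<omega>) (- {0}) s t)\<^sup>2 + 2 * (ennreal (\<bar>drift\<bar> * (t - s)))\<^sup>2 \<partial>Q)"
  proof (rule nn_integral_mono_AE, use AE_jump_mass_finite[OF Q R C t0] AE_space in eventually_elim)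
    case (elim \<omega>)
    have "levy_path (\<eta> \<omega>) t - levy_path (\<eta> \<omega>) s = jump_sum (\<eta> \<omega>) (- {0}) s t - drift * (t - s)"
      using jump_sum_time[OF random_measure_on_facts(1)[OF R elim(2)] Z order_refl st(1,2) elim(1)]
      by (simp add: levy_path_def algebra_simps)
    then have "\<bar>levy_path (\<eta> \<omega>) t - levy_path (\<eta> \<omega>) s\<bar> \<le> \<bar>jump_sum (\<eta> \<omega>) (- {0}) s t\<bar> + \<bar>drift\<bar> * (t - s)"
      using abs_triangle_ineq4[of "jump_sum (\<eta> \<omega>) (- {0}) s t" "drift * (t - s)"] st by (simp add: abs_mult)
    then have "ennreal \<bar>levy_path (\<eta> \<omega>) t - levy_path (\<eta> \<omega>) s\<bar> \<le> ennreal \<bar>jump_sum (\<eta> \<omega>) (- {0}) s t\<bar> + ennreal (\<bar>drift\<bar> * (t - s))"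
      using st by (simp add: ennreal_leI flip: ennreal_plus)
    also have "\<dots> \<le> jump_mass (\<eta> \<omega>) (- {0}) s t + ennreal (\<bar>drift\<bar> * (t - s))"
      by (intro add_mono abs_jump_sum_le order_refl)
    finally show ?case
      by (intro order_trans[OF ennreal_square_of_abs_le ennreal_square_add_le])
  qed
  also have "\<dots> = 2 * (\<integral>\<^sup>+\<omega>. (jump_mass (\<eta> \<omega>) (- {0}) s t)\<^sup>2 \<partial>Q) + 2 * (ennreal (\<bar>drift\<bar> * (t - s)))\<^sup>2"
    by (simp add: nn_integral_add nn_integral_cmult emeasure_space_1)
  also have "(\<integral>\<^sup>+\<omega>. (jump_mass (\<eta> \<omega>) (- {0}) s t)\<^sup>2 \<partial>Q) \<le> (first_moment (- {0}) * ennreal (t - s))\<^sup>2 + second_moment (- {0}) * ennreal (t - s)"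
    by (rule jump_mass_second_moment[OF Q R C Z st(1,2)]) (use st in \<open>auto simp: space_J\<close>)
  also have "\<dots> = ennreal ((f1 * (t - s))\<^sup>2 + f2 * (t - s))"
    using f st by (simp add: ennreal_power flip: ennreal_mult ennreal_plus)
  also have "2 * ennreal ((f1 * (t - s))\<^sup>2 + f2 * (t - s)) + 2 * (ennreal (\<bar>drift\<bar> * (t - s)))\<^sup>2
      = ennreal (2 * ((f1 * (t - s))\<^sup>2 + f2 * (t - s)) + 2 * (\<bar>drift\<bar> * (t - s))\<^sup>2)"
  proof -
    have "2 * ennreal x + 2 * (ennreal y)\<^sup>2 = ennreal (2 * x + 2 * y\<^sup>2)" if "0 \<le> x" "0 \<le> y" for x y
      using that by (simp add: ennreal_mult ennreal_power)
    from this[of "(f1 * (t - s))\<^sup>2 + f2 * (t - s)" "\<bar>drift\<bar> * (t - s)"] show ?thesis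
      using f(3,4) st(2) by (simp only: zero_le_power2 add_nonneg_nonneg mult_nonneg_nonneg abs_ge_zero diff_ge_0_iff_ge)
  qed
  also have "\<dots> \<le> ennreal ((2 * f1\<^sup>2 * T + 2 * f2 + 2 * drift\<^sup>2 * T) * (t - s))"
  proof (rule ennreal_leI)
    have le: "(t - s)\<^sup>2 \<le> T * (t - s)" unfolding power2_eq_square using st by (intro mult_right_mono) auto
    have eq: "(2 * f1\<^sup>2 * T + 2 * f2 + 2 * drift\<^sup>2 * T) * (t - s)
        = 2 * (f1\<^sup>2 * (T * (t - s)) + f2 * (t - s)) + 2 * (drift\<^sup>2 * (T * (t - s)))"
      by (simp add: algebra_simps)
    show "2 * ((f1 * (t - s))\<^sup>2 + f2 * (t - s)) + 2 * (\<bar>drift\<bar> * (t - s))\<^sup>2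
        \<le> (2 * f1\<^sup>2 * T + 2 * f2 + 2 * drift\<^sup>2 * T) * (t - s)"
      unfolding power_mult_distrib power2_abs eq by (intro add_mono mult_left_mono le order_refl) (use f in simp_all)
  qed
  finally show ?thesis by (simp add: f1_def f2_def add_mono mult_mono)
qed

end

section \<open>Small deviations of the noise\<close>

lemma poisson_counts_unconditioned:
  assumes M: "prob_space M" and P: "poisson_random_measure M \<mu> \<eta>"
  shows "poisson_counts_on M \<mu> \<eta> (space \<mu>)"
  unfolding poisson_counts_on_def
proof (intro ballI impI allI)
  interpret prob_space M by fact
  fix B1 B2 a b assume B: "B1 \<in> sets \<mu>" "B2 \<in> sets \<mu>" "emeasure \<mu> B1 < \<infinity>" "emeasure \<mu> B2 < \<infinity>" "B1 \<inter> B2 = {}"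
  let ?H = "{\<omega>\<in>space M. emeasure (\<eta> \<omega>) B1 = of_nat a \<and> emeasure (\<eta> \<omega>) B2 = of_nat b}"
  have "measure M (count_event M \<eta> (\<lambda>_. {}) (\<lambda>_. 0) 0 \<inter> ?H)
      = measure M (count_event M \<eta> (\<lambda>_. {}) (\<lambda>_. 0) 0) * (poisson_weight (measure \<mu> B1) a * poisson_weight (measure \<mu> B2) b)"
    by (rule count_event_insert_pair[OF M P _ _ _ B]) (auto simp: disjoint_family_on_def)
  moreover have "count_event M \<eta> (\<lambda>_. {}) (\<lambda>_. 0) 0 \<inter> ?H = ?H" "count_event M \<eta> (\<lambda>_. {}) (\<lambda>_. 0) 0 = space M"
    by (auto simp: count_event_def)
  ultimately show "emeasure M ?H = ennreal (poisson_weight (measure \<mu> B1) a * poisson_weight (measure \<mu> B2) b)"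
    by (simp add: emeasure_eq_measure prob_space)
qed

context jump_law
begin

lemma emeasure_away_from_zero:
  assumes \<epsilon>: "0 < \<epsilon>" and Z: "Z \<in> sets \<nu>" "\<And>z. z \<in> Z \<Longrightarrow> \<epsilon> < \<bar>z\<bar>"
  shows "emeasure \<nu> Z < \<infinity>"
proof -
  have "ennreal \<epsilon> * emeasure \<nu> Z = (\<integral>\<^sup>+z. ennreal \<epsilon> * indicator Z z \<partial>\<nu>)"
    using Z by (simp add: nn_integral_cmult_indicator)
  also have "\<dots> \<le> first_moment Z"
    unfolding first_moment_def using Z(2)
    by (intro nn_integral_mono) (auto split: split_indicator intro!: ennreal_leI less_imp_le)
  also have "\<dots> < \<infinity>" by (rule moments_finite)
  finally show ?thesis using \<epsilon> by (auto simp: ennreal_mult_less_top less_top[symmetric] ennreal_mult_eq_top_iff)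
qed

lemma jump_mass_null:
  assumes "Z \<times> {a<..b} \<in> sets m" "emeasure m (Z \<times> {a<..b}) = 0"
  shows "jump_mass m Z a b = 0"
proof -
  have "Z \<times> {a<..b} \<in> null_sets m" using assms by auto
  then have "AE p in m. p \<notin> Z \<times> {a<..b}" by (rule AE_not_in)
  then have "jump_mass m Z a b = (\<integral>\<^sup>+p. 0 \<partial>m)"
    unfolding jump_mass_def
    by (intro nn_integral_cong_AE) (auto simp: indicator_def elim!: eventually_mono)
  then show ?thesis by simp
qed

text \<open>The sum of the jumps is their number times \<open>x\<close>, up to \<open>r\<close> per jump.\<close>

lemma jump_sum_near_level:
  assumes m: "sets m = sets J" and Z: "Z \<in> sets \<nu>" and near: "\<And>z. z \<in> Z \<Longrightarrow> \<bar>z - x\<bar> \<le> r"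
    and fin: "emeasure m (Z \<times> {0<..t}) < \<infinity>" "jump_mass m Z 0 t < \<infinity>"
  shows "\<bar>jump_sum m Z 0 t - x * measure m (Z \<times> {0<..t})\<bar> \<le> r * measure m (Z \<times> {0<..t})"
proof -
  let ?A = "Z \<times> {0<..t}"
  have A: "?A \<in> sets m" using rectangle_in_J[OF Z order_refl] m by simp
  have iz: "integrable m (\<lambda>p. indicator ?A p * fst p)"
    using jump_integrable[OF m Z order_refl fin(2)] by (simp add: set_integrable_def)
  have ic: "integrable m (\<lambda>p. indicator ?A p * k)" for k :: real
    using A fin(1) by (intro integrable_mult_left integrable_real_indicator)
  have I: "(\<integral>p. indicator ?A p * k \<partial>m) = k * measure m ?A" for k :: real
    using A sets.sets_into_space[OF A] by (simp add: Int_absorb2)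
  have "jump_sum m Z 0 t - x * measure m ?A = (\<integral>p. indicator ?A p * fst p - indicator ?A p * x \<partial>m)"
    unfolding Bochner_Integration.integral_diff[OF iz ic] I jump_sum_def set_lebesgue_integral_def by simp
  also have "\<bar>\<dots>\<bar> \<le> (\<integral>p. \<bar>indicator ?A p * fst p - indicator ?A p * x\<bar> \<partial>m)"
    by (rule integral_abs_bound)
  also have "\<dots> \<le> (\<integral>p. indicator ?A p * r \<partial>m)"
    using iz ic near by (intro integral_mono integrable_abs Bochner_Integration.integrable_diff) (auto split: split_indicator)
  finally show ?thesis unfolding I .
qed

text \<open>At time \<open>t\<close> there have been \<open>t / \<tau>\<close> jumps from \<open>S\<close> up to an error of \<open>1\<close>, each of size \<open>drift * \<tau>\<close> up to \<open>r\<close>.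
  Their sum therefore follows \<open>drift * t\<close> up to \<open>\<bar>drift\<bar> * \<tau> + r * n\<close>. Without drift, no large jump is
  allowed at all.\<close>

lemma quiet_path:
  assumes m: "sets m = sets J" and \<epsilon>: "0 < \<epsilon>" and \<tau>: "0 < \<tau>" and r: "0 \<le> r"
    and S: "S = {z. \<epsilon> < \<bar>z\<bar> \<and> \<bar>z - drift * \<tau>\<bar> \<le> r}" and R: "R = {z. \<epsilon> < \<bar>z\<bar> \<and> r < \<bar>z - drift * \<tau>\<bar>}"
    and k: "k = (if drift = 0 then 0 else 1 :: nat)"
    and count: "\<And>i. i < n \<Longrightarrow> emeasure m (S \<times> {real i * \<tau><..real (Suc i) * \<tau>}) = of_nat k"
    and none: "emeasure m (R \<times> {0<..real n * \<tau>}) = 0"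
    and t: "0 \<le> t" "t + \<tau> \<le> real n * \<tau>" and fin: "jump_mass m (- {0}) 0 t < \<infinity>"
  shows "ennreal \<bar>levy_path m t\<bar> \<le> jump_mass m {z. z \<noteq> 0 \<and> \<bar>z\<bar> \<le> \<epsilon>} 0 t + ennreal (\<bar>drift\<bar> * \<tau> + r * real n)"
proof -
  define Z0 where "Z0 = {z. z \<noteq> 0 \<and> \<bar>z\<bar> \<le> \<epsilon>}"
  have sets: "Z0 \<in> sets \<nu>" "S \<in> sets \<nu>" "R \<in> sets \<nu>" "S \<union> R \<in> sets \<nu>"
    using \<epsilon> by (auto simp: sets_nu_iff Z0_def S R)
  have rect: "Z \<times> {a<..b} \<in> sets m" if "Z \<in> sets \<nu>" "0 \<le> a" for Z a b
    using rectangle_in_J[OF that] m by simp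
  have U: "- {0} = Z0 \<union> (S \<union> R)" "Z0 \<inter> (S \<union> R) = {}" "S \<inter> R = {}"
    using \<epsilon> by (auto simp: Z0_def S R)
  have fin': "jump_mass m (Z0 \<union> (S \<union> R)) 0 t < \<infinity>" using fin U(1) by simp
  have finSR: "jump_mass m (S \<union> R) 0 t < \<infinity>" "jump_mass m S 0 t < \<infinity>"
    by (rule le_less_trans[OF jump_mass_mono fin']; auto)+
  have sum: "jump_sum m (- {0}) 0 t = jump_sum m Z0 0 t + (jump_sum m S 0 t + jump_sum m R 0 t)"
    unfolding U(1) using jump_sum_Un[OF m sets(1,4) U(2) order_refl fin'] jump_sum_Un[OF m sets(2,3) U(3) order_refl finSR(1)]
    by simp
  have tn: "t \<le> real n * \<tau>" using t \<tau> by simp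
  have R0: "jump_sum m R 0 t = 0"
  proof -
    have "emeasure m (R \<times> {0<..t}) \<le> emeasure m (R \<times> {0<..real n * \<tau>})"
      using tn by (intro emeasure_mono rect sets) auto
    then have "jump_mass m R 0 t = 0"
      using none by (intro jump_mass_null rect sets) auto
    then show ?thesis using abs_jump_sum_le[of m R 0 t] by simp
  qed
  have cum: "emeasure m (S \<times> {0<..real i * \<tau>}) = of_nat (i * k)" if "i \<le> n" for i
    using that
  proof (induction i)
    case (Suc i)
    have "S \<times> {0<..real (Suc i) * \<tau>} = S \<times> {0<..real i * \<tau>} \<union> S \<times> {real i * \<tau><..real (Suc i) * \<tau>}"
    proof -
      have "{0<..real (Suc i) * \<tau>} = {0<..real i * \<tau>} \<union> {real i * \<tau><..real (Suc i) * \<tau>}"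
      proof -
        have "0 \<le> real i * \<tau>" "real i * \<tau> \<le> real (Suc i) * \<tau>" using \<tau> by (auto intro: mult_right_mono)
        then show ?thesis by (auto simp del: of_nat_Suc)
      qed
      then show ?thesis by blast
    qed
    also have "emeasure m \<dots> = emeasure m (S \<times> {0<..real i * \<tau>}) + emeasure m (S \<times> {real i * \<tau><..real (Suc i) * \<tau>})"
      using \<tau> by (intro plus_emeasure[symmetric] rect sets) auto
    also have "\<dots> = of_nat (i * k) + of_nat k" using Suc count[of i] by simp
    finally show ?case by (simp add: add.commute)
  qed simp
  (* t lies in the step from i \<tau> to (i + 1) \<tau>. *)
  define i where "i = nat \<lfloor>t / \<tau>\<rfloor>"
  have "0 \<le> \<lfloor>t / \<tau>\<rfloor>" using t \<tau> by simp
  then have ri: "real i = of_int \<lfloor>t / \<tau>\<rfloor>" by (simp add: i_def)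
  then have "real i \<le> t / \<tau>" "t / \<tau> < real i + 1" by linarith+
  then have it: "real i * \<tau> \<le> t" "t \<le> real (Suc i) * \<tau>"
    using \<tau> by (auto simp: field_simps)
  have "real (Suc i) * \<tau> \<le> real n * \<tau>" using it t by (simp add: algebra_simps)
  then have i_n: "Suc i \<le> n" using \<tau> by simp
  let ?\<kappa> = "measure m (S \<times> {0<..t})"
  have up: "emeasure m (S \<times> {0<..t}) \<le> of_nat (Suc i * k)"
    unfolding cum[OF i_n, symmetric] using it by (intro emeasure_mono rect sets) auto
  have lo: "of_nat (i * k) \<le> emeasure m (S \<times> {0<..t})"
    unfolding cum[OF Suc_leD[OF i_n], symmetric] using it by (intro emeasure_mono rect sets) auto
  have Sfin: "emeasure m (S \<times> {0<..t}) < \<infinity>" using up by (rule le_less_trans) (simp add: ennreal_of_nat_eq_real_of_nat)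
  have em: "emeasure m (S \<times> {0<..t}) = ennreal ?\<kappa>" using Sfin by (simp add: emeasure_eq_ennreal_measure less_top)
  have \<kappa>: "real (i * k) \<le> ?\<kappa>" "?\<kappa> \<le> real (Suc i * k)"
    using up lo unfolding em ennreal_of_nat_eq_real_of_nat
    by (simp_all only: ennreal_le_iff of_nat_0_le_iff measure_nonneg)
  have \<kappa>n: "?\<kappa> \<le> real n"
    by (rule order_trans[OF \<kappa>(2)]) (use i_n in \<open>simp add: k\<close>)
  have "\<bar>drift * \<tau> * ?\<kappa> - drift * t\<bar> \<le> \<bar>drift\<bar> * \<tau>"
  proof (cases "drift = 0")
    case False
    have "\<bar>\<tau> * ?\<kappa> - t\<bar> \<le> \<tau>"
    proof -
      have "\<tau> * real i \<le> \<tau> * ?\<kappa>" "\<tau> * ?\<kappa> \<le> \<tau> * real (Suc i)"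
        using \<kappa> \<tau> False by (auto simp: k intro!: mult_left_mono)
      then show ?thesis using it by (auto simp: algebra_simps abs_le_iff)
    qed
    then have "\<bar>drift\<bar> * \<bar>\<tau> * ?\<kappa> - t\<bar> \<le> \<bar>drift\<bar> * \<tau>" by (intro mult_left_mono) auto
    then show ?thesis by (simp add: abs_mult[symmetric] algebra_simps)
  qed simp
  moreover have "\<bar>jump_sum m S 0 t - drift * \<tau> * ?\<kappa>\<bar> \<le> r * real n"
  proof -
    have "\<bar>jump_sum m S 0 t - drift * \<tau> * ?\<kappa>\<bar> \<le> r * ?\<kappa>"
      by (rule jump_sum_near_level[OF m sets(2) _ Sfin finSR(2)]) (simp add: S)
    also have "\<dots> \<le> r * real n" using \<kappa>n r by (rule mult_left_mono)
    finally show ?thesis .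
  qed
  ultimately have "\<bar>levy_path m t\<bar> \<le> \<bar>jump_sum m Z0 0 t\<bar> + (\<bar>drift\<bar> * \<tau> + r * real n)"
    unfolding levy_path_def sum R0 by linarith
  then have "ennreal \<bar>levy_path m t\<bar> \<le> ennreal (\<bar>jump_sum m Z0 0 t\<bar> + (\<bar>drift\<bar> * \<tau> + r * real n))"
    by (rule ennreal_leI)
  also have "\<dots> = ennreal \<bar>jump_sum m Z0 0 t\<bar> + ennreal (\<bar>drift\<bar> * \<tau> + r * real n)"
    using r \<tau> by (intro ennreal_plus) auto
  also have "\<dots> \<le> jump_mass m Z0 0 t + ennreal (\<bar>drift\<bar> * \<tau> + r * real n)"
    by (intro add_mono abs_jump_sum_le order_refl)
  finally show ?thesis by (simp add: Z0_def)
qed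

text \<open>A finite family of disjoint regions, away from the jumps below \<open>\<epsilon>\<close>, and possible counts on them that
  force the path to stay below \<open>\<delta>\<close> up to the contribution of those small jumps.\<close>

definition quiet_family ::
  "real \<Rightarrow> real \<Rightarrow> real \<Rightarrow> nat \<Rightarrow> (nat \<Rightarrow> (real \<times> real) set) \<Rightarrow> (nat \<Rightarrow> nat) \<Rightarrow> bool" where
  "quiet_family T \<delta> \<epsilon> n A c \<longleftrightarrow>
    (\<forall>l<n. A l \<in> sets J \<and> emeasure J (A l) < \<infinity> \<and> 0 < poisson_weight (measure J (A l)) (c l) \<and>
       A l \<inter> {z. z \<noteq> 0 \<and> \<bar>z\<bar> \<le> \<epsilon>} \<times> {0..} = {}) \<and>
    disjoint_family_on A {..<n} \<and>
    (\<forall>m. sets m = sets J \<longrightarrow> (\<forall>l<n. emeasure m (A l) = of_nat (c l)) \<longrightarrow>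
       (\<forall>t\<in>{0..T}. jump_mass m (- {0}) 0 t < \<infinity> \<longrightarrow>
          ennreal \<bar>levy_path m t\<bar> \<le> jump_mass m {z. z \<noteq> 0 \<and> \<bar>z\<bar> \<le> \<epsilon>} 0 t + ennreal \<delta>))"

text \<open>The time step \<open>\<tau>\<close> and the tolerance \<open>r\<close> are fixed by \<open>\<delta>\<close> and \<open>T\<close> before \<open>\<epsilon>\<close>, which only has to stay below
  half the required jump size \<open>\<bar>drift * \<tau>\<bar>\<close>. The last region carries the forbidden jumps. The
  steps reach beyond \<open>T\<close> by one, so that every \<open>t \<le> T\<close> lies in a complete step.\<close>

lemma quiet_counts:
  assumes T: "0 < T" and \<delta>: "0 < \<delta>"
  shows "\<exists>\<epsilon>0>0. \<forall>\<epsilon>. 0 < \<epsilon> \<longrightarrow> \<epsilon> \<le> \<epsilon>0 \<longrightarrow> (\<exists>n A c. quiet_family T \<delta> \<epsilon> n A c)"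
proof -
  define \<tau> where "\<tau> = \<delta> / (2 * (\<bar>drift\<bar> + 1))"
  have \<tau>: "0 < \<tau>" using \<delta> by (simp add: \<tau>_def)
  define n where "n = nat \<lceil>(T + \<tau>) / \<tau>\<rceil>"
  have n: "T + \<tau> \<le> real n * \<tau>"
  proof -
    have "(T + \<tau>) / \<tau> \<le> real n" unfolding n_def by (rule real_nat_ceiling_ge)
    then show ?thesis using \<tau> by (simp add: field_simps)
  qed
  then have n0: "0 < real n" using T \<tau> by (smt (verit) mult_nonneg_nonneg mult_eq_0_iff of_nat_0_le_iff)
  define r where "r = \<delta> / (2 * real n)"
  have r: "0 < r" using \<delta> n0 by (simp add: r_def)
  have "\<bar>drift\<bar> * \<tau> \<le> (\<bar>drift\<bar> + 1) * \<tau>" using \<tau> by simp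
  also have "\<dots> = \<delta> / 2" unfolding \<tau>_def by (simp add: field_simps)
  finally have err: "\<bar>drift\<bar> * \<tau> + r * real n \<le> \<delta>" using n0 by (simp add: r_def)
  define k where "k = (if drift = 0 then 0 else 1 :: nat)"
  (* If drift = 0, no jump size has to be avoided and any bound does. *)
  define \<epsilon>0 where "\<epsilon>0 = (if drift = 0 then 1 else \<bar>drift * \<tau>\<bar> / 2)"
  have "0 < \<epsilon>0" using \<tau> by (simp add: \<epsilon>0_def)
  moreover have "\<exists>n A c. quiet_family T \<delta> \<epsilon> n A c"
    if \<epsilon>: "0 < \<epsilon>" "\<epsilon> \<le> \<epsilon>0" for \<epsilon>
  proof -
    define S where "S = {z. \<epsilon> < \<bar>z\<bar> \<and> \<bar>z - drift * \<tau>\<bar> \<le> r}"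
    define R where "R = {z. \<epsilon> < \<bar>z\<bar> \<and> r < \<bar>z - drift * \<tau>\<bar>}"
    have sets: "S \<in> sets \<nu>" "R \<in> sets \<nu>" using \<epsilon> by (auto simp: sets_nu_iff S_def R_def)
    have fin: "emeasure \<nu> S < \<infinity>" "emeasure \<nu> R < \<infinity>"
      by (rule emeasure_away_from_zero[OF \<epsilon>(1)]; (rule sets | simp add: S_def R_def))+
    define A where "A l = (if l < n then S \<times> {real l * \<tau><..real (Suc l) * \<tau>} else R \<times> {0<..real n * \<tau>})" for l
    define c where "c l = (if l < n then k else 0)" for l
    have JA: "emeasure J (S \<times> {real l * \<tau><..real (Suc l) * \<tau>}) = emeasure \<nu> S * ennreal \<tau>" for l
      using emeasure_J[OF sets(1), of "real l * \<tau>" "real (Suc l) * \<tau>"] \<tau> by (simp add: algebra_simps)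
    have JR: "emeasure J (R \<times> {0<..real n * \<tau>}) = emeasure \<nu> R * ennreal (real n * \<tau>)"
      using emeasure_J[OF sets(2), of 0 "real n * \<tau>"] \<tau> by simp
    have Spos: "0 < emeasure \<nu> S" if "drift \<noteq> 0"
    proof -
      define d where "d = drift * \<tau>"
      have d: "d \<noteq> 0" "\<epsilon> \<le> \<bar>d\<bar> / 2" using that \<tau> \<epsilon> by (auto simp: d_def \<epsilon>0_def)
      define w where "w = min r (\<bar>d\<bar> / 2)"
      have w: "0 < w" "w \<le> r" "w \<le> \<bar>d\<bar> / 2" using r d by (auto simp: w_def)
      have sub: "{d - w<..<d + w} \<subseteq> S"
      proof
        fix z assume "z \<in> {d - w<..<d + w}"
        then have "\<bar>z - d\<bar> < w" by auto
        then have "\<bar>d\<bar> / 2 < \<bar>z\<bar>" "\<bar>z - d\<bar> \<le> r" using w by linarith+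
        then show "z \<in> S" using d by (simp add: S_def d_def)
      qed
      have "0 < emeasure \<nu> {d - w<..<d + w}"
        using w d by (intro full_support) auto
      also have "\<dots> \<le> emeasure \<nu> S" by (rule emeasure_mono[OF sub sets(1)])
      finally show ?thesis .
    qed
    have weights: "0 < poisson_weight (measure J (A l)) (c l)" for l
    proof (cases "l < n \<and> drift \<noteq> 0")
      case True
      have "0 < emeasure J (A l)" "emeasure J (A l) < \<infinity>"
        using True Spos \<tau> fin by (auto simp: A_def JA ennreal_zero_less_mult_iff ennreal_mult_less_top simp del: of_nat_Suc)
      then have "0 < measure J (A l)" by (simp add: measure_def enn2real_positive_iff)
      then show ?thesis using True by (simp add: c_def k_def poisson_weight_def)
    next
      case False
      then have "c l = 0" by (auto simp: c_def k_def)
      then show ?thesis by (simp add: poisson_weight_def)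
    qed
    have "\<forall>l<Suc n. A l \<in> sets J \<and> emeasure J (A l) < \<infinity> \<and> 0 < poisson_weight (measure J (A l)) (c l) \<and>
       A l \<inter> {z. z \<noteq> 0 \<and> \<bar>z\<bar> \<le> \<epsilon>} \<times> {0..} = {}"
    proof (intro allI impI conjI weights)
      fix l
      show "A l \<in> sets J" using sets \<tau> by (auto simp: A_def intro!: rectangle_in_J)
      show "emeasure J (A l) < \<infinity>" using fin by (auto simp: A_def JA JR ennreal_mult_less_top simp del: of_nat_Suc)
      show "A l \<inter> {z. z \<noteq> 0 \<and> \<bar>z\<bar> \<le> \<epsilon>} \<times> {0..} = {}" by (auto simp: A_def S_def R_def)
    qed
    moreover have "disjoint_family_on A {..<Suc n}"
    proof -
      have ivl: "{real i * \<tau><..real (Suc i) * \<tau>} \<inter> {real j * \<tau><..real (Suc j) * \<tau>} = {}" if "i < j" for i j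
      proof -
        have "real (Suc i) * \<tau> \<le> real j * \<tau>" using that \<tau> by (intro mult_right_mono) auto
        then show ?thesis by auto
      qed
      have "A i \<inter> A j = {}" if "i < j" "j < Suc n" for i j
      proof (cases "j < n")
        case True
        then show ?thesis using ivl[OF that(1)] that by (auto simp: A_def)
      next
        case False
        then show ?thesis using that by (auto simp: A_def S_def R_def)
      qed
      then show ?thesis unfolding disjoint_family_on_def
        by (metis Int_commute lessThan_iff linorder_neqE_nat)
    qed
    moreover have "ennreal \<bar>levy_path m t\<bar> \<le> jump_mass m {z. z \<noteq> 0 \<and> \<bar>z\<bar> \<le> \<epsilon>} 0 t + ennreal \<delta>"
      if m: "sets m = sets J" and cnt: "\<forall>l<Suc n. emeasure m (A l) = of_nat (c l)" and t: "t \<in> {0..T}"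
        and f: "jump_mass m (- {0}) 0 t < \<infinity>" for m t
    proof -
      have "ennreal \<bar>levy_path m t\<bar> \<le> jump_mass m {z. z \<noteq> 0 \<and> \<bar>z\<bar> \<le> \<epsilon>} 0 t + ennreal (\<bar>drift\<bar> * \<tau> + r * real n)"
      proof (rule quiet_path[OF m \<epsilon>(1) \<tau> less_imp_le[OF r] S_def R_def k_def _ _ _ _ f])
        show "emeasure m (S \<times> {real i * \<tau><..real (Suc i) * \<tau>}) = of_nat k" if "i < n" for i
          using cnt[rule_format, of i] that by (simp add: A_def c_def)
        show "emeasure m (R \<times> {0<..real n * \<tau>}) = 0"
          using cnt[rule_format, of n] by (simp add: A_def c_def)
        show "0 \<le> t" "t + \<tau> \<le> real n * \<tau>" using t n by auto
      qed
      also have "\<dots> \<le> jump_mass m {z. z \<noteq> 0 \<and> \<bar>z\<bar> \<le> \<epsilon>} 0 t + ennreal \<delta>"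
        using err by (intro add_left_mono ennreal_leI)
      finally show ?thesis .
    qed
    ultimately have "quiet_family T \<delta> \<epsilon> (Suc n) A c"
      unfolding quiet_family_def by blast
    then show ?thesis by blast
  qed
  ultimately show ?thesis by blast
qed

definition increment_const :: "real \<Rightarrow> real" where
  "increment_const T = 2 * (enn2real (first_moment (- {0})))\<^sup>2 * T + 2 * enn2real (second_moment (- {0})) + 2 * drift\<^sup>2 * T"

text \<open>On \<open>G\<close>, the coordinates \<open>j < N\<close> are bounded by \<open>\<delta>\<close> plus the jumps below \<open>\<epsilon>\<close>, whose moments vanish
  with \<open>\<epsilon>\<close>; the coordinates \<open>j \<ge> N\<close> do not notice the conditioning. The constant in their bound
  depends neither on \<open>N\<close> nor on \<open>\<rho>\<close>.\<close>

lemma quiet_event: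
  fixes \<eta> :: "nat \<Rightarrow> 'w \<Rightarrow> (real \<times> real) measure"
  assumes M: "prob_space M" and P: "\<And>k. poisson_random_measure M J (\<eta> k)"
    and ind: "prob_space.indep_sets M (\<lambda>k. random_measure_events M (\<eta> k) (sets J)) UNIV"
    and e: "orthonormal_basis e" and L: "is_noise M \<nu> \<eta> \<beta> e L" and T: "0 < T" and \<rho>: "0 < \<rho>"
  shows "\<exists>G\<in>sets M. 0 < emeasure M G \<and>
    (\<forall>j<N. \<forall>t\<in>{0..T}. (\<integral>\<^sup>+\<omega>. ennreal ((L t \<omega> \<bullet> e j)\<^sup>2) \<partial>uniform_measure M G) \<le> ennreal ((\<beta> j)\<^sup>2 * \<rho>)) \<and>
    (\<forall>j\<ge>N. \<forall>s t. 0 \<le> s \<longrightarrow> s \<le> t \<longrightarrow> t \<le> T \<longrightarrow>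
       (\<integral>\<^sup>+\<omega>. ennreal ((L t \<omega> \<bullet> e j - L s \<omega> \<bullet> e j)\<^sup>2) \<partial>uniform_measure M G)
         \<le> ennreal ((\<beta> j)\<^sup>2 * increment_const T * (t - s)))"
proof -
  interpret prob_space M by fact
  note R = poisson_random_measureD(1)[OF P]
  note C = poisson_counts_unconditioned[OF M P]
  note coord = noise_coordinates[OF M R C e L]
  define \<delta> where "\<delta> = sqrt (\<rho> / 4)"
  have \<delta>: "0 < \<delta>" "\<delta>\<^sup>2 = \<rho> / 4" using \<rho> by (auto simp: \<delta>_def)
  obtain \<epsilon>0 where \<epsilon>0: "0 < \<epsilon>0" and fam: "\<And>\<epsilon>. 0 < \<epsilon> \<Longrightarrow> \<epsilon> \<le> \<epsilon>0 \<Longrightarrow> \<exists>n A c. quiet_family T \<delta> \<epsilon> n A c"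
    using quiet_counts[OF T \<delta>(1)] by blast
  define Zs where "Zs n = {z::real. z \<noteq> 0 \<and> \<bar>z\<bar> \<le> 1 / real (Suc n)}" for n
  have "(\<lambda>n. (first_moment (Zs n) * ennreal T)\<^sup>2 + second_moment (Zs n) * ennreal T) \<longlonglongrightarrow> (0 * ennreal T)\<^sup>2 + 0 * ennreal T"
    unfolding power2_eq_square Zs_def
    by (intro tendsto_add tendsto_mult_ennreal moments_vanish tendsto_const) auto
  then have "eventually (\<lambda>n. (first_moment (Zs n) * ennreal T)\<^sup>2 + second_moment (Zs n) * ennreal T < ennreal (\<rho> / 4)) sequentially"
    by (rule order_tendstoD(2)) (use \<rho> in simp)
  moreover have "eventually (\<lambda>n. 1 / real (Suc n) < \<epsilon>0) sequentially"
    using LIMSEQ_inverse_real_of_nat \<epsilon>0 by (auto simp: inverse_eq_divide intro: order_tendstoD)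
  ultimately have "eventually (\<lambda>n. (first_moment (Zs n) * ennreal T)\<^sup>2 + second_moment (Zs n) * ennreal T < ennreal (\<rho> / 4)
      \<and> 1 / real (Suc n) < \<epsilon>0) sequentially" by eventually_elim blast
  then obtain q where q: "(first_moment (Zs q) * ennreal T)\<^sup>2 + second_moment (Zs q) * ennreal T < ennreal (\<rho> / 4)" "1 / real (Suc q) < \<epsilon>0"
    by (auto simp: eventually_sequentially)
  define Z where "Z = Zs q"
  have Z: "Z \<in> sets \<nu>" by (simp add: Z_def Zs_def sets_nu_iff)
  obtain n A c where fm: "quiet_family T \<delta> (1 / real (Suc q)) n A c"
    using fam[of "1 / real (Suc q)"] q(2) by auto
  note fm = fm[unfolded quiet_family_def, folded Zs_def, folded Z_def]
  have A: "A l \<in> sets J" "emeasure J (A l) < \<infinity>" "0 < poisson_weight (measure J (A l)) (c l)"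
    "A l \<inter> Z \<times> {0..} = {}" if "l < n" for l
    using fm that by blast+
  have disj: "disjoint_family_on A {..<n}" using fm by blast
  have quiet: "ennreal \<bar>levy_path m t\<bar> \<le> jump_mass m Z 0 t + ennreal \<delta>"
    if "sets m = sets J" "\<forall>l<n. emeasure m (A l) = of_nat (c l)" "t \<in> {0..T}" "jump_mass m (- {0}) 0 t < \<infinity>" for m t
    using fm that by blast
  define G where "G = {\<omega>\<in>space M. \<forall>k<N. \<omega> \<in> count_event M (\<eta> k) A c n}"
  note cond = poisson_counts_conditioned[where n = n and A = A and c = c and N = N and \<eta> = \<eta> and G = G, OF M P ind A(1,2) disj A(3) G_def]
  define Q where "Q = uniform_measure M G"
  have Gs: "G \<in> events" and Gpos: "0 < emeasure M G" by (rule cond(1), assumption+, rule cond(2), assumption+)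
  have Q: "prob_space Q" unfolding Q_def using Gpos by (intro prob_space_uniform_measure) auto
  interpret Q: prob_space Q by fact
  have spQ: "space Q = space M" "sets Q = sets M" by (auto simp: Q_def)
  have RQ: "random_measure_on Q J (\<eta> k)" for k
    using R[of k] unfolding random_measure_on_def by (simp add: spQ cong: measurable_cong_sets)
  have AEQ: "AE \<omega> in Q. X \<omega>" if "AE \<omega> in M. X \<omega>" for X
    unfolding Q_def using that Gs by (intro AE_uniform_measureI) (auto elim: eventually_mono)
  have AEG: "AE \<omega> in Q. \<omega> \<in> G"
    unfolding Q_def using Gs by (intro AE_uniform_measureI) auto
  have small: "(\<integral>\<^sup>+\<omega>. ennreal ((L t \<omega> \<bullet> e j)\<^sup>2) \<partial>Q) \<le> ennreal ((\<beta> j)\<^sup>2 * \<rho>)" if j: "j < N" and t: "t \<in> {0..T}" for j t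
  proof -
    have t0: "0 \<le> t" using t by simp
    have CQ: "poisson_counts_on Q J (\<eta> j) (Z \<times> {0..})"
      unfolding Q_def by (rule cond(3)[OF _ _ _ j A(4)])
    note [measurable] = measurable_jump_mass[OF RQ Z order_refl, of j t]
    have "(\<integral>\<^sup>+\<omega>. ennreal ((L t \<omega> \<bullet> e j)\<^sup>2) \<partial>Q) \<le> (\<integral>\<^sup>+\<omega>. ennreal ((\<beta> j)\<^sup>2) * (2 * (jump_mass (\<eta> j \<omega>) Z 0 t)\<^sup>2 + 2 * (ennreal \<delta>)\<^sup>2) \<partial>Q)"
    proof (rule nn_integral_mono_AE, use AEG AEQ[OF coord[OF t0, of j]] AEQ[OF AE_jump_mass_finite[OF M R C t0, of j]] AE_space in eventually_elim)
      case (elim \<omega>)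
      have "ennreal \<bar>levy_path (\<eta> j \<omega>) t\<bar> \<le> jump_mass (\<eta> j \<omega>) Z 0 t + ennreal \<delta>"
      proof (rule quiet[OF random_measure_on_facts(1)[OF RQ elim(4)] _ t elim(3)])
        show "\<forall>l<n. emeasure (\<eta> j \<omega>) (A l) = of_nat (c l)"
          using elim(1) j by (auto simp: G_def count_event_def)
      qed
      then have "ennreal ((levy_path (\<eta> j \<omega>) t)\<^sup>2) \<le> 2 * (jump_mass (\<eta> j \<omega>) Z 0 t)\<^sup>2 + 2 * (ennreal \<delta>)\<^sup>2"
        by (intro order_trans[OF ennreal_square_of_abs_le ennreal_square_add_le])
      then have "ennreal ((\<beta> j)\<^sup>2) * ennreal ((levy_path (\<eta> j \<omega>) t)\<^sup>2)
          \<le> ennreal ((\<beta> j)\<^sup>2) * (2 * (jump_mass (\<eta> j \<omega>) Z 0 t)\<^sup>2 + 2 * (ennreal \<delta>)\<^sup>2)" by (intro mult_left_mono) auto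
      then show ?case unfolding elim(2) power_mult_distrib by (simp add: ennreal_mult)
    qed
    also have "\<dots> = ennreal ((\<beta> j)\<^sup>2) * (2 * (\<integral>\<^sup>+\<omega>. (jump_mass (\<eta> j \<omega>) Z 0 t)\<^sup>2 \<partial>Q) + 2 * (ennreal \<delta>)\<^sup>2)"
      by (simp add: nn_integral_add nn_integral_cmult Q.emeasure_space_1)
    also have "\<dots> \<le> ennreal ((\<beta> j)\<^sup>2) * (2 * ennreal (\<rho> / 4) + 2 * ennreal (\<rho> / 4))"
    proof (intro mult_left_mono add_mono)
      have "(\<integral>\<^sup>+\<omega>. (jump_mass (\<eta> j \<omega>) Z 0 t)\<^sup>2 \<partial>Q) \<le> (first_moment Z * ennreal (t - 0))\<^sup>2 + second_moment Z * ennreal (t - 0)"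
        by (rule jump_mass_second_moment[OF Q RQ CQ Z order_refl t0]) auto
      also have "\<dots> \<le> (first_moment Z * ennreal T)\<^sup>2 + second_moment Z * ennreal T"
        using t by (intro add_mono power_mono mult_left_mono ennreal_leI) auto
      also have "\<dots> \<le> ennreal (\<rho> / 4)" using q(1) by (simp add: Z_def)
      finally show "(\<integral>\<^sup>+\<omega>. (jump_mass (\<eta> j \<omega>) Z 0 t)\<^sup>2 \<partial>Q) \<le> ennreal (\<rho> / 4)" .
      show "(ennreal \<delta>)\<^sup>2 \<le> ennreal (\<rho> / 4)"
        unfolding \<delta>(2)[symmetric] using \<delta>(1) by (simp add: ennreal_power)
    qed auto
    also have "\<dots> = ennreal ((\<beta> j)\<^sup>2 * \<rho>)"
    proof -
      have "2 * ennreal x + 2 * ennreal x = ennreal (2 * x + 2 * x)" if "0 \<le> x" for x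
        using that by (subst ennreal_plus) (auto simp: ennreal_mult)
      from this[of "\<rho> / 4"] have "2 * ennreal (\<rho> / 4) + 2 * ennreal (\<rho> / 4) = ennreal \<rho>"
        using \<rho> by simp
      then show ?thesis using \<rho> by (simp add: ennreal_mult)
    qed
    finally show ?thesis .
  qed
  have incr: "(\<integral>\<^sup>+\<omega>. ennreal ((L t \<omega> \<bullet> e j - L s \<omega> \<bullet> e j)\<^sup>2) \<partial>Q) \<le> ennreal ((\<beta> j)\<^sup>2 * increment_const T * (t - s))"
    if j: "N \<le> j" and st: "0 \<le> s" "s \<le> t" "t \<le> T" for j s t
  proof -
    have t0: "0 \<le> t" using st by simp
    have CQ: "poisson_counts_on Q J (\<eta> j) (space J)" unfolding Q_def by (rule cond(4)[OF _ _ _ j])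
    have Z: "- {0} \<in> sets \<nu>" by (simp add: sets_nu_iff)
    have [measurable]: "(\<lambda>\<omega>. levy_path (\<eta> j \<omega>) x) \<in> borel_measurable Q" for x
      unfolding levy_path_def using measurable_jump_sum[OF RQ Z order_refl] by simp
    have "(\<integral>\<^sup>+\<omega>. ennreal ((L t \<omega> \<bullet> e j - L s \<omega> \<bullet> e j)\<^sup>2) \<partial>Q)
        = (\<integral>\<^sup>+\<omega>. ennreal ((\<beta> j)\<^sup>2) * ennreal ((levy_path (\<eta> j \<omega>) t - levy_path (\<eta> j \<omega>) s)\<^sup>2) \<partial>Q)"
    proof (rule nn_integral_cong_AE, use AEQ[OF coord[OF t0, of j]] AEQ[OF coord[OF st(1), of j]] in eventually_elim)
      case (elim \<omega>)
      have "L t \<omega> \<bullet> e j - L s \<omega> \<bullet> e j = \<beta> j * (levy_path (\<eta> j \<omega>) t - levy_path (\<eta> j \<omega>) s)"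
        unfolding elim by (simp add: algebra_simps)
      then show ?case by (simp add: power_mult_distrib ennreal_mult)
    qed
    also have "\<dots> = ennreal ((\<beta> j)\<^sup>2) * (\<integral>\<^sup>+\<omega>. ennreal ((levy_path (\<eta> j \<omega>) t - levy_path (\<eta> j \<omega>) s)\<^sup>2) \<partial>Q)"
      by (simp add: nn_integral_cmult)
    also have "\<dots> \<le> ennreal ((\<beta> j)\<^sup>2) * ennreal (increment_const T * (t - s))"
      unfolding increment_const_def by (intro mult_left_mono levy_path_increment_moment[OF Q RQ CQ st]) simp
    also have "\<dots> = ennreal ((\<beta> j)\<^sup>2 * (increment_const T * (t - s)))"
      by (rule ennreal_mult'[symmetric]) simp
    finally show ?thesis by (simp only: mult.assoc)
  qed
  show ?thesis
    using Gs Gpos small incr unfolding Q_def by (intro bexI[of _ G]) auto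
qed

end

section \<open>Moments of the smoothed noise\<close>

lemma ennreal_integral_le_nn_integral:
  fixes f :: "'a \<Rightarrow> real"
  assumes "\<And>x. 0 \<le> f x"
  shows "ennreal (\<integral>x. f x \<partial>M) \<le> (\<integral>\<^sup>+x. ennreal (f x) \<partial>M)"
proof (cases "integrable M f")
  case True
  then show ?thesis using nn_integral_eq_integral[OF True] assms by simp
qed (simp add: not_integrable_integral_eq)

text \<open>The bound \<open>c0\<close> serves for coordinates that are uniformly small, and \<open>c1\<close> for coordinates with
  independent increments, where the exponential weights turn \<open>t - s\<close> into \<open>1 / a\<close>.\<close>

lemma ou_moment:
  fixes m :: "real \<Rightarrow> 'w \<Rightarrow> real"
  assumes Q: "prob_space Q" and a: "0 < a"
    and jm: "(\<lambda>p. m (fst p) (snd p)) \<in> borel_measurable (borel \<Otimes>\<^sub>M Q)"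
    and int: "AE \<omega> in Q. integrable lborel (\<lambda>s. m s \<omega>) \<and> integrable lborel (\<lambda>s. (m s \<omega>)\<^sup>2)"
    and c: "0 \<le> c0" "0 \<le> c1" and t: "0 \<le> t" "t \<le> T"
    and b0: "(\<integral>\<^sup>+\<omega>. ennreal ((m t \<omega>)\<^sup>2) \<partial>Q) \<le> ennreal (c0 + c1 * t)"
    and b1: "\<And>s. 0 \<le> s \<Longrightarrow> s \<le> t \<Longrightarrow> (\<integral>\<^sup>+\<omega>. ennreal ((m t \<omega> - m s \<omega>)\<^sup>2) \<partial>Q) \<le> ennreal (c0 + c1 * (t - s))"
  shows "(\<integral>\<^sup>+\<omega>. ennreal ((ou a (\<lambda>s. m s \<omega>) t)\<^sup>2) \<partial>Q) \<le> ennreal (c0 + c1 / a)"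
proof -
  interpret prob_space Q by fact
  interpret P: pair_sigma_finite lborel Q ..
  define w where "w s = indicator {0..t} s * (a * exp (- a * (t - s)))" for s
  have w0: "0 \<le> w s" for s using a by (auto simp: w_def split: split_indicator)
  have [measurable]: "w \<in> borel_measurable borel" unfolding w_def by measurable
  have mm[measurable (raw)]: "(\<lambda>x. m (f x) (g x)) \<in> borel_measurable N"
    if "f \<in> borel_measurable N" "g \<in> measurable N Q" for f g and N :: "'z measure"
    using measurable_compose[OF measurable_Pair[OF that] jm] by simp
  have mt[measurable]: "(\<lambda>\<omega>. m s \<omega>) \<in> borel_measurable Q" for s
    using measurable_compose[OF measurable_Pair1'[of s borel Q] jm] by simp
  have jd: "(\<lambda>p. ennreal (w (fst p)) * ennreal ((m t (snd p) - m (fst p) (snd p))\<^sup>2)) \<in> borel_measurable (lborel \<Otimes>\<^sub>M Q)"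
  proof -
    have "(\<lambda>p. m (fst p) (snd p)) \<in> borel_measurable (lborel \<Otimes>\<^sub>M Q)" using jm by simp
    moreover have "(\<lambda>p. m t (snd p)) \<in> borel_measurable (lborel \<Otimes>\<^sub>M Q)"
      by (rule measurable_compose[OF measurable_snd mt])
    ultimately show ?thesis by measurable
  qed
  have "(\<integral>\<^sup>+\<omega>. (\<integral>\<^sup>+s. ennreal (w s) * ennreal ((m t \<omega> - m s \<omega>)\<^sup>2) \<partial>lborel) \<partial>Q)
      = (\<integral>\<^sup>+s. (\<integral>\<^sup>+\<omega>. ennreal (w s) * ennreal ((m t \<omega> - m s \<omega>)\<^sup>2) \<partial>Q) \<partial>lborel)"
    using P.Fubini'[of "\<lambda>s \<omega>. ennreal (w s) * ennreal ((m t \<omega> - m s \<omega>)\<^sup>2)"] jd by (simp add: case_prod_beta')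
  also have "\<dots> \<le> (\<integral>\<^sup>+s. ennreal (w s * (c0 + c1 * (t - s))) \<partial>lborel)"
  proof (rule nn_integral_mono)
    fix s
    show "(\<integral>\<^sup>+\<omega>. ennreal (w s) * ennreal ((m t \<omega> - m s \<omega>)\<^sup>2) \<partial>Q) \<le> ennreal (w s * (c0 + c1 * (t - s)))"
    proof (cases "s \<in> {0..t}")
      case True
      have "(\<integral>\<^sup>+\<omega>. ennreal (w s) * ennreal ((m t \<omega> - m s \<omega>)\<^sup>2) \<partial>Q) = ennreal (w s) * (\<integral>\<^sup>+\<omega>. ennreal ((m t \<omega> - m s \<omega>)\<^sup>2) \<partial>Q)"
        by (rule nn_integral_cmult) simp
      also have "\<dots> \<le> ennreal (w s) * ennreal (c0 + c1 * (t - s))" using True by (intro mult_left_mono b1) auto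
      also have "\<dots> = ennreal (w s * (c0 + c1 * (t - s)))" using w0 by (intro ennreal_mult'[symmetric]) auto
      finally show ?thesis .
    qed (simp add: w_def)
  qed
  also have "\<dots> = ennreal (\<integral>s. w s * (c0 + c1 * (t - s)) \<partial>lborel)"
  proof (rule nn_integral_eq_integral)
    show "integrable lborel (\<lambda>s. w s * (c0 + c1 * (t - s)))"
      using borel_integrable_atLeastAtMost'[of 0 t "\<lambda>s. a * exp (- a * (t - s)) * (c0 + c1 * (t - s))"]
      by (simp add: set_integrable_def w_def mult.assoc continuous_intros)
    show "AE s in lborel. 0 \<le> w s * (c0 + c1 * (t - s))"
      using a c by (auto simp: w_def split: split_indicator)
  qed
  also have "(\<integral>s. w s * (c0 + c1 * (t - s)) \<partial>lborel) = c0 * (1 - exp (- a * t)) + c1 * (1 / a - exp (- a * t) * (t + 1 / a))"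
  proof -
    have i1: "integrable lborel w"
      using borel_integrable_atLeastAtMost'[of 0 t "\<lambda>s. a * exp (- a * (t - s))"]
      by (simp add: set_integrable_def w_def[abs_def] continuous_intros)
    have i2: "integrable lborel (\<lambda>s. w s * (t - s))"
      using borel_integrable_atLeastAtMost'[of 0 t "\<lambda>s. a * exp (- a * (t - s)) * (t - s)"]
      by (simp add: set_integrable_def w_def mult.assoc continuous_intros)
    have "(\<integral>s. w s * (c0 + c1 * (t - s)) \<partial>lborel) = (\<integral>s. c0 * w s + c1 * (w s * (t - s)) \<partial>lborel)"
      by (rule Bochner_Integration.integral_cong) (simp_all add: algebra_simps)
    also have "\<dots> = c0 * (\<integral>s. w s \<partial>lborel) + c1 * (\<integral>s. w s * (t - s) \<partial>lborel)"
      using i1 i2 by simp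
    also have "(\<integral>s. w s \<partial>lborel) = 1 - exp (- a * t)"
      using primitive_exp[OF a t(1)] unfolding primitive_eq w_def .
    also have "(\<integral>s. w s * (t - s) \<partial>lborel) = 1 / a - exp (- a * t) * (t + 1 / a)"
      using primitive_exp_weighted[OF a t(1)] unfolding primitive_eq w_def by (simp only: mult.assoc)
    finally show ?thesis .
  qed
  finally have increments: "(\<integral>\<^sup>+\<omega>. (\<integral>\<^sup>+s. ennreal (w s) * ennreal ((m t \<omega> - m s \<omega>)\<^sup>2) \<partial>lborel) \<partial>Q)
      \<le> ennreal (c0 * (1 - exp (- a * t)) + c1 * (1 / a - exp (- a * t) * (t + 1 / a)))" .
  have "(\<integral>\<^sup>+\<omega>. ennreal ((ou a (\<lambda>s. m s \<omega>) t)\<^sup>2) \<partial>Q)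
      \<le> (\<integral>\<^sup>+\<omega>. ennreal (exp (- a * t)) * ennreal ((m t \<omega>)\<^sup>2)
          + (\<integral>\<^sup>+s. ennreal (w s) * ennreal ((m t \<omega> - m s \<omega>)\<^sup>2) \<partial>lborel) \<partial>Q)"
  proof (rule nn_integral_mono_AE, use int in eventually_elim)
    case (elim \<omega>)
    have "(ou a (\<lambda>s. m s \<omega>) t)\<^sup>2 \<le> exp (- a * t) * (m t \<omega>)\<^sup>2 + primitive (\<lambda>s. a * exp (- a * (t - s)) * (m t \<omega> - m s \<omega>)\<^sup>2) t"
      using elim by (intro ou_square_le[OF a t(1)]) auto
    also have "primitive (\<lambda>s. a * exp (- a * (t - s)) * (m t \<omega> - m s \<omega>)\<^sup>2) t = (\<integral>s. w s * (m t \<omega> - m s \<omega>)\<^sup>2 \<partial>lborel)"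
      unfolding primitive_eq w_def by (simp only: mult.assoc)
    finally have "ennreal ((ou a (\<lambda>s. m s \<omega>) t)\<^sup>2)
        \<le> ennreal (exp (- a * t) * (m t \<omega>)\<^sup>2 + (\<integral>s. w s * (m t \<omega> - m s \<omega>)\<^sup>2 \<partial>lborel))" by (rule ennreal_leI)
    also have "\<dots> = ennreal (exp (- a * t) * (m t \<omega>)\<^sup>2) + ennreal (\<integral>s. w s * (m t \<omega> - m s \<omega>)\<^sup>2 \<partial>lborel)"
      using w0 by (intro ennreal_plus Bochner_Integration.integral_nonneg) auto
    also have "\<dots> \<le> ennreal (exp (- a * t)) * ennreal ((m t \<omega>)\<^sup>2) + (\<integral>\<^sup>+s. ennreal (w s * (m t \<omega> - m s \<omega>)\<^sup>2) \<partial>lborel)"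
      using w0 by (intro add_mono ennreal_integral_le_nn_integral) (auto simp: ennreal_mult)
    finally show ?case using w0 by (simp add: ennreal_mult)
  qed
  also have "\<dots> = ennreal (exp (- a * t)) * (\<integral>\<^sup>+\<omega>. ennreal ((m t \<omega>)\<^sup>2) \<partial>Q)
      + (\<integral>\<^sup>+\<omega>. (\<integral>\<^sup>+s. ennreal (w s) * ennreal ((m t \<omega> - m s \<omega>)\<^sup>2) \<partial>lborel) \<partial>Q)"
  proof -
    have "(\<lambda>\<omega>. \<integral>\<^sup>+s. ennreal (w s) * ennreal ((m t \<omega> - m s \<omega>)\<^sup>2) \<partial>lborel) \<in> borel_measurable Q"
      using measurable_pair_swap[OF jd] by (intro lborel.borel_measurable_nn_integral) (simp add: case_prod_beta')
    then show ?thesis by (subst nn_integral_add) (simp_all add: nn_integral_cmult)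
  qed
  also have "\<dots> \<le> ennreal (exp (- a * t)) * ennreal (c0 + c1 * t)
      + ennreal (c0 * (1 - exp (- a * t)) + c1 * (1 / a - exp (- a * t) * (t + 1 / a)))"
    by (intro add_mono mult_left_mono b0 increments) simp
  also have "\<dots> = ennreal (exp (- a * t) * (c0 + c1 * t) + (c0 * (1 - exp (- a * t)) + c1 * (1 / a - exp (- a * t) * (t + 1 / a))))"
  proof -
    have "0 \<le> 1 / a - exp (- a * t) * (t + 1 / a)"
      unfolding primitive_exp_weighted[OF a t(1), symmetric] primitive_eq
      using a by (intro Bochner_Integration.integral_nonneg) (auto split: split_indicator)
    then show ?thesis using a c t by (subst ennreal_plus) (auto simp: ennreal_mult)
  qed
  also have "\<dots> \<le> ennreal (c0 + c1 / a)"
  proof (rule ennreal_leI)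
    have "exp (- a * t) * (c0 + c1 * t) + (c0 * (1 - exp (- a * t)) + c1 * (1 / a - exp (- a * t) * (t + 1 / a)))
        = c0 + c1 / a - c1 * exp (- a * t) / a" by (simp add: algebra_simps)
    also have "\<dots> \<le> c0 + c1 / a" using c a by simp
    finally show "exp (- a * t) * (c0 + c1 * t) + (c0 * (1 - exp (- a * t)) + c1 * (1 / a - exp (- a * t) * (t + 1 / a))) \<le> c0 + c1 / a" .
  qed
  finally show ?thesis .
qed

lemma ou_integrable:
  assumes a: "0 < a" and m: "integrable lborel m"
  shows "integrable lborel (\<lambda>t. indicator {0..T} t * ou a m t)"
proof (rule Bochner_Integration.integrable_bound)
  let ?K = "\<integral>s. \<bar>m s\<bar> \<partial>lborel"
  have [measurable]: "m \<in> borel_measurable borel" using m by auto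
  note [measurable] = measurable_ou[of m a]
  have "integrable lborel (\<lambda>t. indicator {0..T} t * (a * ?K))"
    by (intro integrable_mult_left integrable_real_indicator) (auto simp: emeasure_lborel_Icc_eq)
  then show "integrable lborel (\<lambda>t. \<bar>m t\<bar> + indicator {0..T} t * (a * ?K))"
    using m by (intro Bochner_Integration.integrable_add integrable_abs)
  show "(\<lambda>t. indicator {0..T} t * ou a m t) \<in> borel_measurable lborel" by simp
  have "\<bar>ou a m t\<bar> \<le> \<bar>m t\<bar> + a * ?K" for t
  proof -
    have "\<bar>primitive (\<lambda>s. exp (- a * (t - s)) * m s) t\<bar> \<le> (\<integral>s. \<bar>indicator {0..t} s * (exp (- a * (t - s)) * m s)\<bar> \<partial>lborel)"
      unfolding primitive_eq by (rule integral_abs_bound)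
    also have "\<dots> \<le> ?K"
    proof (rule Bochner_Integration.integral_mono')
      show "integrable lborel (\<lambda>s. \<bar>m s\<bar>)" using m by (rule integrable_abs)
      fix s
      show "\<bar>indicator {0..t} s * (exp (- a * (t - s)) * m s)\<bar> \<le> \<bar>m s\<bar>"
        using a by (auto simp: abs_mult mult_left_le_one_le split: split_indicator)
    qed simp
    finally have "a * \<bar>primitive (\<lambda>s. exp (- a * (t - s)) * m s) t\<bar> \<le> a * ?K" using a by simp
    moreover have "\<bar>a * primitive (\<lambda>s. exp (- a * (t - s)) * m s) t\<bar> = a * \<bar>primitive (\<lambda>s. exp (- a * (t - s)) * m s) t\<bar>"
      unfolding abs_mult using a by simp
    ultimately show ?thesis
      unfolding ou_def using abs_triangle_ineq4[of "m t" "a * primitive (\<lambda>s. exp (- a * (t - s)) * m s) t"]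
      by linarith
  qed
  then show "AE t in lborel. norm (indicator {0..T} t * ou a m t) \<le> norm (\<bar>m t\<bar> + indicator {0..T} t * (a * ?K))"
    using a by (auto split: split_indicator intro: order_trans[OF _ abs_ge_self])
qed

section \<open>The Levy measure, the noise coefficients and the resolvent\<close>

text \<open>The moments are those of order \<open>1\<close> and \<open>2\<close>; jumps of every size occur because the density is positive.\<close>

lemma jump_law_of_conditions:
  assumes levy: "levy_measure \<nu>" and L: "condition_L \<nu>"
  shows "jump_law \<nu>"
proof (rule jump_law.intro)
  show sets: "sets \<nu> = sets (restrict_space borel (- {0}))" and "sigma_finite_measure \<nu>"
    using levy by (auto simp: levy_measure_def)
  have mom: "(\<integral>\<^sup>+z. ennreal (\<bar>z\<bar> powr q) \<partial>\<nu>) < \<infinity>" if "1 \<le> q" for q :: real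
    using L that unfolding condition_L_def by blast
  have "\<bar>z\<bar> powr 1 = \<bar>z\<bar>" "\<bar>z\<bar> powr 2 = z\<^sup>2" for z :: real
    by (cases "z = 0"; simp add: powr_numeral)+
  then show "(\<integral>\<^sup>+z. ennreal \<bar>z\<bar> \<partial>\<nu>) < \<infinity>" "(\<integral>\<^sup>+z. ennreal (z\<^sup>2) \<partial>\<nu>) < \<infinity>"
    using mom[of 1] mom[of 2] by auto
  obtain g where g: "\<nu> = density (restrict_space lborel (- {0})) (\<lambda>z. ennreal (g z))"
    and gpos: "\<And>z. z \<noteq> 0 \<Longrightarrow> 0 < g z" and gd: "\<And>z. z \<noteq> 0 \<Longrightarrow> g field_differentiable (at z)"
    using L unfolding condition_L_def by blast
  have "continuous_on (- {0}) g"
    using gd by (intro continuous_at_imp_continuous_on ballI field_differentiable_imp_continuous_at) auto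
  then have "g \<in> borel_measurable (restrict_space borel (- {0}))"
    by (rule borel_measurable_continuous_on_restrict)
  then have gm: "g \<in> borel_measurable (restrict_space lborel (- {0}))"
    by (simp cong: measurable_cong_sets add: sets_restrict_space)
  fix a b :: real assume ab: "a < b" "0 \<notin> {a<..<b}"
  have in_sets: "{a<..<b} \<in> sets (restrict_space lborel (- {0}))"
    using ab by (subst sets_restrict_space_iff) auto
  have "emeasure \<nu> {a<..<b} \<noteq> 0"
  proof
    assume "emeasure \<nu> {a<..<b} = 0"
    then have "(\<integral>\<^sup>+z. ennreal (g z) * indicator {a<..<b} z \<partial>restrict_space lborel (- {0})) = 0"
      unfolding g using gm in_sets by (subst (asm) emeasure_density) auto
    then have "AE z in restrict_space lborel (- {0}). ennreal (g z) * indicator {a<..<b} z = 0"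
      using gm in_sets by (subst (asm) nn_integral_0_iff_AE) auto
    then have "AE z in lborel. z \<in> - {0} \<longrightarrow> ennreal (g z) * indicator {a<..<b} z = 0"
      by (subst (asm) AE_restrict_space_iff) auto
    then have "AE z in lborel. z \<notin> {a<..<b}"
    proof eventually_elim
      case (elim z)
      show ?case using elim gpos[of z] ab by (auto split: split_indicator)
    qed
    then have "emeasure lborel {a<..<b} = 0"
      by (subst (asm) AE_iff_measurable[of "{a<..<b}"]) auto
    then show False using ab by simp
  qed
  then show "0 < emeasure \<nu> {a<..<b}" by (simp add: zero_less_iff_neq_zero)
qed

lemma summable_noise_coefficients:
  assumes k0: "0 < k0" and lam: "1 < lam" and N: "condition_N (shell_eigenvalue k0 lam) \<beta>"
  shows "summable (\<lambda>j. (\<beta> j)\<^sup>2)"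
proof -
  obtain \<theta> where \<theta>: "1/4 < \<theta>" and \<beta>: "\<And>j. \<beta> j = shell_eigenvalue k0 lam j powr (- \<theta>)"
    using N unfolding condition_N_def by blast
  define q where "q = lam powr (- (4 * \<theta>))"
  have q: "0 < q" "q < 1" using lam \<theta> by (auto simp: q_def powr_less_one)
  have "(\<beta> j)\<^sup>2 = k0 powr (- (2 * \<theta>)) * q * q ^ j" for j
  proof -
    have "(\<beta> j)\<^sup>2 = shell_eigenvalue k0 lam j powr (- (2 * \<theta>))"
      by (simp add: \<beta> power2_eq_square flip: powr_add)
    also have "\<dots> = k0 powr (- (2 * \<theta>)) * (lam ^ (2 * (j + 1))) powr (- (2 * \<theta>))"
      unfolding shell_eigenvalue_def by (rule powr_mult)
    also have "(lam ^ (2 * (j + 1))) powr (- (2 * \<theta>)) = q ^ (Suc j)"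
    proof -
      have "lam ^ (2 * (j + 1)) = lam powr real (2 * (j + 1))" using lam by (simp only: powr_realpow)
      moreover have "q ^ Suc j = q powr real (Suc j)" using q by (simp only: powr_realpow)
      moreover have "real (2 * (j + 1)) * (- (2 * \<theta>)) = - (4 * \<theta>) * real (Suc j)" by (simp add: algebra_simps)
      ultimately show ?thesis unfolding q_def by (simp only: powr_powr)
    qed
    finally show ?thesis by simp
  qed
  then show ?thesis using q by (simp add: summable_mult)
qed

text \<open>Clamping the time to \<open>[0,T]\<close> reduces the measurability on the line to that on the interval.\<close>

lemma joint_extension:
  fixes u :: "real \<Rightarrow> 'w \<Rightarrow> 'h::real_normed_vector"
  assumes T: "0 < T" and u: "(\<lambda>(t, \<omega>). u t \<omega>) \<in> borel_measurable (restrict_space borel {0..T} \<Otimes>\<^sub>M M)"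
  shows "(\<lambda>p. if fst p \<in> {0..T} then u (fst p) (snd p) else 0) \<in> borel_measurable (borel \<Otimes>\<^sub>M M)"
proof -
  define c where "c t = max 0 (min T t)" for t
  have c: "c \<in> measurable borel (restrict_space borel {0..T})"
    unfolding c_def using T by (intro measurable_restrict_space2) auto
  have "(\<lambda>p. (c (fst p), snd p)) \<in> measurable (borel \<Otimes>\<^sub>M M) (restrict_space borel {0..T} \<Otimes>\<^sub>M M)"
    by (intro measurable_Pair measurable_compose[OF measurable_fst c] measurable_snd)
  from measurable_compose[OF this u]
  have "(\<lambda>p. u (c (fst p)) (snd p)) \<in> borel_measurable (borel \<Otimes>\<^sub>M M)" by simp
  then have "(\<lambda>p. if fst p \<in> {0..T} then u (c (fst p)) (snd p) else 0) \<in> borel_measurable (borel \<Otimes>\<^sub>M M)"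
    by (intro measurable_If) auto
  moreover have "(\<lambda>p. if fst p \<in> {0..T} then u (c (fst p)) (snd p) else 0)
      = (\<lambda>p. if fst p \<in> {0..T} then u (fst p) (snd p) else 0)"
    by (auto simp: c_def fun_eq_iff)
  ultimately show ?thesis by simp
qed

text \<open>If the resolvent vanished, then for almost every \<open>t\<close> the path would almost surely avoid \<open>U\<close> at time \<open>t\<close>;
  by Fubini's theorem almost every path would avoid \<open>U\<close> at almost every time.\<close>

lemma resolvent_positive:
  fixes u :: "real \<Rightarrow> 'w \<Rightarrow> 'h::real_normed_vector"
  assumes M: "prob_space M"
    and u: "\<And>T. 0 < T \<Longrightarrow> (\<lambda>(t, \<omega>). u t \<omega>) \<in> borel_measurable (restrict_space borel {0..T} \<Otimes>\<^sub>M M)"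
    and U: "open U" and r: "0 < r" and T: "0 < T"
    and hit: "\<not> (AE \<omega> in M. AE t in lborel. t \<in> {0..T} \<longrightarrow> u t \<omega> \<notin> U)"
  shows "0 < (\<integral>t\<in>{0..}. exp (- r * t) * (\<integral>\<omega>. indicator U (u t \<omega>) \<partial>M) \<partial>lborel)"
proof -
  interpret prob_space M by fact
  interpret P: pair_sigma_finite lborel M ..
  define ext where "ext S p = (if fst p \<in> {0..S} then u (fst p) (snd p) else 0)" for S p
  have ext: "ext S \<in> borel_measurable (borel \<Otimes>\<^sub>M M)" if "0 < S" for S
    unfolding ext_def by (rule joint_extension[OF that u[OF that]])
  define I where "I S p = indicator {0..S} (fst p) * (indicator U (ext S p) :: real)" for S p
  have I[measurable]: "I S \<in> borel_measurable (borel \<Otimes>\<^sub>M M)" if "0 < S" for S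
  proof -
    have "(\<lambda>p. indicator U (ext S p) :: real) \<in> borel_measurable (borel \<Otimes>\<^sub>M M)"
      using U by (intro measurable_compose[OF ext[OF that]]) auto
    then show ?thesis unfolding I_def by simp
  qed
  define p :: "real \<Rightarrow> real" where "p t = (\<integral>\<omega>. indicator U (u t \<omega>) \<partial>M)" for t
  have p01: "0 \<le> p t" "p t \<le> 1" for t
  proof -
    show "0 \<le> p t" unfolding p_def by simp
    show "p t \<le> 1"
    proof (cases "integrable M (\<lambda>\<omega>. indicator U (u t \<omega>) :: real)")
      case True
      have "p t \<le> (\<integral>\<omega>. 1 \<partial>M)" unfolding p_def using True by (intro integral_mono) (auto split: split_indicator)
      then show ?thesis by (simp add: prob_space)
    qed (simp add: p_def not_integrable_integral_eq)
  qed
  have pI: "indicator {0..S} t * p t = (\<integral>\<omega>. I S (t, \<omega>) \<partial>M)" for S t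
    unfolding p_def I_def ext_def by (cases "t \<in> {0..S}") auto
  have pm: "(\<lambda>t. indicator {0..S} t * p t) \<in> borel_measurable borel" if "0 < S" for S
    unfolding pI using I[OF that] by (intro borel_measurable_lebesgue_integral) (simp add: case_prod_beta')
  have pm': "(\<lambda>t. indicator {0..} t * p t) \<in> borel_measurable borel"
  proof (rule borel_measurable_LIMSEQ_real)
    show "(\<lambda>t. indicator {0..real (Suc n)} t * p t) \<in> borel_measurable borel" for n by (rule pm) simp
    fix t
    obtain n0 where n0: "t \<le> real n0" using real_arch_simple by blast
    have "indicator {0..real (Suc n)} t * p t = indicator {0..} t * p t" if "n0 \<le> n" for n
      using n0 that by (auto split: split_indicator)
    then show "(\<lambda>n. indicator {0..real (Suc n)} t * p t) \<longlonglongrightarrow> indicator {0..} t * p t"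
      by (intro tendsto_eventually) (auto simp: eventually_sequentially)
  qed
  define h where "h t = indicator {0..} t * (exp (- r * t) * p t)" for t
  have h0: "0 \<le> h t" for t using p01 by (simp add: h_def)
  have hm: "h \<in> borel_measurable borel"
  proof -
    have "h = (\<lambda>t. exp (- r * t) * (indicator {0..} t * p t))" by (auto simp: h_def fun_eq_iff)
    then show ?thesis using pm' by simp
  qed
  have hi: "integrable lborel h"
  proof (rule integrableI_bounded)
    have "(\<integral>\<^sup>+t. ennreal (norm (h t)) \<partial>lborel) \<le> (\<integral>\<^sup>+t. ennreal (exp (- r * t)) * indicator {0..} t \<partial>lborel)"
      using p01 by (intro nn_integral_mono) (auto simp: h_def mult_left_le split: split_indicator)
    also have "\<dots> = ennreal (0 - (- exp (- r * 0) / r))"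
    proof (rule nn_integral_FTC_atLeast)
      show "((\<lambda>t. - exp (- r * t) / r) \<longlongrightarrow> 0) at_top"
        using r by real_asymp
    qed (use r in \<open>auto intro!: derivative_eq_intros\<close>)
    finally show "(\<integral>\<^sup>+t. ennreal (norm (h t)) \<partial>lborel) < \<infinity>" by (rule le_less_trans) simp
  qed (use hm in simp)
  have eq: "(\<integral>t\<in>{0..}. exp (- r * t) * (\<integral>\<omega>. indicator U (u t \<omega>) \<partial>M) \<partial>lborel) = (\<integral>t. h t \<partial>lborel)"
    by (simp add: set_lebesgue_integral_def h_def p_def)
  have "(\<integral>t. h t \<partial>lborel) \<noteq> 0"
  proof
    assume "(\<integral>t. h t \<partial>lborel) = 0"
    then have "AE t in lborel. h t = 0" using integral_nonneg_eq_0_iff_AE[OF hi] h0 by simp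
    then have "AE t in lborel. (\<integral>\<^sup>+\<omega>. ennreal (I T (t, \<omega>)) \<partial>M) = 0"
    proof eventually_elim
      case (elim t)
      then have "indicator {0..T} t * p t = 0" by (auto simp: h_def split: split_indicator_asm split_indicator)
      moreover have "integrable M (\<lambda>\<omega>. I T (t, \<omega>))"
        using measurable_compose[OF measurable_Pair1'[of t borel M] I[OF T]]
        by (intro integrable_const_bound[where B = 1]) (auto simp: I_def split: split_indicator)
      ultimately show ?case
        unfolding pI by (subst nn_integral_eq_integral) (auto simp: I_def)
    qed
    then have "(\<integral>\<^sup>+t. (\<integral>\<^sup>+\<omega>. ennreal (I T (t, \<omega>)) \<partial>M) \<partial>lborel) = 0"
      by (subst nn_integral_cong_AE[where v = "\<lambda>_. 0"]) auto
    then have "(\<integral>\<^sup>+\<omega>. (\<integral>\<^sup>+t. ennreal (I T (t, \<omega>)) \<partial>lborel) \<partial>M) = 0"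
      using P.Fubini'[of "\<lambda>t \<omega>. ennreal (I T (t, \<omega>))"] I[OF T] by (simp add: case_prod_beta')
    moreover have "(\<lambda>\<omega>. \<integral>\<^sup>+t. ennreal (I T (t, \<omega>)) \<partial>lborel) \<in> borel_measurable M"
      using measurable_pair_swap[of "\<lambda>p. ennreal (I T p)" borel M] I[OF T]
      by (intro lborel.borel_measurable_nn_integral) (simp add: case_prod_beta')
    ultimately have "AE \<omega> in M. (\<integral>\<^sup>+t. ennreal (I T (t, \<omega>)) \<partial>lborel) = 0"
      by (subst (asm) nn_integral_0_iff_AE) auto
    then have "AE \<omega> in M. AE t in lborel. t \<in> {0..T} \<longrightarrow> u t \<omega> \<notin> U"
      using AE_space
    proof eventually_elim
      case (elim \<omega>)
      have "(\<lambda>t. I T (t, \<omega>)) \<in> borel_measurable borel"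
        using measurable_compose[OF measurable_Pair2'[OF elim(2), of borel] I[OF T]] by simp
      then have "AE t in lborel. ennreal (I T (t, \<omega>)) = 0"
        using elim(1) by (subst (asm) nn_integral_0_iff_AE) auto
      then show ?case by eventually_elim (auto simp: I_def ext_def split: split_indicator_asm)
    qed
    then show False using hit by contradiction
  qed
  moreover have "0 \<le> (\<integral>t. h t \<partial>lborel)" using h0 by simp
  ultimately show ?thesis unfolding eq by simp
qed

section \<open>Hitting a neighbourhood of the origin\<close>

lemma measurable_primitive_joint:
  assumes F: "(\<lambda>p. F (fst p) (snd p)) \<in> borel_measurable (borel \<Otimes>\<^sub>M M)"
  shows "(\<lambda>p. primitive (\<lambda>s. F s (snd p)) (fst p)) \<in> borel_measurable (borel \<Otimes>\<^sub>M M)"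
proof -
  have "(\<lambda>x. F (snd x) (snd (fst x))) \<in> borel_measurable ((borel \<Otimes>\<^sub>M M) \<Otimes>\<^sub>M lborel)"
  proof -
    have "(\<lambda>x. (snd x, snd (fst x))) \<in> measurable ((borel \<Otimes>\<^sub>M M) \<Otimes>\<^sub>M lborel) (borel \<Otimes>\<^sub>M M)"
      by simp
    from measurable_compose[OF this F] show ?thesis by simp
  qed
  moreover have "(\<lambda>x. indicator {0..fst (fst x)} (snd x) :: real) \<in> borel_measurable (((borel :: real measure) \<Otimes>\<^sub>M M) \<Otimes>\<^sub>M lborel)"
  proof -
    let ?N = "((borel :: real measure) \<Otimes>\<^sub>M M) \<Otimes>\<^sub>M (lborel :: real measure)"
    have s: "(\<lambda>x. snd x :: real) \<in> borel_measurable ?N"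
      using measurable_snd[of "(borel :: real measure) \<Otimes>\<^sub>M M" lborel] by simp
    have f: "(\<lambda>x. fst (fst x)) \<in> borel_measurable ?N" by simp
    note [measurable] = s f
    have "{x \<in> space ?N. 0 \<le> snd x \<and> snd x \<le> fst (fst x)} \<in> sets ?N" by measurable
    then show ?thesis unfolding indicator_def of_bool_def atLeastAtMost_iff by (intro measurable_If measurable_const) simp_all
  qed
  ultimately have "(\<lambda>x. indicator {0..fst (fst x)} (snd x) * F (snd x) (snd (fst x))) \<in> borel_measurable ((borel \<Otimes>\<^sub>M M) \<Otimes>\<^sub>M lborel)"
    by (rule borel_measurable_times[rotated])
  then show ?thesis
    unfolding primitive_eq by (intro lborel.borel_measurable_lebesgue_integral) (simp add: case_prod_beta')
qed

lemma sqrt_domain_measurable: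
  assumes \<mu>: "\<And>j. 0 \<le> \<mu> j"
  shows "sqrt_domain \<mu> e \<in> sets borel"
proof -
  have "sqrt_domain \<mu> e = {x \<in> space borel. (\<Sum>j. ennreal (\<mu> j * (x \<bullet> e j)\<^sup>2)) < \<infinity>}"
  proof -
    have "summable (\<lambda>j. \<mu> j * (x \<bullet> e j)\<^sup>2) \<longleftrightarrow> (\<Sum>j. ennreal (\<mu> j * (x \<bullet> e j)\<^sup>2)) < \<infinity>" for x
    proof
      assume "summable (\<lambda>j. \<mu> j * (x \<bullet> e j)\<^sup>2)"
      then show "(\<Sum>j. ennreal (\<mu> j * (x \<bullet> e j)\<^sup>2)) < \<infinity>"
        using \<mu> by (subst suminf_ennreal2) auto
    qed (use suminf_ennreal_finite_sums[of "\<lambda>j. \<mu> j * (x \<bullet> e j)\<^sup>2"] \<mu> in \<open>auto simp: sums_iff\<close>)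
    then show ?thesis by (simp add: sqrt_domain_def)
  qed
  also have "\<dots> \<in> sets borel" by measurable
  finally show ?thesis .
qed

lemma energy_finite:
  fixes u :: "real \<Rightarrow> shell_space"
  assumes e: "orthonormal_basis e" and \<mu>: "\<And>j. 0 \<le> \<mu> j"
    and V: "AE t in lborel. t \<in> {0..T} \<longrightarrow> u t \<in> sqrt_domain \<mu> e"
    and int: "set_integrable lborel {0..T} (\<lambda>t. (V_norm \<mu> e (u t))\<^sup>2)"
  shows "(\<integral>\<^sup>+t. (\<Sum>j. ennreal (\<mu> j * ((if t \<in> {0..T} then u t else 0) \<bullet> e j)\<^sup>2)) \<partial>lborel) < \<infinity>"
proof -
  have "(\<integral>\<^sup>+t. (\<Sum>j. ennreal (\<mu> j * ((if t \<in> {0..T} then u t else 0) \<bullet> e j)\<^sup>2)) \<partial>lborel)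
      \<le> (\<integral>\<^sup>+t. ennreal (norm (indicator {0..T} t *\<^sub>R (V_norm \<mu> e (u t))\<^sup>2)) \<partial>lborel)"
  proof (rule nn_integral_mono_AE, use V in eventually_elim)
    case (elim t)
    show ?case
    proof (cases "t \<in> {0..T}")
      case True
      then have "(\<Sum>j. ennreal (\<mu> j * (u t \<bullet> e j)\<^sup>2)) = ennreal ((norm (sqrt_op \<mu> e (u t)))\<^sup>2)"
        using elim \<mu> by (intro suminf_ennreal_sums norm_sqrt_op[OF e]) auto
      also have "\<dots> \<le> ennreal ((V_norm \<mu> e (u t))\<^sup>2)"
        by (intro ennreal_leI power_mono) (auto simp: V_norm_def)
      finally show ?thesis using True by simp
    next
      case False
      show ?thesis unfolding if_not_P[OF False] by simp
    qed
  qed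
  also have "\<dots> < \<infinity>" using int unfolding set_integrable_def integrable_iff_bounded by blast
  finally show ?thesis .
qed

text \<open>The constants are chosen in the order \<open>T\<close>, \<open>\<gamma>\<close>, \<open>N\<close>, \<open>\<rho>\<close>: the threshold \<open>\<gamma>\<close> depends on \<open>T\<close>, the tail
  \<open>j \<ge> N\<close> has to be small against \<open>\<gamma>\<close>, and \<open>\<rho>\<close> beats the finitely many weights \<open>\<mu> j\<close> with \<open>j < N\<close>.\<close>

lemma hitting_near_zero:
  fixes M :: "'w measure" and u :: "real \<Rightarrow> 'w \<Rightarrow> shell_space" and \<eta> :: "nat \<Rightarrow> 'w \<Rightarrow> (real \<times> real) measure"
  assumes M: "prob_space M" and e: "orthonormal_basis e" and \<mu>0: "0 < \<mu>0" and \<mu>: "\<And>j. \<mu>0 \<le> \<mu> j" and \<kappa>: "0 < \<kappa>"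
    and B: "condition_B \<mu> e B" and \<beta>: "summable (\<lambda>j. (\<beta> j)\<^sup>2)" and \<nu>: "jump_law \<nu>"
    and P: "\<And>k. poisson_random_measure M (jump_intensity \<nu>) (\<eta> k)"
    and ind: "prob_space.indep_sets M (\<lambda>k. random_measure_events M (\<eta> k) (sets (jump_intensity \<nu>))) UNIV"
    and L: "is_noise M \<nu> \<eta> \<beta> e L"
    and sol: "\<And>T. 0 < T \<Longrightarrow> is_solution M F \<mu> e \<kappa> B L \<xi> T u"
    and r: "0 < r" and U: "\<And>x. norm x < r \<Longrightarrow> x \<in> U"
  shows "\<exists>T>0. \<not> (AE \<omega> in M. AE t in lborel. t \<in> {0..T} \<longrightarrow> u t \<omega> \<notin> U)"
proof -
  interpret prob_space M by fact
  interpret JL: jump_law \<nu> by fact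
  note P = P[folded JL.J_def] and ind = ind[folded JL.J_def]
  note C_counts = poisson_counts_unconditioned[OF M P] and R_meas = poisson_random_measureD(1)[OF P]
  have \<mu>p: "0 < \<mu> j" "0 \<le> \<mu> j" for j using \<mu>0 \<mu>[of j] by linarith+
  obtain C where C: "0 < C" and tri: "\<And>x p q. p \<in> sqrt_domain \<mu> e \<Longrightarrow> (\<lambda>j. \<mu> j * ((x - p) \<bullet> e j)\<^sup>2) sums q \<Longrightarrow>
           \<bar>B x x p\<bar> \<le> C * norm x * sqrt q * norm p"
    using trilinear_bound[OF e \<mu>0 \<mu> B] by blast
  define T0 where "T0 = (4 * (norm \<xi>)\<^sup>2 + 1) / (2 * \<kappa> * \<mu>0) + 2 / \<mu>0"
  define T where "T = (T0 + 1) / r\<^sup>2"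
  have T0: "0 \<le> T0" using \<kappa> \<mu>0 by (simp add: T0_def)
  then have T: "0 < T" using r by (simp add: T_def)
  have T_large: "T0 < r\<^sup>2 * T" using r by (simp add: T_def)
  define \<gamma> where "\<gamma> = min 1 (min (1 / (64 * C\<^sup>2 * T)) (sqrt \<mu>0 / (4 * C)))"
  have \<gamma>: "0 < \<gamma>" "\<gamma> \<le> 1" using C T \<mu>0 by (auto simp: \<gamma>_def)
  have \<gamma>1: "8 * C\<^sup>2 * T * \<gamma> \<le> 1 / 8"
  proof -
    have "8 * C\<^sup>2 * T * \<gamma> \<le> 8 * C\<^sup>2 * T * (1 / (64 * C\<^sup>2 * T))"
      using C T by (intro mult_left_mono) (auto simp: \<gamma>_def)
    also have "\<dots> = 1 / 8" using C T by (simp add: field_simps)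
    finally show ?thesis .
  qed
  have \<gamma>2: "C * \<gamma> / sqrt \<mu>0 \<le> 1 / 4"
  proof -
    have "C * \<gamma> \<le> C * (sqrt \<mu>0 / (4 * C))" using C by (intro mult_left_mono) (auto simp: \<gamma>_def)
    also have "\<dots> = sqrt \<mu>0 / 4" using C by (simp add: field_simps)
    finally show ?thesis using \<mu>0 by (simp add: field_simps)
  qed
  define K where "K = JL.increment_const T"
  have K: "0 \<le> K" using T by (simp add: K_def JL.increment_const_def)
  define tailc where "tailc j = (\<beta> j)\<^sup>2 * K * T / \<kappa>" for j
  have tailc: "0 \<le> tailc j" for j using K T \<kappa> by (simp add: tailc_def)
  have "summable tailc"
    using summable_mult2[OF \<beta>, of "K * T / \<kappa>"] by (simp add: tailc_def[abs_def] mult_ac)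
  then have "(\<Sum>j. ennreal (tailc j)) < \<infinity>" using tailc by (subst suminf_ennreal2) auto
  from ennreal_suminf_tail_small[OF this, of "\<gamma> / 8"] \<gamma>
  obtain N where N: "(\<Sum>j. ennreal (tailc (j + N))) \<le> ennreal (\<gamma> / 8)" by auto
  define D where "D = (\<Sum>j<N. T * \<mu> j * (4 * (\<beta> j)\<^sup>2)) + 1"
  have D: "1 \<le> D" unfolding D_def using T \<mu>p by (simp add: sum_nonneg)
  define \<rho> where "\<rho> = \<gamma> / 8 / D"
  have \<rho>: "0 < \<rho>" using \<gamma> D by (simp add: \<rho>_def)
  from JL.quiet_event[OF M P ind e L T \<rho>, where N = N, folded K_def]
  obtain G where "G \<in> sets M" and G': "0 < emeasure M G \<and>
    (\<forall>j<N. \<forall>t\<in>{0..T}. (\<integral>\<^sup>+\<omega>. ennreal ((L t \<omega> \<bullet> e j)\<^sup>2) \<partial>uniform_measure M G) \<le> ennreal ((\<beta> j)\<^sup>2 * \<rho>)) \<and>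
    (\<forall>j\<ge>N. \<forall>s t. 0 \<le> s \<longrightarrow> s \<le> t \<longrightarrow> t \<le> T \<longrightarrow>
       (\<integral>\<^sup>+\<omega>. ennreal ((L t \<omega> \<bullet> e j - L s \<omega> \<bullet> e j)\<^sup>2) \<partial>uniform_measure M G) \<le> ennreal ((\<beta> j)\<^sup>2 * K * (t - s)))"
    by (rule bexE)
  then have G: "G \<in> sets M" "0 < emeasure M G" by simp_all
  have low: "(\<integral>\<^sup>+\<omega>. ennreal ((L t \<omega> \<bullet> e j)\<^sup>2) \<partial>uniform_measure M G) \<le> ennreal ((\<beta> j)\<^sup>2 * \<rho>)"
    if "j < N" "t \<in> {0..T}" for j t using G' that by simp
  have high: "(\<integral>\<^sup>+\<omega>. ennreal ((L t \<omega> \<bullet> e j - L s \<omega> \<bullet> e j)\<^sup>2) \<partial>uniform_measure M G) \<le> ennreal ((\<beta> j)\<^sup>2 * K * (t - s))"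
    if "N \<le> j" "0 \<le> s" "s \<le> t" "t \<le> T" for j s t using G' that by simp
  define Q where "Q = uniform_measure M G"
  note low = low[folded Q_def] and high = high[folded Q_def]
  have Q: "prob_space Q" unfolding Q_def using G by (intro prob_space_uniform_measure) auto
  interpret Q: prob_space Q by fact
  interpret PQ: pair_sigma_finite lborel Q ..
  have spQ: "space Q = space M" "sets Q = sets M" by (auto simp: Q_def)
  have AEQ: "AE \<omega> in Q. X \<omega>" if "AE \<omega> in M. X \<omega>" for X
    unfolding Q_def using that G by (intro AE_uniform_measureI) (auto elim: eventually_mono)
  have prodQ: "borel_measurable (borel \<Otimes>\<^sub>M Q) = borel_measurable (borel \<Otimes>\<^sub>M M)"
    using spQ by (intro measurable_cong_sets sets_pair_measure_cong) auto
  note solT = sol[OF T, unfolded is_solution_def]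
  define a where "a j = \<kappa> * \<mu> j" for j
  have a: "0 < a j" for j using \<kappa> \<mu>p by (simp add: a_def)
  (* Set to 0 off [0,T], so that path integrals are integrals over the line. *)
  define uu where "uu t \<omega> = (if t \<in> {0..T} then u t \<omega> else 0)" for t \<omega>
  have uum: "(\<lambda>p. uu (fst p) (snd p)) \<in> borel_measurable (borel \<Otimes>\<^sub>M M)"
    unfolding uu_def by (rule joint_extension[OF T]) (use solT in blast)
  have uu_path: "(\<lambda>t. uu t \<omega>) \<in> borel_measurable borel" if "\<omega> \<in> space M" for \<omega>
    using measurable_compose[OF measurable_Pair2'[OF that, of borel] uum] by simp
  have Bm: "(\<lambda>x. B x x (e j)) \<in> borel_measurable borel" for j
    by (rule borel_measurable_continuous_onI[OF continuous_trilinear_basis(2)[OF e B]])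
  define b where "b j s \<omega> = B (uu s \<omega>) (uu s \<omega>) (e j)" for j s \<omega>
  define f where "f j s \<omega> = a j * (uu s \<omega> \<bullet> e j) + b j s \<omega>" for j s \<omega>
  (* The noise coordinate, read off from the equation: unlike L itself it is jointly measurable. *)
  define m where "m j t \<omega> = indicator {0..T} t * (uu t \<omega> \<bullet> e j - \<xi> \<bullet> e j + primitive (\<lambda>s. f j s \<omega>) t)" for j t \<omega>
  define z where "z j t \<omega> = indicator {0..T} t * ou (a j) (\<lambda>s. m j s \<omega>) t" for j t \<omega>
  have fm: "(\<lambda>p. f j (fst p) (snd p)) \<in> borel_measurable (borel \<Otimes>\<^sub>M M)" for j
  proof -
    have "(\<lambda>p. uu (fst p) (snd p) \<bullet> e j) \<in> borel_measurable (borel \<Otimes>\<^sub>M M)" by (rule measurable_inner_const[OF uum])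
    moreover have "(\<lambda>p. b j (fst p) (snd p)) \<in> borel_measurable (borel \<Otimes>\<^sub>M M)"
      unfolding b_def by (rule measurable_compose[OF uum Bm])
    ultimately show ?thesis unfolding f_def by measurable
  qed
  have mm: "(\<lambda>p. m j (fst p) (snd p)) \<in> borel_measurable (borel \<Otimes>\<^sub>M M)" for j
  proof -
    have "(\<lambda>p. uu (fst p) (snd p) \<bullet> e j) \<in> borel_measurable (borel \<Otimes>\<^sub>M M)" by (rule measurable_inner_const[OF uum])
    then show ?thesis unfolding m_def using measurable_primitive_joint[OF fm[of j]] by measurable
  qed
  have zm: "(\<lambda>p. z j (fst p) (snd p)) \<in> borel_measurable (borel \<Otimes>\<^sub>M M)" for j
  proof -
    have eq: "primitive (\<lambda>s. exp (- a j * (t - s)) * m j s \<omega>) t = exp (- a j * t) * primitive (\<lambda>s. exp (a j * s) * m j s \<omega>) t" for t \<omega>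
      unfolding primitive_cmult[symmetric]
      by (rule primitive_cong) (simp add: right_diff_distrib mult.assoc[symmetric] flip: exp_add)
    have "(\<lambda>p. exp (a j * fst p) * m j (fst p) (snd p)) \<in> borel_measurable (borel \<Otimes>\<^sub>M M)" using mm[of j] by measurable
    note [measurable] = measurable_primitive_joint[of "\<lambda>s \<omega>. exp (a j * s) * m j s \<omega>", OF this] mm[of j]
    show ?thesis unfolding z_def ou_def eq by measurable
  qed
  have mt: "(\<lambda>\<omega>. m j t \<omega>) \<in> borel_measurable M" for j t
    using measurable_compose[OF measurable_Pair1'[of t borel M] mm[of j]] by simp
  have mtQ[measurable]: "(\<lambda>\<omega>. m j t \<omega>) \<in> borel_measurable Q" for j t
    using mt by (simp cong: measurable_cong_sets add: spQ)
  define good where "good \<omega> \<longleftrightarrow> \<omega> \<in> space M \<and> (AE t in lborel. t \<in> {0..T} \<longrightarrow> u t \<omega> \<in> sqrt_domain \<mu> e) \<and>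
      set_integrable lborel {0..T} (\<lambda>t. (V_norm \<mu> e (u t \<omega>))\<^sup>2)" for \<omega>
  have AEgood: "AE \<omega> in M. good \<omega>"
  proof -
    have "AE \<omega> in M. (AE t in lborel. t \<in> {0..T} \<longrightarrow> u t \<omega> \<in> sqrt_domain \<mu> e) \<and>
      set_integrable lborel {0..T} (\<lambda>t. (V_norm \<mu> e (u t \<omega>))\<^sup>2)" using solT by blast
    then show ?thesis using AE_space by eventually_elim (simp add: good_def)
  qed
  have uu0: "uu t \<omega> = 0" if "t \<notin> {0..T}" for t \<omega> unfolding uu_def using that by (rule if_not_P)
  have fin: "(\<integral>\<^sup>+t. (\<Sum>j. ennreal (\<mu> j * (uu t \<omega> \<bullet> e j)\<^sup>2)) \<partial>lborel) < \<infinity>" if "good \<omega>" for \<omega>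
    unfolding uu_def by (rule energy_finite[OF e \<mu>p(2)]) (use that in \<open>auto simp: good_def\<close>)
  have coord: "integrable lborel (\<lambda>t. (uu t \<omega> \<bullet> e j)\<^sup>2)" "integrable lborel (\<lambda>t. uu t \<omega> \<bullet> e j)"
    "integrable lborel (\<lambda>t. b j t \<omega>)" if "good \<omega>" for \<omega> j
    unfolding b_def using integrable_coordinates[OF e \<mu>0 \<mu> B uu_path uu0 fin[OF that]] that by (auto simp: good_def)
  have fi: "integrable lborel (\<lambda>s. f j s \<omega>)" if "good \<omega>" for \<omega> j
    unfolding f_def using coord[OF that] by simp
  have mi: "integrable lborel (\<lambda>s. (m j s \<omega>)\<^sup>2)" "integrable lborel (\<lambda>s. m j s \<omega>)" if g: "good \<omega>" for \<omega> j
  proof -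
    have mp[measurable]: "(\<lambda>t. m j t \<omega>) \<in> borel_measurable borel"
      using measurable_compose[OF measurable_Pair2'[of \<omega> M borel] mm[of j]] g by (simp add: good_def)
    define k where "k = \<bar>\<xi> \<bullet> e j\<bar> + (\<integral>s. \<bar>f j s \<omega>\<bar> \<partial>lborel)"
    have k0: "0 \<le> k" by (simp add: k_def)
    show sq: "integrable lborel (\<lambda>s. (m j s \<omega>)\<^sup>2)"
    proof (rule Bochner_Integration.integrable_bound)
      show "integrable lborel (\<lambda>s. 2 * (uu s \<omega> \<bullet> e j)\<^sup>2 + indicator {0..T} s * (2 * k\<^sup>2))"
        using coord(1)[OF g] by (intro Bochner_Integration.integrable_add integrable_mult_right integrable_mult_left integrable_real_indicator)
          (auto simp: emeasure_lborel_Icc_eq)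
      have "(m j s \<omega>)\<^sup>2 \<le> 2 * (uu s \<omega> \<bullet> e j)\<^sup>2 + indicator {0..T} s * (2 * k\<^sup>2)" for s
      proof (cases "s \<in> {0..T}")
        case True
        define x y where "x = uu s \<omega> \<bullet> e j" and "y = primitive (\<lambda>s. f j s \<omega>) s - \<xi> \<bullet> e j"
        have "\<bar>y\<bar> \<le> k" using abs_primitive_le[OF fi[OF g], of j s] unfolding y_def k_def by linarith
        then have "y\<^sup>2 \<le> k\<^sup>2" using k0 by (intro iffD1[OF abs_le_square_iff]) simp
        moreover have "(x + y)\<^sup>2 \<le> 2 * x\<^sup>2 + 2 * y\<^sup>2"
          using zero_le_power2[of "x - y"] unfolding power2_sum power2_diff by linarith
        moreover have "m j s \<omega> = x + y" using True by (simp add: m_def x_def y_def)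
        ultimately show ?thesis using True by (simp add: x_def)
      qed (simp add: m_def)
      then show "AE s in lborel. norm ((m j s \<omega>)\<^sup>2) \<le> norm (2 * (uu s \<omega> \<bullet> e j)\<^sup>2 + indicator {0..T} s * (2 * k\<^sup>2))"
        by (simp add: order_trans[OF _ abs_ge_self])
    qed simp
    show "integrable lborel (\<lambda>s. m j s \<omega>)"
      by (rule integrable_of_square[OF mp sq, of T]) (simp add: m_def indicator_def)
  qed
  have mL: "AE \<omega> in M. m j t \<omega> = L t \<omega> \<bullet> e j" if t: "t \<in> {0..T}" for j t
  proof -
    have "AE \<omega> in M. u t \<omega> \<bullet> e j = \<xi> \<bullet> e j
          - (\<integral>s\<in>{0..t}. (\<kappa> * V_operator \<mu> e (u s \<omega>) (e j) + B (u s \<omega>) (u s \<omega>) (e j)) \<partial>lborel)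
          + L t \<omega> \<bullet> e j"
      using solT t basis_in_sqrt_domain[OF e, of j \<mu>] by blast
    then show ?thesis using AEgood
    proof eventually_elim
      case (elim \<omega>)
      have w: "\<omega> \<in> space M" using elim(2) by (simp add: good_def)
      define V where "V = sqrt_domain \<mu> e"
      have [measurable]: "V \<in> sets borel" unfolding V_def by (rule sqrt_domain_measurable[OF \<mu>p(2)])
      note [measurable] = uu_path[OF w]
      have Vop: "V_operator \<mu> e x (e j) = (if x \<in> V then \<mu> j * (x \<bullet> e j) else 0)" for x
        using V_operator_basis[where \<mu> = \<mu> and x = x and k = j, OF e \<mu>p(2)] by (auto simp: V_def V_operator_def sqrt_op_def)
      have bm: "(\<lambda>s. b j s \<omega>) \<in> borel_measurable borel" unfolding b_def by (rule measurable_compose[OF uu_path[OF w] Bm])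
      have "(\<integral>s\<in>{0..t}. (\<kappa> * V_operator \<mu> e (u s \<omega>) (e j) + B (u s \<omega>) (u s \<omega>) (e j)) \<partial>lborel)
          = (\<integral>s. indicator {0..t} s * (\<kappa> * (if uu s \<omega> \<in> V then \<mu> j * (uu s \<omega> \<bullet> e j) else 0) + b j s \<omega>) \<partial>lborel)"
        unfolding set_lebesgue_integral_def Vop
        using t by (intro Bochner_Integration.integral_cong) (auto simp: uu_def b_def split: split_indicator)
      also have "\<dots> = (\<integral>s. indicator {0..t} s * f j s \<omega> \<partial>lborel)"
      proof (rule integral_cong_AE)
        have "AE s in lborel. s \<in> {0..T} \<longrightarrow> u s \<omega> \<in> V" using elim(2) by (simp add: good_def V_def)
        then show "AE s in lborel. indicator {0..t} s * (\<kappa> * (if uu s \<omega> \<in> V then \<mu> j * (uu s \<omega> \<bullet> e j) else 0) + b j s \<omega>)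
            = indicator {0..t} s * f j s \<omega>"
          by eventually_elim (use t in \<open>auto simp: f_def a_def uu_def split: split_indicator\<close>)
        show "(\<lambda>s. indicator {0..t} s * (\<kappa> * (if uu s \<omega> \<in> V then \<mu> j * (uu s \<omega> \<bullet> e j) else 0) + b j s \<omega>)) \<in> borel_measurable lborel"
          using bm by simp
        show "(\<lambda>s. indicator {0..t} s * f j s \<omega>) \<in> borel_measurable lborel"
          unfolding f_def using bm by simp
      qed
      finally show ?case using elim(1) t by (simp add: m_def uu_def primitive_eq)
    qed
  qed
  have zero: "AE \<omega> in M. m j 0 \<omega> = 0" for j
    using mL[of 0 j] JL.noise_coordinates[OF M R_meas C_counts e L order_refl, of j] T
    by (auto simp: JL.levy_path_def JL.jump_sum_def set_lebesgue_integral_def elim!: eventually_elim2)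
  (* For j < N both terms of (m t - m s)^2 \<le> 2 (m t)^2 + 2 (m s)^2 contribute 2 \<beta>_j^2 \<rho>. *)
  define c0 c1 where "c0 j = (if j < N then 4 * (\<beta> j)\<^sup>2 * \<rho> else 0)" and "c1 j = (if j < N then 0 else (\<beta> j)\<^sup>2 * K)" for j
  have c: "0 \<le> c0 j" "0 \<le> c1 j" for j using \<rho> K by (auto simp: c0_def c1_def)
  have lowm: "(\<integral>\<^sup>+\<omega>. ennreal ((m j t \<omega>)\<^sup>2) \<partial>Q) \<le> ennreal ((\<beta> j)\<^sup>2 * \<rho>)" if "j < N" "t \<in> {0..T}" for j t
  proof -
    have "(\<integral>\<^sup>+\<omega>. ennreal ((m j t \<omega>)\<^sup>2) \<partial>Q) = (\<integral>\<^sup>+\<omega>. ennreal ((L t \<omega> \<bullet> e j)\<^sup>2) \<partial>Q)"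
      using AEQ[OF mL[OF that(2), of j]] by (intro nn_integral_cong_AE) (auto elim!: eventually_mono)
    then show ?thesis using low[OF that] by simp
  qed
  have b1: "(\<integral>\<^sup>+\<omega>. ennreal ((m j t \<omega> - m j s \<omega>)\<^sup>2) \<partial>Q) \<le> ennreal (c0 j + c1 j * (t - s))"
    if st: "0 \<le> s" "s \<le> t" "t \<le> T" for j s t
  proof (cases "j < N")
    case True
    have "(\<integral>\<^sup>+\<omega>. ennreal ((m j t \<omega> - m j s \<omega>)\<^sup>2) \<partial>Q) \<le> (\<integral>\<^sup>+\<omega>. 2 * ennreal ((m j t \<omega>)\<^sup>2) + 2 * ennreal ((m j s \<omega>)\<^sup>2) \<partial>Q)"
    proof (rule nn_integral_mono)
      fix \<omega>
      have "(m j t \<omega> - m j s \<omega>)\<^sup>2 \<le> 2 * (m j t \<omega>)\<^sup>2 + 2 * (m j s \<omega>)\<^sup>2"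
        using zero_le_power2[of "m j t \<omega> + m j s \<omega>"] unfolding power2_sum power2_diff by linarith
      then have "ennreal ((m j t \<omega> - m j s \<omega>)\<^sup>2) \<le> ennreal (2 * (m j t \<omega>)\<^sup>2 + 2 * (m j s \<omega>)\<^sup>2)"
        by (rule ennreal_leI)
      also have "\<dots> = 2 * ennreal ((m j t \<omega>)\<^sup>2) + 2 * ennreal ((m j s \<omega>)\<^sup>2)" by (simp add: ennreal_mult)
      finally show "ennreal ((m j t \<omega> - m j s \<omega>)\<^sup>2) \<le> 2 * ennreal ((m j t \<omega>)\<^sup>2) + 2 * ennreal ((m j s \<omega>)\<^sup>2)" .
    qed
    also have "\<dots> = 2 * (\<integral>\<^sup>+\<omega>. ennreal ((m j t \<omega>)\<^sup>2) \<partial>Q) + 2 * (\<integral>\<^sup>+\<omega>. ennreal ((m j s \<omega>)\<^sup>2) \<partial>Q)"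
      by (simp add: nn_integral_add nn_integral_cmult)
    also have "\<dots> \<le> 2 * ennreal ((\<beta> j)\<^sup>2 * \<rho>) + 2 * ennreal ((\<beta> j)\<^sup>2 * \<rho>)"
      using st True by (intro add_mono mult_left_mono lowm) auto
    also have "\<dots> = ennreal (c0 j + c1 j * (t - s))"
    proof -
      have "2 * ennreal x + 2 * ennreal x = ennreal (4 * x)" if "0 \<le> x" for x
      proof -
        have "2 * ennreal x + 2 * ennreal x = ennreal (2 * x + 2 * x)"
          using that by (subst ennreal_plus) (auto simp: ennreal_mult)
        then show ?thesis by simp
      qed
      from this[of "(\<beta> j)\<^sup>2 * \<rho>"] show ?thesis using \<rho> True by (simp add: c0_def c1_def mult.assoc)
    qed
    finally show ?thesis .
  next
    case False
    have "(\<integral>\<^sup>+\<omega>. ennreal ((m j t \<omega> - m j s \<omega>)\<^sup>2) \<partial>Q) = (\<integral>\<^sup>+\<omega>. ennreal ((L t \<omega> \<bullet> e j - L s \<omega> \<bullet> e j)\<^sup>2) \<partial>Q)"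
      using AEQ[OF mL[of t j]] AEQ[OF mL[of s j]] st
      by (intro nn_integral_cong_AE) (auto elim!: eventually_elim2)
    also have "\<dots> \<le> ennreal ((\<beta> j)\<^sup>2 * K * (t - s))" using False st by (intro high) auto
    finally show ?thesis using False by (simp add: c0_def c1_def)
  qed
  have b0: "(\<integral>\<^sup>+\<omega>. ennreal ((m j t \<omega>)\<^sup>2) \<partial>Q) \<le> ennreal (c0 j + c1 j * t)" if t: "0 \<le> t" "t \<le> T" for j t
  proof -
    have "(\<integral>\<^sup>+\<omega>. ennreal ((m j t \<omega>)\<^sup>2) \<partial>Q) = (\<integral>\<^sup>+\<omega>. ennreal ((m j t \<omega> - m j 0 \<omega>)\<^sup>2) \<partial>Q)"
      using AEQ[OF zero[of j]] by (intro nn_integral_cong_AE) (auto elim!: eventually_mono)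
    then show ?thesis using b1[OF order_refl t, of j] by simp
  qed
  have zb: "(\<integral>\<^sup>+\<omega>. ennreal (\<mu> j * (z j t \<omega>)\<^sup>2) \<partial>Q) \<le> ennreal (\<mu> j * (c0 j + c1 j / a j)) * indicator {0..T} t" for j t
  proof (cases "t \<in> {0..T}")
    case True
    have "(\<integral>\<^sup>+\<omega>. ennreal ((ou (a j) (\<lambda>s. m j s \<omega>) t)\<^sup>2) \<partial>Q) \<le> ennreal (c0 j + c1 j / a j)"
    proof (rule ou_moment[OF Q a _ _ c])
      show "(\<lambda>p. m j (fst p) (snd p)) \<in> borel_measurable (borel \<Otimes>\<^sub>M Q)" unfolding prodQ by (rule mm)
      show "AE \<omega> in Q. integrable lborel (\<lambda>s. m j s \<omega>) \<and> integrable lborel (\<lambda>s. (m j s \<omega>)\<^sup>2)"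
        using AEQ[OF AEgood] by eventually_elim (intro conjI mi)
      show "0 \<le> t" "t \<le> T" using True by auto
      show "(\<integral>\<^sup>+\<omega>. ennreal ((m j t \<omega>)\<^sup>2) \<partial>Q) \<le> ennreal (c0 j + c1 j * t)" using True by (intro b0) auto
      show "(\<integral>\<^sup>+\<omega>. ennreal ((m j t \<omega> - m j s \<omega>)\<^sup>2) \<partial>Q) \<le> ennreal (c0 j + c1 j * (t - s))" if "0 \<le> s" "s \<le> t" for s
        using True that by (intro b1) auto
    qed
    then have le: "(\<integral>\<^sup>+\<omega>. ennreal ((z j t \<omega>)\<^sup>2) \<partial>Q) \<le> ennreal (c0 j + c1 j / a j)" using True by (simp add: z_def)
    have "(\<lambda>\<omega>. z j t \<omega>) \<in> borel_measurable M"
      using measurable_compose[OF measurable_Pair1'[of t borel M] zm[of j]] by simp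
    then have "(\<lambda>\<omega>. z j t \<omega>) \<in> borel_measurable Q" by (simp cong: measurable_cong_sets add: spQ)
    then have "(\<integral>\<^sup>+\<omega>. ennreal (\<mu> j * (z j t \<omega>)\<^sup>2) \<partial>Q) = ennreal (\<mu> j) * (\<integral>\<^sup>+\<omega>. ennreal ((z j t \<omega>)\<^sup>2) \<partial>Q)"
      using \<mu>p by (simp add: ennreal_mult nn_integral_cmult)
    also have "\<dots> \<le> ennreal (\<mu> j) * ennreal (c0 j + c1 j / a j)" by (intro mult_left_mono le) simp
    also have "\<dots> = ennreal (\<mu> j * (c0 j + c1 j / a j)) * indicator {0..T} t"
      using True \<mu>p by (simp add: ennreal_mult')
    finally show ?thesis .
  qed (simp add: z_def)
  define W where "W \<omega> = (\<integral>\<^sup>+t. (\<Sum>j. ennreal (\<mu> j * (z j t \<omega>)\<^sup>2)) \<partial>lborel)" for \<omega>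
  have EW: "(\<integral>\<^sup>+\<omega>. W \<omega> \<partial>Q) \<le> ennreal (\<gamma> / 4)"
  proof -
    have zQ: "(\<lambda>p. ennreal (\<mu> j * (z j (fst p) (snd p))\<^sup>2)) \<in> borel_measurable (lborel \<Otimes>\<^sub>M Q)" for j
    proof -
      have "(\<lambda>p. z j (fst p) (snd p)) \<in> borel_measurable (borel \<Otimes>\<^sub>M Q)" unfolding prodQ by (rule zm)
      then show ?thesis by simp
    qed
    have zQt: "(\<lambda>\<omega>. ennreal (\<mu> j * (z j t \<omega>)\<^sup>2)) \<in> borel_measurable Q" for j t
      using measurable_compose[OF measurable_Pair1'[of t lborel Q] zQ[of j]] by simp
    have "(\<integral>\<^sup>+\<omega>. W \<omega> \<partial>Q) = (\<integral>\<^sup>+t. (\<integral>\<^sup>+\<omega>. (\<Sum>j. ennreal (\<mu> j * (z j t \<omega>)\<^sup>2)) \<partial>Q) \<partial>lborel)"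
      unfolding W_def using PQ.Fubini'[of "\<lambda>t \<omega>. \<Sum>j. ennreal (\<mu> j * (z j t \<omega>)\<^sup>2)"] zQ by (simp add: case_prod_beta')
    also have "\<dots> \<le> (\<integral>\<^sup>+t. (\<Sum>j. ennreal (\<mu> j * (c0 j + c1 j / a j)) * indicator {0..T} t) \<partial>lborel)"
    proof (rule nn_integral_mono)
      fix t
      have "(\<integral>\<^sup>+\<omega>. (\<Sum>j. ennreal (\<mu> j * (z j t \<omega>)\<^sup>2)) \<partial>Q) = (\<Sum>j. \<integral>\<^sup>+\<omega>. ennreal (\<mu> j * (z j t \<omega>)\<^sup>2) \<partial>Q)"
        by (rule nn_integral_suminf[OF zQt])
      also have "\<dots> \<le> (\<Sum>j. ennreal (\<mu> j * (c0 j + c1 j / a j)) * indicator {0..T} t)"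
        by (intro suminf_le zb) auto
      finally show "(\<integral>\<^sup>+\<omega>. (\<Sum>j. ennreal (\<mu> j * (z j t \<omega>)\<^sup>2)) \<partial>Q)
          \<le> (\<Sum>j. ennreal (\<mu> j * (c0 j + c1 j / a j)) * indicator {0..T} t)" .
    qed
    also have "\<dots> = (\<Sum>j. ennreal (\<mu> j * (c0 j + c1 j / a j)) * ennreal T)"
      using T by (simp add: nn_integral_suminf nn_integral_cmult)
    also have "\<dots> = (\<Sum>j. ennreal (T * \<mu> j * (c0 j + c1 j / a j)))"
      using T by (intro suminf_cong) (simp add: ennreal_mult' mult_ac)
    also have "\<dots> = (\<Sum>j. ennreal (T * \<mu> (j + N) * (c0 (j + N) + c1 (j + N) / a (j + N)))) + (\<Sum>j<N. ennreal (T * \<mu> j * (c0 j + c1 j / a j)))"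
      by (rule suminf_offset) auto
    also have "(\<Sum>j. ennreal (T * \<mu> (j + N) * (c0 (j + N) + c1 (j + N) / a (j + N)))) = (\<Sum>j. ennreal (tailc (j + N)))"
    proof (intro suminf_cong arg_cong[where f = ennreal])
      fix j
      show "T * \<mu> (j + N) * (c0 (j + N) + c1 (j + N) / a (j + N)) = tailc (j + N)"
        using \<mu>p(1)[of "j + N"] \<kappa> by (simp add: c0_def c1_def a_def tailc_def)
    qed
    also have "(\<Sum>j<N. ennreal (T * \<mu> j * (c0 j + c1 j / a j))) = ennreal (\<Sum>j<N. T * \<mu> j * (c0 j + c1 j / a j))"
      using T \<mu>p(2) c less_imp_le[OF a]
      by (intro sum_ennreal mult_nonneg_nonneg add_nonneg_nonneg divide_nonneg_nonneg) auto
    also have "(\<Sum>j<N. T * \<mu> j * (c0 j + c1 j / a j)) = (\<Sum>j<N. T * \<mu> j * (4 * (\<beta> j)\<^sup>2)) * \<rho>"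
      unfolding sum_distrib_right by (rule sum.cong) (auto simp: c0_def c1_def)
    also have "(\<Sum>j. ennreal (tailc (j + N))) + ennreal ((\<Sum>j<N. T * \<mu> j * (4 * (\<beta> j)\<^sup>2)) * \<rho>) \<le> ennreal (\<gamma> / 8) + ennreal (\<gamma> / 8)"
    proof (intro add_mono N ennreal_leI)
      have "(\<Sum>j<N. T * \<mu> j * (4 * (\<beta> j)\<^sup>2)) * \<rho> \<le> D * \<rho>" using \<rho> by (intro mult_right_mono) (auto simp: D_def)
      also have "\<dots> = \<gamma> / 8" using D by (simp add: \<rho>_def)
      finally show "(\<Sum>j<N. T * \<mu> j * (4 * (\<beta> j)\<^sup>2)) * \<rho> \<le> \<gamma> / 8" .
    qed
    also have "\<dots> = ennreal (\<gamma> / 4)" using \<gamma> by (subst ennreal_plus[symmetric]) auto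
    finally show ?thesis .
  qed
  (* A path with small smoothed noise comes near 0 by the energy estimate. *)
  have Wsmall: "\<not> (AE t in lborel. t \<in> {0..T} \<longrightarrow> r \<le> norm (uu t \<omega>))" if g: "good \<omega>" and W: "W \<omega> \<le> ennreal (\<gamma> / 2)" for \<omega>
  proof (rule energy_estimate[where z = "\<lambda>j t. z j t \<omega>" and \<kappa> = \<kappa> and \<mu> = \<mu> and B = B and e = e and \<xi> = \<xi>,
        OF e \<mu>0 \<mu> \<kappa> B C tri T uu_path _ fin[OF g] _ _ \<gamma> \<gamma>1 \<gamma>2 _ _ r])
    show w: "\<omega> \<in> space M" using g by (simp add: good_def)
    show "uu t \<omega> = 0" if "t \<notin> {0..T}" for t using that by (rule uu0)
    show "(\<lambda>t. z j t \<omega>) \<in> borel_measurable borel" for j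
      using measurable_compose[OF measurable_Pair2'[OF w, of borel] zm[of j]] by simp
    show "z j t \<omega> = 0" if "t \<notin> {0..T}" for j t using that by (simp add: z_def)
    show "(\<integral>\<^sup>+t. (\<Sum>j. ennreal (\<mu> j * (z j t \<omega>)\<^sup>2)) \<partial>lborel) \<le> ennreal (\<gamma> / 2)" using W by (simp add: W_def)
    show "(4 * (norm \<xi>)\<^sup>2 + 1) / (2 * \<kappa> * \<mu>0) + 2 / \<mu>0 < r\<^sup>2 * T" using T_large by (simp add: T0_def)
    fix j t assume t: "t \<in> {0..T}"
    have zi: "integrable lborel (\<lambda>s. z j s \<omega>)" unfolding z_def by (rule ou_integrable[OF a mi(2)[OF g]])
    have "z j t \<omega> = m j t \<omega> - a j * primitive (ou (a j) (\<lambda>s. m j s \<omega>)) t"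
      using ou_equation[OF a _ _ mi(2)[OF g], of t T j j] t by (simp add: z_def)
    also have "primitive (ou (a j) (\<lambda>s. m j s \<omega>)) t = primitive (\<lambda>s. z j s \<omega>) t"
      using t by (intro primitive_cong) (auto simp: z_def)
    finally have z: "z j t \<omega> = m j t \<omega> - a j * primitive (\<lambda>s. z j s \<omega>) t" .
    have "primitive (\<lambda>s. \<kappa> * \<mu> j * (uu s \<omega> \<bullet> e j - z j s \<omega>) + B (uu s \<omega>) (uu s \<omega>) (e j)) t
        = primitive (\<lambda>s. f j s \<omega> - a j * z j s \<omega>) t"
      by (rule primitive_cong) (simp add: f_def a_def b_def algebra_simps)
    also have "\<dots> = primitive (\<lambda>s. f j s \<omega>) t - primitive (\<lambda>s. a j * z j s \<omega>) t"
      using fi[OF g] zi by (intro primitive_diff) auto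
    also have "\<dots> = primitive (\<lambda>s. f j s \<omega>) t - a j * primitive (\<lambda>s. z j s \<omega>) t"
      by (simp add: primitive_cmult)
    finally show "uu t \<omega> \<bullet> e j - z j t \<omega> = \<xi> \<bullet> e j
        - primitive (\<lambda>s. \<kappa> * \<mu> j * (uu s \<omega> \<bullet> e j - z j s \<omega>) + B (uu s \<omega>) (uu s \<omega>) (e j)) t"
      using z t by (simp add: m_def)
  qed
  have "\<not> (AE \<omega> in M. AE t in lborel. t \<in> {0..T} \<longrightarrow> u t \<omega> \<notin> U)"
  proof
    assume "AE \<omega> in M. AE t in lborel. t \<in> {0..T} \<longrightarrow> u t \<omega> \<notin> U"
    from AEQ[OF this] AEQ[OF AEgood] have "AE \<omega> in Q. ennreal (\<gamma> / 2) \<le> W \<omega>"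
    proof eventually_elim
      case (elim \<omega>)
      have "AE t in lborel. t \<in> {0..T} \<longrightarrow> r \<le> norm (uu t \<omega>)"
        using elim(1)
      proof eventually_elim
        case (elim t)
        then show ?case using U[of "u t \<omega>"] by (auto simp: uu_def not_le[symmetric])
      qed
      then show ?case using Wsmall[OF elim(2)] by (meson linear)
    qed
    then have "(\<integral>\<^sup>+\<omega>. ennreal (\<gamma> / 2) \<partial>Q) \<le> (\<integral>\<^sup>+\<omega>. W \<omega> \<partial>Q)" by (rule nn_integral_mono_AE)
    also note EW
    finally have "ennreal (\<gamma> / 2) \<le> ennreal (\<gamma> / 4)" by (simp add: Q.emeasure_space_1)
    then show False using \<gamma> by (simp add: ennreal_le_iff)
  qed
  then show ?thesis using T by blast
qed

theorem proposition3p8: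
  fixes M :: "'w measure" and F :: "real \<Rightarrow> 'w measure"
    and D :: "shell_space set" and A :: "shell_space \<Rightarrow> shell_space"
    and e :: "nat \<Rightarrow> shell_space" and k0 lam \<kappa> :: real and \<mu> \<beta> :: "nat \<Rightarrow> real"
    and B :: "shell_space \<Rightarrow> shell_space \<Rightarrow> shell_space \<Rightarrow> real"
    and \<nu> :: "real measure" and \<eta> :: "nat \<Rightarrow> 'w \<Rightarrow> (real \<times> real) measure"
    and L :: "real \<Rightarrow> 'w \<Rightarrow> shell_space"
    and u :: "shell_space \<Rightarrow> real \<Rightarrow> 'w \<Rightarrow> shell_space"
  defines "\<mu> \<equiv> shell_eigenvalue k0 lam"
  assumes "prob_space M" and "complete_measure M" and "usual_filtration M F"
    and "0 < \<kappa>"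
    and "condition_A D A k0 lam e"
    and "condition_B \<mu> e B"
    and "condition_N \<mu> \<beta>"
    and "driving_measures M F \<nu> \<eta>"
    and "condition_L \<nu>"
    and "condition_SD \<nu>"
    and "is_noise M \<nu> \<eta> \<beta> e L"
    and "\<And>\<xi> T. 0 < T \<Longrightarrow> is_solution M F \<mu> e \<kappa> B L \<xi> T (u \<xi>)"
  shows "accessible (solution_semigroup M u) 0"
proof -
  have k0: "0 < k0" and lam: "1 < lam" and e: "orthonormal_basis e"
    using assms(6) by (auto simp: condition_A_def)
  have \<mu>0: "0 < \<mu> 0" using k0 lam by (simp add: \<mu>_def shell_eigenvalue_def)
  have \<mu>: "\<mu> 0 \<le> \<mu> j" for j
    unfolding \<mu>_def shell_eigenvalue_def using k0 lam by (intro mult_left_mono power_increasing) auto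
  have \<beta>: "summable (\<lambda>j. (\<beta> j)\<^sup>2)"
    using summable_noise_coefficients[OF k0 lam] assms(8) by (simp add: \<mu>_def)
  have \<nu>: "jump_law \<nu>"
    using assms(9,10) by (intro jump_law_of_conditions) (auto simp: driving_measures_def)
  have P: "poisson_random_measure M (jump_intensity \<nu>) (\<eta> k)" for k
    using assms(9) by (auto simp: driving_measures_def)
  have ind: "prob_space.indep_sets M (\<lambda>k. random_measure_events M (\<eta> k) (sets (jump_intensity \<nu>))) UNIV"
    using assms(9) by (auto simp: driving_measures_def)
  show ?thesis
    unfolding accessible_def resolvent_def solution_semigroup_def
  proof (intro allI impI)
    fix r :: real and \<xi> :: shell_space and U :: "shell_space set"
    assume r: "0 < r" and U: "open U" "0 \<in> U"
    obtain d where d: "0 < d" "\<And>x. norm x < d \<Longrightarrow> x \<in> U"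
      using U open_dist by (metis dist_0_norm dist_commute)
    have "\<exists>T>0. \<not> (AE \<omega> in M. AE t in lborel. t \<in> {0..T} \<longrightarrow> u \<xi> t \<omega> \<notin> U)"
      by (rule hitting_near_zero[OF assms(2) e \<mu>0 \<mu> assms(5,7) \<beta> \<nu> P ind assms(12) assms(13) d])
    then obtain T where T: "0 < T" "\<not> (AE \<omega> in M. AE t in lborel. t \<in> {0..T} \<longrightarrow> u \<xi> t \<omega> \<notin> U)" by blast
    show "0 < (\<integral>t\<in>{0..}. exp (- r * t) * (\<integral>\<omega>. indicator U (u \<xi> t \<omega>) \<partial>M) \<partial>lborel)"
    proof (rule resolvent_positive[OF assms(2) _ U(1) r T])
      show "(\<lambda>(t, \<omega>). u \<xi> t \<omega>) \<in> borel_measurable (restrict_space borel {0..S} \<Otimes>\<^sub>M M)" if "0 < S" for S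
        using assms(13)[OF that, of \<xi>] unfolding is_solution_def by blast
    qed
  qed
qed

end
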